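(* For each integer $n\ge 3$ there is some $\epsilon=\epsilon_n>0$ such that $$\overline{N_{++}(n,\epsilon)}-\{V_n\}\ \subset\ \bigcup_{k=0}^{\infty}O(W_{nk}).$$
   Context: The parameter space of obtuse triangles is $\Delta=\{(x_1,x_2)\in\mathbb{R}^2: x_1>0,\ x_2>0,\ x_1+x_2<\pi/2\}$; the point $(x_1,x_2)$ represents the obtuse triangle (up to similarity) whose two small angles are $x_1$ and $x_2$ radians. Its sides are labelled $1,2,3$, where side $j$ is opposite the angle $x_j$ for $j=1,2$, and side $3$ is the longest side. A periodic billiard path in a triangle (unit speed motion, equal-angle reflections off the interiors of the sides, never hitting a vertex, closing up) has as its combinatorial type the periodic sequence of labels of the successive sides it hits. A finite word $W$ in $\{1,2,3\}$ is identified with the infinite periodic word obtained by repeating $W$. The orbit tile $O(W)\subset\Delta$ is the set of points whose corresponding triangle has a periodic billiard path of combinatorial type $W$. $V_n=(\pi/2n,\pi/2n)$, and $N_{++}(n,\epsilon)=\{V_n+(y_1,y_2): y_1>0,\ y_2>0,\ y_1^2+y_2^2<\epsilon^2\}$. An overline denotes closure in $\mathbb{R}^2$. The words $W_{nk}$ ($n=3,4,5,\ldots$, $k=0,1,2,\ldots$): exponents and juxtaposition denote repetition and concatenation of words. Put $$h=2(32)^{n-2},\quad H=2(32)^{n-1},\quad v=1(31)^{n-2},\quad u=1(31)^{n-1}.$$ Then $W_{nk}$ is the concatenation of the following four words, in this order: $$(h\,3\,v\,3)^{k+1}\,h\,3\,v;\qquad H\,3\,v\,(3\,h\,3\,v)^{k}\,3\,h;\qquad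 u\,3\,(h\,3\,v\,3)^{k}\,H;\qquad (v\,3\,h\,3)^{k+1}\,u .$$ For example $W_{30}=232313132323131\ 2323231313232\ 13131323232\ 1313232313131$, of length $52$. *)

theory Defs
  imports "HOL-Analysis.Analysis"
begin

section \<open>Triangles\<close>

definition obtuse_param_space :: "(real \<times> real) set" where
  "obtuse_param_space = {(x1, x2). x1 > 0 \<and> x2 > 0 \<and> x1 + x2 < pi / 2}"

definition vec_angle :: "complex \<Rightarrow> complex \<Rightarrow> real" where
  "vec_angle a b = arccos ((a \<bullet> b) / (norm a * norm b))"

text \<open>A triangle in the Euclidean plane (here \<^typ>\<open>complex\<close> with its real inner product) is given
  by its vertices \<open>A 1\<close>, \<open>A 2\<close>, \<open>A 3\<close>; other values of \<open>A\<close> are irrelevant.  The vertex \<open>A j\<close> is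
  the one opposite side \<open>j\<close>, so that for an obtuse triangle with small angles at \<open>A 1\<close> and \<open>A 2\<close>
  side 3 is the longest one.\<close>

definition triangle_with_angles :: "real \<times> real \<Rightarrow> (nat \<Rightarrow> complex) \<Rightarrow> bool" where
  "triangle_with_angles x A \<longleftrightarrow>
     \<not> collinear {A 1, A 2, A 3} \<and>
     vec_angle (A 2 - A 1) (A 3 - A 1) = fst x \<and>
     vec_angle (A 1 - A 2) (A 3 - A 2) = snd x"

definition triangle_interior :: "(nat \<Rightarrow> complex) \<Rightarrow> complex set" where
  "triangle_interior A = interior (convex hull {A 1, A 2, A 3})"

text \<open>The endpoints of side \<open>j\<close> are the two vertices other than \<open>A j\<close>: for \<open>j = 1, 2, 3\<close> the map
  \<open>j \<mapsto> j mod 3 + 1\<close> is the cyclic permutation \<open>1 \<mapsto> 2 \<mapsto> 3 \<mapsto> 1\<close>.\<close>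

definition side_start :: "(nat \<Rightarrow> complex) \<Rightarrow> nat \<Rightarrow> complex" where
  "side_start A j = A (j mod 3 + 1)"

definition side_end :: "(nat \<Rightarrow> complex) \<Rightarrow> nat \<Rightarrow> complex" where
  "side_end A j = A ((j + 1) mod 3 + 1)"

definition side_interior :: "(nat \<Rightarrow> complex) \<Rightarrow> nat \<Rightarrow> complex set" where
  "side_interior A j = open_segment (side_start A j) (side_end A j)"

text \<open>Reflection of the vector \<open>d\<close> in the line spanned by \<open>a\<close>.\<close>

definition reflect_vec :: "complex \<Rightarrow> complex \<Rightarrow> complex" where
  "reflect_vec a d = (2 * (d \<bullet> a) / (a \<bullet> a)) *\<^sub>R a - d"


section \<open>Billiard paths\<close>

text \<open>\<open>\<gamma>\<close> is the position as a function of time.  The times \<open>t i\<close> are the successive bounces, at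
  which \<open>\<gamma>\<close> hits the interior of side \<open>w i\<close>; between \<open>t i\<close> and \<open>t (i + 1)\<close> the motion is straight
  with unit velocity \<open>d i\<close> in the interior of the triangle.  Since every time lies between two
  bounces, the path never meets a vertex, and \<open>w\<close> lists all the sides hit.\<close>

definition billiard_path :: "(nat \<Rightarrow> complex) \<Rightarrow> (real \<Rightarrow> complex) \<Rightarrow> (int \<Rightarrow> nat) \<Rightarrow> bool" where
  "billiard_path A \<gamma> w \<longleftrightarrow>
     (\<exists>(t :: int \<Rightarrow> real) (d :: int \<Rightarrow> complex).
        strict_mono t \<and> (\<forall>s. \<exists>i. t i \<le> s \<and> s < t (i + 1)) \<and>
        (\<forall>i. norm (d i) = 1 \<and>
             (\<forall>s\<in>{t i..t (i + 1)}. \<gamma> s = \<gamma> (t i) + (s - t i) *\<^sub>R d i) \<and>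
             (\<forall>s\<in>{t i<..<t (i + 1)}. \<gamma> s \<in> triangle_interior A) \<and>
             w i \<in> {1, 2, 3} \<and> \<gamma> (t i) \<in> side_interior A (w i) \<and>
             d i = reflect_vec (side_end A (w i) - side_start A (w i)) (d (i - 1))))"

definition repeat_word :: "nat list \<Rightarrow> int \<Rightarrow> nat" where
  "repeat_word W i = W ! nat (i mod int (length W))"

text \<open>The path has to close up after some time, which need not be the time taken by a single copy
  of \<open>W\<close>: only the infinite word counts.\<close>

definition has_periodic_billiard_path :: "(nat \<Rightarrow> complex) \<Rightarrow> nat list \<Rightarrow> bool" where
  "has_periodic_billiard_path A W \<longleftrightarrow>
     W \<noteq> [] \<and>
     (\<exists>\<gamma> T. T > 0 \<and> (\<forall>s. \<gamma> (s + T) = \<gamma> s) \<and> billiard_path A \<gamma> (repeat_word W))"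

definition orbit_tile :: "nat list \<Rightarrow> (real \<times> real) set" where
  "orbit_tile W = {x \<in> obtuse_param_space.
     \<exists>A. triangle_with_angles x A \<and> has_periodic_billiard_path A W}"


section \<open>The points \<open>V n\<close> and the words \<open>W n k\<close>\<close>

definition V :: "nat \<Rightarrow> real \<times> real" where
  "V n = (pi / (2 * real n), pi / (2 * real n))"

definition N_pp :: "nat \<Rightarrow> real \<Rightarrow> (real \<times> real) set" where
  "N_pp n \<epsilon> = {V n + (y1, y2) | y1 y2. y1 > 0 \<and> y2 > 0 \<and> y1\<^sup>2 + y2\<^sup>2 < \<epsilon>\<^sup>2}"

definition word_power :: "nat list \<Rightarrow> nat \<Rightarrow> nat list" where
  "word_power w m = concat (replicate m w)"

definition word_h :: "nat \<Rightarrow> nat list" where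
  "word_h n = [2] @ word_power [3, 2] (n - 2)"

definition word_H :: "nat \<Rightarrow> nat list" where
  "word_H n = [2] @ word_power [3, 2] (n - 1)"

definition word_v :: "nat \<Rightarrow> nat list" where
  "word_v n = [1] @ word_power [3, 1] (n - 2)"

definition word_u :: "nat \<Rightarrow> nat list" where
  "word_u n = [1] @ word_power [3, 1] (n - 1)"

definition word_W :: "nat \<Rightarrow> nat \<Rightarrow> nat list" where
  "word_W n k = (let h = word_h n; H = word_H n; v = word_v n; u = word_u n in
     (word_power (h @ [3] @ v @ [3]) (k + 1) @ h @ [3] @ v) @
     (H @ [3] @ v @ word_power ([3] @ h @ [3] @ v) k @ [3] @ h) @
     (u @ [3] @ word_power (h @ [3] @ v @ [3]) k @ H) @
     (word_power (v @ [3] @ h @ [3]) (k + 1) @ u))"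

lemma word_W_3_0:
  "word_W 3 0 =
     [2,3,2,3,1,3,1,3,2,3,2,3,1,3,1] @ [2,3,2,3,2,3,1,3,1,3,2,3,2] @
     [1,3,1,3,1,3,2,3,2,3,2] @ [1,3,1,3,2,3,2,3,1,3,1,3,1]"
  by (simp add: word_W_def word_h_def word_H_def word_v_def word_u_def word_power_def
      numeral_eq_Suc)

end

theory Submission
  imports Defs
begin

text \<open>Reflecting the triangle in the sides that the path hits, instead of reflecting the path, turns a
billiard path into a straight line.  Here that line is the real axis, run through to the right,
and the triangle is placed accordingly.  A word closes up to a periodic path as soon as every
crossed side has its endpoints on the correct sides of the axis and the last unfolded triangle is
the first one moved to the right (\<open>orbit_tile_of_runs\<close>).  So for a given triangle one has to find
\<open>k\<close> and a line that separates the unfolded vertices on its left from those on its right.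

Let \<open>s\<close> and \<open>c\<close> be the sine and the cosine of \<open>pi / 2n\<close>.  A block of letters 2 and 3 turns the triangle
about the vertex \<open>A 1\<close>, a block of letters 1 and 3 about \<open>A 2\<close>; consecutive pivots are joined by a
copy of side 3, which has length 1, so that the pivots form a zigzag.  At \<open>V n\<close> the blocks \<open>h\<close> and
\<open>v\<close> turn the zigzag by the angle \<open>pi - pi / n\<close>: its upper vertices lie on one horizontal line and
its lower vertices on another, at distance \<open>s\<close>.  At the blocks \<open>H\<close> and \<open>u\<close> the angle is \<open>pi\<close>, and
there the zigzag climbs by \<open>s\<close>.  Hence the unfolding of \<open>W n k\<close> consists of four zones of about \<open>k\<close>
periods each, every one a level higher than the one before, and the separating line has slope
about \<open>s / (2 c k)\<close>.  The last upper vertices of a level and the first lower vertices of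
the next one have the same height; the line has to pass between them, through a gate of height
\<open>O(1 / k)\<close>.  At \<open>V n\<close>, for large \<open>k\<close>, no line passes through all four gates.

For a triangle at \<open>V n + (y1, y2)\<close> each zone is slightly curved and the angle at \<open>H\<close> and \<open>u\<close> is no
longer \<open>pi\<close>.  If \<open>y1\<close> and \<open>y2\<close> are of order \<open>1 / k^2\<close>, this moves the gates by the order \<open>1 / k\<close>
of their height.  Inside a zone nothing more has to be checked: the line rises relative to every
period of the zigzag, so that the upper vertices are critical at the end of the zone and the
lower ones at its beginning.  This leaves eight inequalities, two for each gate (\<open>runs_word_W\<close>).

Let \<open>k^2 (y1, y2)\<close> tend to \<open>(\<eta>1, \<eta>2)\<close>.  The heights of the gates, multiplied by \<open>k\<close>, have limits
which are linear in \<open>\<eta>1\<close> and \<open>\<eta>2\<close> (\<open>gate_limits\<close>), and the eight inequalities become the four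
hypotheses of \<open>eventually_in_tile\<close>.  They hold on the curve
\<open>2 n c (\<eta>1 + \<eta>2) + 2 c \<bar>\<eta>1 - \<eta>2\<bar> = s (2 n + 1) / (2 n + 2)\<close> (\<open>gate_inequalities\<close>), which meets every ray of
the closed quadrant.  Since \<open>(k + 1)^2 / k^2\<close> tends to 1, a small vector \<open>(y1, y2)\<close> can be scaled
by some \<open>k^2\<close> to a vector close to this curve (\<open>pinning_scale\<close>).  By compactness, a sequence of
points that tends to \<open>V n\<close> and avoids all the tiles would have a subsequence for which the
rescaled points converge to a point of the curve, and that is impossible.\<close>
section \<open>Unfolded triangles\<close>
text \<open>An unfolded triangle is determined by its orientation (1 if \<open>A 1\<close>, \<open>A 2\<close>, \<open>A 3\<close> are in
counterclockwise order, otherwise \<open>- 1\<close>) and by the images of \<open>A 1\<close> and \<open>A 2\<close>.\<close>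
type_synonym unfolded = "real \<times> complex \<times> complex"

text \<open>By the law of sines, this is the length of side 2 divided by that of side 3.\<close>
definition side_ratio :: "real \<Rightarrow> real \<Rightarrow> real" where
  "side_ratio x1 x2 = sin x2 / sin (x1 + x2)"

fun corner :: "real \<Rightarrow> real \<Rightarrow> unfolded \<Rightarrow> nat \<Rightarrow> complex" where
  "corner x1 x2 (s, p, q) m =
     (if m = 1 then p else if m = 2 then q
      else p + of_real (side_ratio x1 x2) * cis (s * x1) * (q - p))"

text \<open>Reflection in side 1 rotates \<open>A 1\<close> about \<open>A 2\<close> by twice the angle there, and similarly for side 2.
With these formulas a block of letters is a product of rotations about a fixed point.\<close>
fun flip :: "real \<Rightarrow> real \<Rightarrow> nat \<Rightarrow> unfolded \<Rightarrow> unfolded" where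
  "flip x1 x2 j (s, p, q) =
     (if j = 1 then (- s, q + cis (- 2 * s * x2) * (p - q), q)
      else if j = 2 then (- s, p, p + cis (2 * s * x1) * (q - p))
      else (- s, p, q))"

text \<open>The real axis leaves a counterclockwise triangle through side \<open>j\<close>, going to the right, if the end
of the side is above the axis and its start below.\<close>
definition crosses :: "real \<Rightarrow> real \<Rightarrow> nat \<Rightarrow> unfolded \<Rightarrow> bool" where
  "crosses x1 x2 j st \<longleftrightarrow> j \<in> {1, 2, 3} \<and>
     fst st * Im (side_end (corner x1 x2 st) j) > 0 \<and>
     fst st * Im (side_start (corner x1 x2 st) j) < 0"

fun shift :: "real \<Rightarrow> unfolded \<Rightarrow> unfolded" where
  "shift \<tau> (s, p, q) = (s, p + of_real \<tau>, q + of_real \<tau>)"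

text \<open>The isometry that carries an unfolded triangle back to the first one: the quotient is the
coordinate of the point relative to the edge from \<open>A 1\<close> to \<open>A 2\<close>, and it has to be conjugated if the
orientations differ.\<close>
fun fold_back :: "unfolded \<Rightarrow> unfolded \<Rightarrow> complex \<Rightarrow> complex" where
  "fold_back (s0, p0, q0) (s, p, q) z =
     p0 + (q0 - p0) * Complex (Re ((z - p) / (q - p))) (s * Im ((z - p) / (q - p)))"

text \<open>The velocity of the folded path in an unfolded triangle: the image of the vector 1.\<close>
fun fold_dir :: "unfolded \<Rightarrow> unfolded \<Rightarrow> complex" where
  "fold_dir (s0, p0, q0) (s, p, q) =
     (q0 - p0) * Complex (Re (1 / (q - p))) (s * Im (1 / (q - p)))"

text \<open>The point where the real axis meets side \<open>j\<close>; the axis is run through with unit speed, so that its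
real coordinate is also the time of the bounce.\<close>
definition crossing_time :: "real \<Rightarrow> real \<Rightarrow> nat \<Rightarrow> unfolded \<Rightarrow> real" where
  "crossing_time x1 x2 j st =
     (let a = side_end (corner x1 x2 st) j; b = side_start (corner x1 x2 st) j
      in Re a + Im a / (Im a - Im b) * (Re b - Re a))"

fun scaled_by :: "real \<Rightarrow> unfolded \<Rightarrow> bool" where
  "scaled_by l (s, p, q) \<longleftrightarrow> s \<in> {1, -1} \<and> norm (q - p) = l"

lemma sides_eq:
  "side_start A 1 = A 2" "side_start A (Suc 0) = A 2" "side_start A 2 = A 3" "side_start A 3 = A 1"
  "side_end A 1 = A 3" "side_end A (Suc 0) = A 3" "side_end A 2 = A 1" "side_end A 3 = A 2"
  by (simp_all add: side_start_def side_end_def flip: numeral_2_eq_2 numeral_3_eq_3)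

text \<open>The third vertex can be computed from either end of side 3.  This is what makes the two cases of
\<^const>\<open>flip\<close> fit together, and it is behind the symmetry that exchanges the labels 1 and 2.\<close>
lemma apex_from_both_ends:
  assumes "sin (x1 + x2) \<noteq> 0" "s \<in> {1, -1}"
  shows "p + of_real (side_ratio x1 x2) * cis (s * x1) * (q - p) =
         q + of_real (side_ratio x2 x1) * cis (- s * x2) * (p - q)"
proof -
  have "of_real (side_ratio x1 x2) * cis (s * x1) + of_real (side_ratio x2 x1) * cis (- s * x2) = 1"
    using assms
    by (auto simp: complex_eq_iff side_ratio_def add.commute[of x2 x1] sin_add
        simp flip: add_divide_distrib)
  then have "of_real (side_ratio x2 x1) * cis (- s * x2) = 1 - of_real (side_ratio x1 x2) * cis (s * x1)"
    by (simp add: algebra_simps)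
  then show ?thesis by (simp only:) (simp add: algebra_simps)
qed

lemma reflect_vec_eq:
  assumes "a \<noteq> 0"
  shows "reflect_vec a d = a * cnj (d / a)"
proof -
  have "a * cnj (d / a) * (a * cnj a) = a * a * cnj d" using assms by (simp add: field_simps)
  moreover have "reflect_vec a d * (a * cnj a) = a * a * cnj d"
  proof -
    have aa: "a * cnj a = of_real (a \<bullet> a)" by (simp add: complex_mult_cnj inner_complex_def power2_eq_square)
    have "a \<bullet> a \<noteq> 0" using assms by simp
    then have "reflect_vec a d * of_real (a \<bullet> a) = of_real (2 * (d \<bullet> a)) * a - d * of_real (a \<bullet> a)"
      by (simp add: reflect_vec_def scaleR_conv_of_real algebra_simps)
    also have "\<dots> = a * a * cnj d"
      by (simp add: complex_eq_iff inner_complex_def algebra_simps)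
    finally show ?thesis by (simp add: aa)
  qed
  ultimately show ?thesis using assms by (metis complex_cnj_zero_iff mult_eq_0_iff mult_right_cancel)
qed

lemma flip_corner:
  assumes "sin (x1 + x2) \<noteq> 0" "scaled_by l st" "j \<in> {1, 2, 3}" "m \<in> {1, 2, 3}" "m \<noteq> j"
  shows "corner x1 x2 (flip x1 x2 j st) m = corner x1 x2 st m"
proof (cases st)
  case (fields s p q)
  with assms have s: "s \<in> {1, -1}" by simp
  then have ns: "- s \<in> {1, -1}" by auto
  show ?thesis
  proof (cases "j = 1 \<and> m = 3")
    case True
    have "cis (- (- s) * x2) * cis (- 2 * s * x2) = cis (- s * x2)"
      by (simp add: cis_mult algebra_simps)
    then have *: "of_real (side_ratio x2 x1) * cis (- (- s) * x2) * (cis (- 2 * s * x2) * (p - q))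
        = of_real (side_ratio x2 x1) * cis (- s * x2) * (p - q)"
      by (metis mult.assoc)
    show ?thesis using True unfolding fields
      using apex_from_both_ends[OF assms(1) s, of p q] apex_from_both_ends[OF assms(1) ns, of "q + cis (- 2 * s * x2) * (p - q)" q] *
      by simp
  next
    case False
    show ?thesis
    proof (cases "j = 2 \<and> m = 3")
      case True
      have "cis (- s * x1) * cis (2 * s * x1) = cis (s * x1)" by (simp add: cis_mult algebra_simps)
      then show ?thesis using True unfolding fields by (simp add: mult.assoc)
    qed (use assms fields False in auto)
  qed
qed

lemma fold_back_corner:
  assumes "scaled_by l st" "l > 0"
  shows "fold_back (1, p0, q0) st (corner x1 x2 st m) = corner x1 x2 (1, p0, q0) m"
proof (cases st)
  case (fields s p q)
  with assms have "s \<in> {1, -1}" "q \<noteq> p" by auto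
  then show ?thesis unfolding fields
    by (auto simp: complex_eq_iff)
qed

lemma fold_back_line:
  "fold_back st0 st (of_real t) = fold_back st0 st (of_real t') + (t - t') *\<^sub>R fold_dir st0 st"
  by (cases st0; cases st)
     (simp add: complex_eq_iff algebra_simps diff_divide_distrib, simp add: divide_complex_def algebra_simps)

lemma fold_back_convex:
  assumes "u + v + w = 1"
  shows "fold_back st0 st (u *\<^sub>R a + v *\<^sub>R b + w *\<^sub>R c) =
    u *\<^sub>R fold_back st0 st a + v *\<^sub>R fold_back st0 st b + w *\<^sub>R fold_back st0 st c"
proof -
  obtain s0 p0 q0 s p q where st: "st0 = (s0, p0, q0)" "st = (s, p, q)" by (cases st0; cases st)
  define G where "G z = (q0 - p0) * Complex (Re (z / (q - p))) (s * Im (z / (q - p)))" for z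
  have G_add: "G (x + y) = G x + G y" for x y
    by (simp add: G_def add_divide_distrib complex_eq_iff algebra_simps)
  have G_scale: "G (r *\<^sub>R x) = r *\<^sub>R G x" for r x
  proof -
    have "r *\<^sub>R x / (q - p) = r *\<^sub>R (x / (q - p))" by (simp add: scaleR_conv_of_real)
    then show ?thesis unfolding G_def by (simp only:) (simp add: complex_eq_iff algebra_simps)
  qed
  have F: "fold_back st0 st z = p0 + G (z - p)" for z by (simp add: st G_def)
  have w: "u *\<^sub>R x + v *\<^sub>R x + w *\<^sub>R x = x" for x :: complex
    using assms by (metis scaleR_add_left scaleR_one)
  have "u *\<^sub>R a + v *\<^sub>R b + w *\<^sub>R c - p = u *\<^sub>R (a - p) + v *\<^sub>R (b - p) + w *\<^sub>R (c - p)"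
    using w[of p] by (simp add: algebra_simps)
  then have "fold_back st0 st (u *\<^sub>R a + v *\<^sub>R b + w *\<^sub>R c) =
      p0 + (u *\<^sub>R G (a - p) + v *\<^sub>R G (b - p) + w *\<^sub>R G (c - p))"
    by (simp only: F G_add G_scale)
  then show ?thesis using w[of p0] by (simp add: F algebra_simps)
qed

lemma norm_fold_dir:
  assumes "scaled_by l st" "l > 0" "norm (q0 - p0) = l"
  shows "norm (fold_dir (1, p0, q0) st) = 1"
proof (cases st)
  case (fields s p q)
  with assms have s: "s * s = 1" "norm (q - p) = l" by auto
  have "norm (Complex (Re z) (s * Im z)) = norm z" for z :: complex
    using s(1) by (simp add: cmod_def power_mult_distrib power2_eq_square)
  then show ?thesis using assms s unfolding fields by (simp add: norm_mult norm_divide)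
qed

lemma flip_scaled:
  assumes "scaled_by l st" shows "scaled_by l (flip x1 x2 j st)"
  using assms by (cases st) (auto simp: norm_mult norm_minus_commute)

text \<open>Folding back after one more reflection is folding back followed by the reflection in side \<open>j\<close> of the
first triangle, which gives the law of reflection.\<close>
lemma fold_dir_flip:
  assumes "sin (x1 + x2) \<noteq> 0" "side_ratio x1 x2 \<noteq> 0" "side_ratio x2 x1 \<noteq> 0"
    and "scaled_by l st" "l > 0" "q0 \<noteq> p0" "j \<in> {1, 2, 3}"
  defines "A \<equiv> corner x1 x2 (1, p0, q0)"
  shows "fold_dir (1, p0, q0) (flip x1 x2 j st) =
         reflect_vec (side_end A j - side_start A j) (fold_dir (1, p0, q0) st)"
proof (cases st)
  case (fields s p q)
  then have s: "s = 1 \<or> s = -1" and pq: "q \<noteq> p" using assms(4,5) by auto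
  define e where "e = q0 - p0"
  have e: "e \<noteq> 0" using assms(6) by (simp add: e_def)
  define \<kappa> where "\<kappa> = Complex (Re (1 / (q - p))) (s * Im (1 / (q - p)))"
  have dir: "fold_dir (1, p0, q0) st = e * \<kappa>" by (simp add: fields e_def \<kappa>_def)
  have refl: "reflect_vec (of_real r * (cis t * e)) (e * \<kappa>) = e * (cis (2 * t) * cnj \<kappa>)"
    if "r \<noteq> 0" for r t
  proof -
    have "reflect_vec (of_real r * (cis t * e)) (e * \<kappa>)
        = of_real r * (cis t * e) * cnj ((e * \<kappa>) / (of_real r * (cis t * e)))"
      using e that by (intro reflect_vec_eq) simp
    also have "(e * \<kappa>) / (of_real r * (cis t * e)) = \<kappa> / (of_real r * cis t)" using e by simp
    also have "of_real r * (cis t * e) * cnj (\<kappa> / (of_real r * cis t))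
        = e * (cis t / cnj (cis t) * cnj \<kappa>)" using that by (simp add: field_simps)
    also have "cis t / cnj (cis t) = cis (2 * t)"
      by (simp add: cis_cnj cis_divide)
    finally show ?thesis .
  qed
  have conj_inv: "Complex (Re (1 / (cis v * w))) (- s * Im (1 / (cis v * w))) =
      (if s = 1 then cis v * cnj (1 / w) else cis (- v) * (1 / w))" for v w
    using s by (auto simp: complex_eq_iff divide_complex_def cis_inverse inverse_mult_distrib)
  have cnjk: "cnj \<kappa> = (if s = 1 then cnj (1 / (q - p)) else 1 / (q - p))"
    using s by (auto simp: \<kappa>_def complex_eq_iff simp del: complex_cnj_divide)
  consider "j = 1" | "j = 2" | "j = 3" using assms(7) by auto
  then show ?thesis
  proof cases
    case 1
    have d: "side_end A j - side_start A j = of_real (side_ratio x2 x1) * (cis (- x2 + pi) * e)"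
      using apex_from_both_ends[OF assms(1), of 1 p0 q0] 1
      by (simp add: side_end_def side_start_def A_def e_def cis_mult[symmetric] algebra_simps
          del: add_uminus_conv_diff diff_conv_add_uminus)
    have c: "cis (2 * (- x2 + pi)) = cis (- 2 * x2)"
      using cis_mult[of "- 2 * x2" "2 * pi", symmetric] by (simp add: distrib_left)
    have qp: "q - (q + cis (- 2 * s * x2) * (p - q)) = cis (- 2 * s * x2) * (q - p)"
      by (simp add: algebra_simps)
    have "fold_dir (1, p0, q0) (flip x1 x2 j st) = e * Complex (Re (1 / (cis (- 2 * s * x2) * (q - p))))
        (- s * Im (1 / (cis (- 2 * s * x2) * (q - p))))"
      unfolding fields 1 by (simp only: flip.simps fold_dir.simps qp e_def simp_thms if_True)
    also have "\<dots> = e * (cis (- 2 * x2) * cnj \<kappa>)"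
      unfolding conj_inv cnjk using s by auto
    finally show ?thesis unfolding d dir refl[OF assms(3)] c .
  next
    case 2
    have d: "side_end A j - side_start A j = of_real (side_ratio x1 x2) * (cis (x1 + pi) * e)"
      using 2 by (simp add: side_end_def side_start_def A_def e_def cis_mult[symmetric] algebra_simps)
    have c: "cis (2 * (x1 + pi)) = cis (2 * x1)"
      using cis_mult[of "2 * x1" "2 * pi", symmetric] by (simp add: distrib_left)
    show ?thesis unfolding d dir refl[OF assms(2)] c
      using conj_inv[of "2 * s * x1" "q - p"] s
      by (auto simp: fields 2 e_def cnjk simp del: complex_cnj_divide)
  next
    case 3
    have d: "side_end A j - side_start A j = of_real 1 * (cis 0 * e)"
      using 3 by (simp add: side_end_def side_start_def A_def e_def)
    show ?thesis unfolding d dir refl[OF one_neq_zero]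
      using conj_inv[of 0 "q - p"] s
      by (auto simp: fields 3 e_def cnjk simp del: complex_cnj_divide)
  qed
qed


section \<open>From the unfolding to a billiard path\<close>
lemma crossing_point:
  assumes "crosses x1 x2 j st"
  obtains \<mu> where "0 < \<mu>" "\<mu> < 1"
    "of_real (crossing_time x1 x2 j st) =
      (1 - \<mu>) *\<^sub>R side_end (corner x1 x2 st) j + \<mu> *\<^sub>R side_start (corner x1 x2 st) j"
proof -
  define a b where "a = Im (side_end (corner x1 x2 st) j)" "b = Im (side_start (corner x1 x2 st) j)"
  have ab: "fst st * a > 0" "fst st * b < 0" using assms by (auto simp: crosses_def a_b_def)
  then have lt: "a > 0 \<and> b < 0 \<or> a < 0 \<and> b > 0"
    by (auto simp: zero_less_mult_iff mult_less_0_iff)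
  define \<mu> where "\<mu> = a / (a - b)"
  have 1: "0 < \<mu>" "\<mu> < 1" and 2: "a - b \<noteq> 0"
    using lt by (auto simp: \<mu>_def divide_simps)
  have 3: "(1 - \<mu>) * a + \<mu> * b = 0" using 2 by (simp add: \<mu>_def field_simps)
  have 4: "crossing_time x1 x2 j st = Re (side_end (corner x1 x2 st) j) +
      \<mu> * (Re (side_start (corner x1 x2 st) j) - Re (side_end (corner x1 x2 st) j))"
    by (simp add: crossing_time_def Let_def a_b_def \<mu>_def)
  show ?thesis
    by (rule that[OF 1], unfold 4) (use 3 in \<open>simp add: complex_eq_iff a_b_def algebra_simps\<close>)
qed

lemma crossing_order_upper:
  fixes hc hd he rc rd re :: real
  assumes "hc > 0" "hd < 0" "he < 0"
    and "(rc - re) * (hd - he) - (hc - he) * (rd - re) > 0"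
  shows "rc + hc / (hc - hd) * (rd - rc) < rc + hc / (hc - he) * (re - rc)"
proof -
  have "(re - rc) / (hc - he) - (rd - rc) / (hc - hd) =
     ((rc - re) * (hd - he) - (hc - he) * (rd - re)) / ((hc - he) * (hc - hd))"
    using assms by (simp add: field_simps)
  also have "\<dots> > 0" using assms by (intro divide_pos_pos mult_pos_pos) auto
  finally have "hc * ((rd - rc) / (hc - hd)) < hc * ((re - rc) / (hc - he))"
    using assms by (intro mult_strict_left_mono) auto
  then show ?thesis by simp
qed

lemma crossing_order_lower:
  fixes hc hd he rc rd re :: real
  assumes "hc < 0" "hd > 0" "he > 0"
    and "(rd - re) * (hc - he) - (hd - he) * (rc - re) > 0"
  shows "rc + hc / (hc - hd) * (rd - rc) < rc + hc / (hc - he) * (re - rc)"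
proof -
  have "- hc / (- hc - - h) = hc / (hc - h)" for h
    by (metis minus_diff_minus minus_divide_divide)
  then show ?thesis
    using crossing_order_upper[of "- hc" "- hd" "- he" rc re rd] assms
    by (simp add: algebra_simps)
qed

text \<open>The numbers \<open>r m\<close> and \<open>h m\<close> are the coordinates of vertex \<open>m\<close> of a counterclockwise triangle that the
axis enters through side \<open>j\<close>.  Two different sides share a vertex, and whether it is above or
below the axis, the orientation puts the entry to the left of the exit.\<close>
lemma crossing_order:
  fixes h r :: "nat \<Rightarrow> real"
  assumes orient: "(r 2 - r 1) * (h 3 - h 1) - (h 2 - h 1) * (r 3 - r 1) > 0"
    and j: "j \<in> {1, 2, 3}" "j' \<in> {1, 2, 3}"
    and entry: "h (j mod 3 + 1) > 0" "h ((j + 1) mod 3 + 1) < 0"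
    and exit: "h ((j' + 1) mod 3 + 1) > 0" "h (j' mod 3 + 1) < 0"
  defines "x \<equiv> \<lambda>a b. r a + h a / (h a - h b) * (r b - r a)"
  shows "j \<noteq> j'" "x ((j + 1) mod 3 + 1) (j mod 3 + 1) < x ((j' + 1) mod 3 + 1) (j' mod 3 + 1)"
proof -
  show "j \<noteq> j'" using entry exit by auto
  have sym: "x a b = x b a" if "h a > 0" "h b < 0" for a b
    using that unfolding x_def by (simp add: divide_simps) (simp add: algebra_simps)
  have up: "x c d < x c e"
    if "h c > 0" "h d < 0" "h e < 0" "(r c - r e) * (h d - h e) - (h c - h e) * (r d - r e) > 0" for c d e
    unfolding x_def using crossing_order_upper[OF that] by simp
  have low: "x c d < x c e"
    if "h c < 0" "h d > 0" "h e > 0" "(r d - r e) * (h c - h e) - (h d - h e) * (r c - r e) > 0" for c d e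
    unfolding x_def using crossing_order_lower[OF that] by simp
  consider "j = 1" "j' = 2" | "j = 1" "j' = 3" | "j = 2" "j' = 1" | "j = 2" "j' = 3"
    | "j = 3" "j' = 1" | "j = 3" "j' = 2" using j \<open>j \<noteq> j'\<close> by auto
  then show "x ((j + 1) mod 3 + 1) (j mod 3 + 1) < x ((j' + 1) mod 3 + 1) (j' mod 3 + 1)"
  proof cases
    case 1
    then have idx: "(j + 1) mod 3 + 1 = 3" "j mod 3 + 1 = 2"
      "(j' + 1) mod 3 + 1 = 1" "j' mod 3 + 1 = 3" by simp_all
    have "(r 2 - r 1) * (h 3 - h 1) - (h 2 - h 1) * (r 3 - r 1) > 0"
      using orient by (simp add: algebra_simps)
    then have "x 3 2 < x 3 1"
      using entry exit unfolding idx by (intro low) auto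
    then show ?thesis
      using entry exit sym[of 2 3] sym[of 1 3] unfolding idx by simp
  next
    case 2
    then have idx: "(j + 1) mod 3 + 1 = 3" "j mod 3 + 1 = 2"
      "(j' + 1) mod 3 + 1 = 2" "j' mod 3 + 1 = 1" by simp_all
    have "(r 2 - r 1) * (h 3 - h 1) - (h 2 - h 1) * (r 3 - r 1) > 0"
      using orient by (simp add: algebra_simps)
    then have "x 2 3 < x 2 1"
      using entry exit unfolding idx by (intro up) auto
    then show ?thesis
      using entry exit sym[of 2 3] sym[of 2 1] unfolding idx by simp
  next
    case 3
    then have idx: "(j + 1) mod 3 + 1 = 1" "j mod 3 + 1 = 3"
      "(j' + 1) mod 3 + 1 = 3" "j' mod 3 + 1 = 2" by simp_all
    have "(r 3 - r 2) * (h 1 - h 2) - (h 3 - h 2) * (r 1 - r 2) > 0"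
      using orient by (simp add: algebra_simps)
    then have "x 3 1 < x 3 2"
      using entry exit unfolding idx by (intro up) auto
    then show ?thesis
      using entry exit sym[of 3 1] sym[of 3 2] unfolding idx by simp
  next
    case 4
    then have idx: "(j + 1) mod 3 + 1 = 1" "j mod 3 + 1 = 3"
      "(j' + 1) mod 3 + 1 = 2" "j' mod 3 + 1 = 1" by simp_all
    have "(r 3 - r 2) * (h 1 - h 2) - (h 3 - h 2) * (r 1 - r 2) > 0"
      using orient by (simp add: algebra_simps)
    then have "x 1 3 < x 1 2"
      using entry exit unfolding idx by (intro low) auto
    then show ?thesis
      using entry exit sym[of 3 1] sym[of 2 1] unfolding idx by simp
  next
    case 5
    then have idx: "(j + 1) mod 3 + 1 = 2" "j mod 3 + 1 = 1"
      "(j' + 1) mod 3 + 1 = 3" "j' mod 3 + 1 = 2" by simp_all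
    have "(r 1 - r 3) * (h 2 - h 3) - (h 1 - h 3) * (r 2 - r 3) > 0"
      using orient by (simp add: algebra_simps)
    then have "x 2 1 < x 2 3"
      using entry exit unfolding idx by (intro low) auto
    then show ?thesis
      using entry exit sym[of 1 2] sym[of 3 2] unfolding idx by simp
  next
    case 6
    then have idx: "(j + 1) mod 3 + 1 = 2" "j mod 3 + 1 = 1"
      "(j' + 1) mod 3 + 1 = 1" "j' mod 3 + 1 = 3" by simp_all
    have "(r 1 - r 3) * (h 2 - h 3) - (h 1 - h 3) * (r 2 - r 3) > 0"
      using orient by (simp add: algebra_simps)
    then have "x 1 2 < x 1 3"
      using entry exit unfolding idx by (intro up) auto
    then show ?thesis
      using entry exit sym[of 1 2] sym[of 1 3] unfolding idx by simp
  qed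
qed

lemma crossing_time_flip:
  assumes "sin (x1 + x2) \<noteq> 0" "scaled_by l st" "j \<in> {1, 2, 3}"
  shows "crossing_time x1 x2 j (flip x1 x2 j st) = crossing_time x1 x2 j st"
    and "side_end (corner x1 x2 (flip x1 x2 j st)) j = side_end (corner x1 x2 st) j"
    and "side_start (corner x1 x2 (flip x1 x2 j st)) j = side_start (corner x1 x2 st) j"
proof -
  have "corner x1 x2 (flip x1 x2 j st) ((j + 1) mod 3 + 1) = corner x1 x2 st ((j + 1) mod 3 + 1)"
    "corner x1 x2 (flip x1 x2 j st) (j mod 3 + 1) = corner x1 x2 st (j mod 3 + 1)"
    using assms(3) by (auto simp: flip_corner[OF assms(1,2)])
  then show "crossing_time x1 x2 j (flip x1 x2 j st) = crossing_time x1 x2 j st"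
    "side_end (corner x1 x2 (flip x1 x2 j st)) j = side_end (corner x1 x2 st) j"
    "side_start (corner x1 x2 (flip x1 x2 j st)) j = side_start (corner x1 x2 st) j"
    by (simp_all add: crossing_time_def side_start_def side_end_def)
qed

text \<open>Consecutive crossings involve different sides and happen one after the other.  A clockwise
triangle is reduced to a counterclockwise one by multiplying the heights by \<open>s\<close>.\<close>
lemma crossing_time_less:
  assumes "sin (x1 + x2) \<noteq> 0" "side_ratio x1 x2 > 0" "sin x1 > 0"
    and "scaled_by l st" "l > 0"
    and "crosses x1 x2 j st" "crosses x1 x2 j' (flip x1 x2 j st)"
  shows "j \<noteq> j'" "crossing_time x1 x2 j st < crossing_time x1 x2 j' (flip x1 x2 j st)"
proof -
  define st' where "st' = flip x1 x2 j st"
  obtain s p q where st': "st' = (s, p, q)" by (cases st')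
  have s: "s = 1 \<or> s = -1" and nz: "norm (q - p) = l" and s': "fst st = - s"
    using flip_scaled[OF assms(4), of x1 x2 j] st'
    by (auto simp: st'_def[symmetric]) (cases st, auto simp: st'_def split: if_splits)+
  have j: "j \<in> {1,2,3}" "j' \<in> {1,2,3}" using assms(6,7) by (auto simp: crosses_def)
  define h r where "h m = s * Im (corner x1 x2 st' m)" "r m = Re (corner x1 x2 st' m)" for m
  have "(r 2 - r 1) * (h 3 - h 1) - (h 2 - h 1) * (r 3 - r 1)
      = side_ratio x1 x2 * (s * sin (s * x1)) * ((Re (q - p))\<^sup>2 + (Im (q - p))\<^sup>2)"
    by (simp add: h_r_def st' algebra_simps power2_eq_square)
  also have "(Re (q - p))\<^sup>2 + (Im (q - p))\<^sup>2 = l\<^sup>2" using nz by (metis cmod_power2)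
  also have "s * sin (s * x1) = sin x1" using s by auto
  finally have orient: "(r 2 - r 1) * (h 3 - h 1) - (h 2 - h 1) * (r 3 - r 1) > 0"
    using assms by simp
  note same = crossing_time_flip[OF assms(1,4) j(1)]
  have entry: "h (j mod 3 + 1) > 0" "h ((j + 1) mod 3 + 1) < 0"
    using assms(6) same s' unfolding crosses_def h_r_def
    by (simp_all add: side_start_def side_end_def st'_def)
  have exit: "h ((j' + 1) mod 3 + 1) > 0" "h (j' mod 3 + 1) < 0"
    using assms(7) st' unfolding crosses_def h_r_def st'_def[symmetric]
    by (simp_all add: side_start_def side_end_def)
  have s0: "s \<noteq> 0" using s by auto
  have ct: "crossing_time x1 x2 i st' =
      r ((i + 1) mod 3 + 1) + h ((i + 1) mod 3 + 1) / (h ((i + 1) mod 3 + 1) - h (i mod 3 + 1)) *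
       (r (i mod 3 + 1) - r ((i + 1) mod 3 + 1))" for i
    using s0 by (simp add: crossing_time_def Let_def side_start_def side_end_def h_r_def
        flip: right_diff_distrib)
  show "j \<noteq> j'" "crossing_time x1 x2 j st < crossing_time x1 x2 j' (flip x1 x2 j st)"
    using crossing_order[OF orient j entry exit] ct same(1) by (simp_all add: st'_def)
qed


lemma corner_shift: "corner x1 x2 (shift \<tau> st) m = corner x1 x2 st m + of_real \<tau>"
  by (cases st) simp

lemma crossing_time_shift: "crossing_time x1 x2 j (shift \<tau> st) = crossing_time x1 x2 j st + \<tau>"
  by (simp add: crossing_time_def Let_def side_start_def side_end_def corner_shift)

lemma fold_back_shift: "fold_back st0 (shift \<tau> st) (z + of_real \<tau>) = fold_back st0 st z"
  by (cases st0; cases st) simp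

lemma fold_back_crossing:
  assumes "sin (x1 + x2) \<noteq> 0" "scaled_by l st" "l > 0" "crosses x1 x2 j st"
    and A: "A = corner x1 x2 (1, p0, q0)" "side_start A j \<noteq> side_end A j"
  shows "fold_back (1, p0, q0) st (of_real (crossing_time x1 x2 j st)) \<in> side_interior A j"
    and "fold_back (1, p0, q0) (flip x1 x2 j st) (of_real (crossing_time x1 x2 j st)) =
         fold_back (1, p0, q0) st (of_real (crossing_time x1 x2 j st))"
proof -
  have j: "j \<in> {1, 2, 3}" using assms(4) by (simp add: crosses_def)
  note same = crossing_time_flip[OF assms(1,2) j]
  obtain \<mu> where \<mu>: "0 < \<mu>" "\<mu> < 1" "of_real (crossing_time x1 x2 j st) =
      (1 - \<mu>) *\<^sub>R side_end (corner x1 x2 st) j + \<mu> *\<^sub>R side_start (corner x1 x2 st) j"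
    using crossing_point[OF assms(4)] by blast
  have F: "fold_back (1, p0, q0) st' ((1 - \<mu>) *\<^sub>R side_end (corner x1 x2 st') j +
        \<mu> *\<^sub>R side_start (corner x1 x2 st') j) = (1 - \<mu>) *\<^sub>R side_end A j + \<mu> *\<^sub>R side_start A j"
    if "scaled_by l st'" for st'
    using fold_back_convex[of "1 - \<mu>" \<mu> 0 "(1, p0, q0)" st'
        "side_end (corner x1 x2 st') j" "side_start (corner x1 x2 st') j" 0]
    by (simp add: side_start_def side_end_def fold_back_corner[OF that assms(3)] A(1))
  have 1: "fold_back (1, p0, q0) st (of_real (crossing_time x1 x2 j st)) =
      (1 - \<mu>) *\<^sub>R side_end A j + \<mu> *\<^sub>R side_start A j"
    using F[OF assms(2)] by (simp add: \<mu>(3))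
  show "fold_back (1, p0, q0) (flip x1 x2 j st) (of_real (crossing_time x1 x2 j st)) =
         fold_back (1, p0, q0) st (of_real (crossing_time x1 x2 j st))"
    using F[OF flip_scaled[OF assms(2)], of x1 x2 j] 1 unfolding same \<mu>(3) by simp
  show "fold_back (1, p0, q0) st (of_real (crossing_time x1 x2 j st)) \<in> side_interior A j"
    unfolding 1 side_interior_def in_segment using A(2) \<mu>(1,2)
    by (intro conjI exI[of _ "1 - \<mu>"]) auto
qed

text \<open>A point strictly between two points on different sides has three positive barycentric
coordinates.\<close>
lemma between_sides_interior:
  assumes nc: "\<not> collinear {A 1, A 2, A 3}" and j: "j \<in> {1, 2, 3}" "j' \<in> {1, 2, 3}" "j \<noteq> j'"
    and P: "P \<in> side_interior A j" and Q: "Q \<in> side_interior A j'" and \<nu>: "0 < \<nu>" "\<nu> < 1"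
  shows "(1 - \<nu>) *\<^sub>R P + \<nu> *\<^sub>R Q \<in> triangle_interior A"
proof -
  obtain u where u: "0 < u" "u < 1" "P = (1 - u) *\<^sub>R side_start A j + u *\<^sub>R side_end A j"
    using P by (auto simp: side_interior_def in_segment)
  obtain v where v: "0 < v" "v < 1" "Q = (1 - v) *\<^sub>R side_start A j' + v *\<^sub>R side_end A j'"
    using Q by (auto simp: side_interior_def in_segment)
  define wt where "wt c m = (if m = c mod 3 + 1 then 1 else 0 :: real)" for c m :: nat
  have wt: "wt 1 m = (if m = 2 then 1 else 0)" "wt (Suc 0) m = (if m = 2 then 1 else 0)"
    "wt 2 m = (if m = 3 then 1 else 0)" "wt (Suc (Suc 0)) m = (if m = 3 then 1 else 0)"
    "wt 3 m = (if m = 1 then 1 else 0)" "wt 4 m = (if m = 2 then 1 else 0)" for m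
    by (auto simp: wt_def)
  define a where "a m = (1 - \<nu>) * ((1 - u) * wt j m + u * wt (j + 1) m)
      + \<nu> * ((1 - v) * wt j' m + v * wt (j' + 1) m)" for m
  consider "j = 1" "j' = 2" | "j = 1" "j' = 3" | "j = 2" "j' = 1" | "j = 2" "j' = 3"
    | "j = 3" "j' = 1" | "j = 3" "j' = 2" using j by auto
  then have "a 1 > 0 \<and> a 2 > 0 \<and> a 3 > 0"
    using u(1,2) v(1,2) \<nu> by cases (simp_all add: a_def wt add_pos_pos)
  moreover have "a 1 + a 2 + a 3 = 1 \<and>
      a 1 *\<^sub>R A 1 + a 2 *\<^sub>R A 2 + a 3 *\<^sub>R A 3 = (1 - \<nu>) *\<^sub>R P + \<nu> *\<^sub>R Q"
    using \<open>j \<in> {1, 2, 3}\<close> \<open>j' \<in> {1, 2, 3}\<close> \<open>j \<noteq> j'\<close>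
    by (elim insertE emptyE; simp add: a_def wt u(3) v(3) sides_eq; simp add: algebra_simps)
  ultimately have pos: "a 1 > 0" "a 2 > 0" "a 3 > 0" and sum1: "a 1 + a 2 + a 3 = 1"
    and eq: "a 1 *\<^sub>R A 1 + a 2 *\<^sub>R A 2 + a 3 *\<^sub>R A 3 = (1 - \<nu>) *\<^sub>R P + \<nu> *\<^sub>R Q" by blast+
  show ?thesis
    unfolding triangle_interior_def
    using pos sum1 eq by (subst interior_convex_hull_3_minimal[OF nc]) auto
qed

lemma corner_not_collinear:
  assumes "sin x1 \<noteq> 0" "side_ratio x1 x2 \<noteq> 0" "q0 \<noteq> p0"
  defines "A \<equiv> corner x1 x2 (1, p0, q0)"
  shows "\<not> collinear {A 1, A 2, A 3}"
proof
  assume "collinear {A 1, A 2, A 3}"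
  then obtain u where "\<forall>x\<in>{A 1, A 2, A 3}. \<forall>y\<in>{A 1, A 2, A 3}. \<exists>c. x - y = c *\<^sub>R u"
    unfolding collinear_def by blast
  then obtain c d where cd: "A 2 - A 1 = c *\<^sub>R u" "A 3 - A 1 = d *\<^sub>R u" by (meson insertI1 insertI2)
  define B where "B = (norm (q0 - p0))\<^sup>2"
  have "cnj (A 2 - A 1) * (A 3 - A 1) = of_real (side_ratio x1 x2) * cis x1 * of_real B"
    unfolding B_def complex_norm_square by (simp add: A_def algebra_simps)
  moreover have "Im (of_real (side_ratio x1 x2) * cis x1 * of_real B) = side_ratio x1 x2 * sin x1 * B"
    by simp
  moreover have "Im (cnj (A 2 - A 1) * (A 3 - A 1)) = 0" unfolding cd by (simp add: algebra_simps)
  ultimately have "side_ratio x1 x2 * sin x1 * (norm (q0 - p0))\<^sup>2 = 0" unfolding B_def by metis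
  then show False using assms by simp
qed

text \<open>The path runs along the axis; between the bounces \<open>i\<close> and \<open>i + 1\<close> it is inside the unfolded triangle
\<open>i + 1\<close> and is folded back from there.  At a bounce the two neighbouring triangles fold the point in the
same way, since they share the crossed side.\<close>
lemma billiard_path_of_unfolding:
  fixes st :: "int \<Rightarrow> unfolded" and w :: "int \<Rightarrow> nat"
  assumes ang: "0 < x1" "0 < x2" "x1 + x2 < pi"
    and sc: "\<And>i. scaled_by l (st i)" and l: "l > 0" "norm (q0 - p0) = l"
    and cr: "\<And>i. crosses x1 x2 (w i) (st i)" and fl: "\<And>i. st (i + 1) = flip x1 x2 (w i) (st i)"
    and per: "\<And>i. st (i + L) = shift \<tau> (st i)" "\<And>i. w (i + L) = w i" "L > 0" "\<tau> > 0"
  shows "\<exists>\<gamma>. (\<forall>s. \<gamma> (s + \<tau>) = \<gamma> s) \<and> billiard_path (corner x1 x2 (1, p0, q0)) \<gamma> w"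
proof -
  define A where "A = corner x1 x2 (1, p0, q0)"
  define t where "t i = crossing_time x1 x2 (w i) (st i)" for i
  define F where "F i z = fold_back (1, p0, q0) (st i) z" for i z
  have sin: "sin x1 > 0" "sin x2 > 0" "sin (x1 + x2) > 0" using ang by (auto intro!: sin_gt_zero)
  have ratio: "side_ratio x1 x2 > 0" "side_ratio x2 x1 > 0"
    using sin by (auto simp: side_ratio_def add.commute)
  have sin0: "sin (x1 + x2) \<noteq> 0" using sin by simp
  have pq: "q0 \<noteq> p0" using l by auto
  have wj: "w i \<in> {1, 2, 3}" for i using cr[of i] by (simp add: crosses_def)
  have nc: "\<not> collinear {A 1, A 2, A 3}"
    unfolding A_def using corner_not_collinear sin ratio pq by force
  then have dist: "A 1 \<noteq> A 2" "A 2 \<noteq> A 3" "A 3 \<noteq> A 1" by (auto simp: insert_commute)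
  have side_ne: "side_start A (w i) \<noteq> side_end A (w i)" for i
    using wj[of i] dist by (auto simp: sides_eq)
  have next_cr: "crosses x1 x2 (w (i + 1)) (flip x1 x2 (w i) (st i))" for i
    using cr[of "i + 1"] by (simp add: fl)
  have t_less: "t i < t (i + 1)" and w_ne: "w i \<noteq> w (i + 1)" for i :: int
    using crossing_time_less[OF sin0 ratio(1) sin(1) sc l(1) cr next_cr]
    by (simp_all add: t_def fl)
  have mono: "strict_mono t"
  proof (rule strict_monoI)
    fix i j :: int assume "i < j"
    then show "t i < t j" by (induction rule: int_gr_induct) (use t_less in \<open>auto intro: less_trans\<close>)
  qed
  have t_per: "t (i + L) = t i + \<tau>" for i by (simp add: t_def per crossing_time_shift)
  have t_per_mult: "t (i + int m * L) = t i + real m * \<tau>" for i m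
  proof (induction m)
    case (Suc m)
    have "t (i + int (Suc m) * L) = t ((i + int m * L) + L)" by (simp add: algebra_simps)
    also have "\<dots> = t i + real (Suc m) * \<tau>" unfolding t_per Suc.IH by (simp add: algebra_simps)
    finally show ?case .
  qed simp
  \<comment> \<open>The bounce times are unbounded in both directions because of the period.\<close>
  have cover: "\<exists>i. t i \<le> s \<and> s < t (i + 1)" for s
  proof -
    obtain m :: nat where m: "s - t 0 < real m * \<tau>" using reals_Archimedean3[OF per(4)] by blast
    obtain m' :: nat where m': "t 0 - s < real m' * \<tau>" using reals_Archimedean3[OF per(4)] by blast
    have up: "s < t (int m * L)" using t_per_mult[of 0 m] m by simp
    have low: "t (- (int m' * L)) \<le> s" using t_per_mult[of "- (int m' * L)" m'] m' by simp
    define I where "I = {- (int m' * L)..int m * L} \<inter> {i. t i \<le> s}"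
    have fin: "finite I" by (simp add: I_def)
    have mem: "- (int m' * L) \<in> I" using low per(3) by (simp add: I_def) (smt (verit) mult_nonneg_nonneg of_nat_0_le_iff)
    define i where "i = Max I"
    have "I \<noteq> {}" using mem by blast
    then have i: "i \<in> I" "\<And>j. j \<in> I \<Longrightarrow> j \<le> i" using fin by (simp_all add: i_def)
    have "i \<noteq> int m * L" using i(1) up by (auto simp: I_def)
    then have "i + 1 \<in> {- (int m' * L)..int m * L}" using i(1) by (auto simp: I_def)
    then have "s < t (i + 1)" using i(2)[of "i + 1"] by (force simp: I_def)
    then show ?thesis using i(1) by (auto simp: I_def)
  qed
  have unique: "i = j" if "t i \<le> s" "s < t (i + 1)" "t j \<le> s" "s < t (j + 1)" for i j s
  proof -
    have "t i < t (j + 1)" "t j < t (i + 1)" using that by linarith+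
    then show ?thesis by (simp add: strict_mono_less[OF mono])
  qed
  define idx where "idx s = (THE i. t i \<le> s \<and> s < t (i + 1))" for s
  have idx_eq: "idx s = i" if "t i \<le> s" "s < t (i + 1)" for s i
    unfolding idx_def by (rule the_equality) (use that unique in blast)+
  define \<gamma> where "\<gamma> s = F (idx s + 1) (of_real s)" for s
  have F_agree: "F (i + 1) (of_real (t i)) = F i (of_real (t i))"
    and F_side: "F i (of_real (t i)) \<in> side_interior A (w i)" for i
    using fold_back_crossing[OF sin0 sc l(1) cr A_def side_ne]
    by (simp_all add: F_def t_def fl)
  have on: "\<gamma> s = F (i + 1) (of_real s)" if "s \<in> {t i..t (i + 1)}" for s i
  proof (cases "s < t (i + 1)")
    case False
    then have s: "s = t (i + 1)" using that by simp
    then have "idx s = i + 1" using t_less[of "i + 1"] by (intro idx_eq) auto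
    then show ?thesis using F_agree[of "i + 1"] by (simp add: \<gamma>_def s)
  qed (use that idx_eq in \<open>simp add: \<gamma>_def\<close>)
  define d where "d i = fold_dir (1, p0, q0) (st (i + 1))" for i
  have start: "\<gamma> (t i) = F i (of_real (t i))" for i
    using on[of "t i" i] t_less[of i] F_agree[of i] by simp
  have line: "\<gamma> s = \<gamma> (t i) + (s - t i) *\<^sub>R d i" if "s \<in> {t i..t (i + 1)}" for s i
    using on[OF that] on[of "t i" i] t_less[of i]
      fold_back_line[of "(1, p0, q0)" "st (i + 1)" s "t i"]
    by (simp add: F_def d_def)
  have inner: "\<gamma> s \<in> triangle_interior A" if "s \<in> {t i<..<t (i + 1)}" for s i
  proof -
    define \<nu> where "\<nu> = (s - t i) / (t (i + 1) - t i)"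
    have \<nu>: "0 < \<nu>" "\<nu> < 1" using that by (auto simp: \<nu>_def divide_simps)
    have s: "s = (1 - \<nu>) * t i + \<nu> * t (i + 1)"
    proof -
      have "\<nu> * (t (i + 1) - t i) = s - t i" using that by (simp add: \<nu>_def)
      then show ?thesis by (simp add: algebra_simps)
    qed
    have "F (i + 1) (of_real s) = (1 - \<nu>) *\<^sub>R F (i + 1) (of_real (t i)) + \<nu> *\<^sub>R F (i + 1) (of_real (t (i + 1)))"
      using fold_back_convex[of "1 - \<nu>" \<nu> 0 "(1, p0, q0)" "st (i + 1)" "of_real (t i)" "of_real (t (i + 1))" 0]
      unfolding s F_def by (simp add: scaleR_conv_of_real)
    then have "\<gamma> s = (1 - \<nu>) *\<^sub>R F i (of_real (t i)) + \<nu> *\<^sub>R F (i + 1) (of_real (t (i + 1)))"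
      using on[of s i] that F_agree[of i] by simp
    then show ?thesis
      using between_sides_interior[OF nc wj wj w_ne F_side F_side \<nu>, of i] by simp
  qed
  have reflect: "d i = reflect_vec (side_end A (w i) - side_start A (w i)) (d (i - 1))" for i
    using fold_dir_flip[OF sin0 _ _ sc l(1) pq wj, of i i] ratio fl[of i] by (simp add: d_def A_def)
  have dnorm: "norm (d i) = 1" for i
    using norm_fold_dir[OF sc l] by (simp add: d_def)
  have "billiard_path A \<gamma> w"
    unfolding billiard_path_def
    by (intro exI[of _ t] exI[of _ d] conjI allI ballI mono cover dnorm inner wj reflect, erule line,
        assumption, unfold start, rule F_side)
  moreover have "\<gamma> (s + \<tau>) = \<gamma> s" for s
  proof -
    obtain i where i: "t i \<le> s" "s < t (i + 1)" using cover by blast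
    have "t (i + L + 1) = t (i + 1) + \<tau>" using t_per[of "i + 1"] by (simp add: algebra_simps)
    then have "idx (s + \<tau>) = i + L" using i t_per[of i] by (intro idx_eq) auto
    moreover have "st (i + L + 1) = shift \<tau> (st (i + 1))" using per(1)[of "i + 1"] by (simp add: algebra_simps)
    ultimately show ?thesis
      using fold_back_shift[of "(1, p0, q0)" \<tau> "st (i + 1)" "of_real s"] idx_eq[OF i]
      by (simp add: \<gamma>_def F_def)
  qed
  ultimately show ?thesis unfolding A_def by blast
qed

section \<open>Running a word along the unfolding\<close>
primrec runs :: "real \<Rightarrow> real \<Rightarrow> nat list \<Rightarrow> unfolded \<Rightarrow> unfolded \<Rightarrow> bool" where
  "runs x1 x2 [] st st' \<longleftrightarrow> st = st'"
| "runs x1 x2 (j # w) st st' \<longleftrightarrow> crosses x1 x2 j st \<and> runs x1 x2 w (flip x1 x2 j st) st'"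

lemma runs_append:
  "runs x1 x2 (u @ w) st st'' \<longleftrightarrow> (\<exists>st'. runs x1 x2 u st st' \<and> runs x1 x2 w st' st'')"
  by (induction u arbitrary: st) auto

lemma runs_appendI:
  "runs x1 x2 u st st' \<Longrightarrow> runs x1 x2 w st' st'' \<Longrightarrow> runs x1 x2 (u @ w) st st''"
  using runs_append by blast

lemma runs_nth:
  assumes "runs x1 x2 w st st'"
  shows "k < length w \<Longrightarrow> crosses x1 x2 (w ! k) (fold (flip x1 x2) (take k w) st)"
    and "fold (flip x1 x2) w st = st'"
  using assms
proof (induction w arbitrary: st k)
  case (Cons j w)
  { case 1 then show ?case using Cons.IH(1) by (cases k) auto }
  { case 2 then show ?case using Cons.IH(2) by auto }
qed auto

lemma flip_shift: "flip x1 x2 j (shift \<tau> st) = shift \<tau> (flip x1 x2 j st)"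
  by (cases st) simp

lemma crosses_shift: "crosses x1 x2 j (shift \<tau> st) = crosses x1 x2 j st"
proof -
  have "fst (shift \<tau> st) = fst st" by (cases st) simp
  then show ?thesis by (simp add: crosses_def side_start_def side_end_def corner_shift)
qed

lemma vec_angle_rotated:
  assumes "0 < x" "x < pi" "r > 0" "a \<noteq> 0"
  shows "vec_angle a (of_real r * cis x * a) = x" "vec_angle a (of_real r * cis (- x) * a) = x"
proof -
  have nz: "norm a * norm a \<noteq> 0" using assms by simp
  have sq: "norm a * norm a = (Re a)\<^sup>2 + (Im a)\<^sup>2" by (metis cmod_power2 power2_eq_square)
  have i: "a \<bullet> (of_real r * cis t * a) = r * cos t * (norm a * norm a)" for t
    unfolding sq by (simp add: inner_complex_def algebra_simps power2_eq_square)
  have "vec_angle a (of_real r * cis t * a) = arccos (cos t)" for t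
    unfolding vec_angle_def i using assms nz by (simp add: norm_mult)
  then show "vec_angle a (of_real r * cis x * a) = x" "vec_angle a (of_real r * cis (- x) * a) = x"
    using assms by (simp_all add: arccos_cos)
qed

lemma corner_triangle_with_angles:
  assumes "0 < x1" "0 < x2" "x1 + x2 < pi" "q \<noteq> p"
  shows "triangle_with_angles (x1, x2) (corner x1 x2 (1, p, q))"
proof -
  have sin: "sin x1 > 0" "sin x2 > 0" "sin (x1 + x2) > 0" using assms by (auto intro!: sin_gt_zero)
  have ratio: "side_ratio x1 x2 > 0" "side_ratio x2 x1 > 0"
    using sin by (auto simp: side_ratio_def add.commute)
  have "\<not> collinear {corner x1 x2 (1, p, q) 1, corner x1 x2 (1, p, q) 2, corner x1 x2 (1, p, q) 3}"
    using corner_not_collinear[of x1 x2 q p] sin ratio assms(4) by simp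
  moreover have "vec_angle (q - p) (of_real (side_ratio x1 x2) * cis x1 * (q - p)) = x1"
    using assms ratio by (intro vec_angle_rotated) auto
  moreover have "vec_angle (p - q) (of_real (side_ratio x2 x1) * cis (- x2) * (p - q)) = x2"
    using assms ratio by (intro vec_angle_rotated) auto
  moreover have "corner x1 x2 (1, p, q) 3 - q = of_real (side_ratio x2 x1) * cis (- x2) * (p - q)"
    using apex_from_both_ends[of x1 x2 1 p q] sin by simp
  ultimately show ?thesis by (simp add: triangle_with_angles_def)
qed

text \<open>If one copy of the word moves the triangle by \<open>\<tau>\<close> along the axis, then the word can be repeated
forever in both directions, each copy shifted by \<open>\<tau>\<close>.\<close>
lemma orbit_tile_of_runs:
  assumes x: "(x1, x2) \<in> obtuse_param_space" and W: "W \<noteq> []" and "\<tau> > 0" "q \<noteq> p"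
    and run: "runs x1 x2 W (1, p, q) (1, p + of_real \<tau>, q + of_real \<tau>)"
  shows "(x1, x2) \<in> orbit_tile W"
proof -
  have ang: "0 < x1" "0 < x2" "x1 + x2 < pi" using x pi_gt_zero by (auto simp: obtuse_param_space_def)
  define L where "L = int (length W)"
  have L: "L > 0" using W by (simp add: L_def)
  define st0 where "st0 = (1 :: real, p, q)"
  \<comment> \<open>The triangles of the first copy of the word.\<close>
  define part where "part k = fold (flip x1 x2) (take k W) st0" for k
  define st where "st i = shift (of_int (i div L) * \<tau>) (part (nat (i mod L)))" for i
  have shift_shift: "shift a (shift b u) = shift (a + b) u" for a b u
    by (cases u) simp
  have part_last: "part (length W) = shift \<tau> (part 0)"
    using runs_nth(2)[OF run] by (simp add: part_def st0_def)
  have part_Suc: "part (Suc k) = flip x1 x2 (W ! k) (part k)" if "k < length W" for k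
    using that by (simp add: part_def take_Suc_conv_app_nth)
  have part_crosses: "crosses x1 x2 (W ! k) (part k)" if "k < length W" for k
    using runs_nth(1)[OF run that] by (simp add: part_def st0_def)
  have "scaled_by (norm (q - p)) (fold (flip x1 x2) w st0)" for w
    by (induction w rule: rev_induct) (auto simp: st0_def intro!: flip_scaled)
  then have scaled: "scaled_by (norm (q - p)) (st i)" for i
    unfolding st_def part_def by (cases "fold (flip x1 x2) (take (nat (i mod L)) W) st0") (metis shift.simps scaled_by.simps add_diff_cancel_right)
  have in_range: "nat (i mod L) < length W" for i
    using L by (simp add: L_def nat_less_iff)
  have cr: "crosses x1 x2 (repeat_word W i) (st i)" for i
    using part_crosses[OF in_range] by (simp add: st_def crosses_shift repeat_word_def L_def)
  have fl: "st (i + 1) = flip x1 x2 (repeat_word W i) (st i)" for i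
  proof -
    have "flip x1 x2 (repeat_word W i) (st i) = shift (of_int (i div L) * \<tau>) (part (Suc (nat (i mod L))))"
      using part_Suc[OF in_range] by (simp add: st_def flip_shift repeat_word_def L_def)
    also have "\<dots> = st (i + 1)"
    proof (cases "i mod L = L - 1")
      case True
      have i: "i + 1 = (i div L + 1) * L + 0" using True div_mult_mod_eq[of i L] unfolding distrib_right by linarith
      have "(i + 1) div L = i div L + 1" "(i + 1) mod L = 0"
        unfolding i using L by simp_all
      moreover have "Suc (nat (i mod L)) = length W"
        unfolding True using W by (cases W) (simp_all add: L_def)
      ultimately show ?thesis
        by (simp add: st_def part_last shift_shift algebra_simps)
    next
      case False
      then have lt: "i mod L + 1 < L" "0 \<le> i mod L" using L pos_mod_bound[OF L, of i] by (smt (verit) pos_mod_sign)+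
      have i: "i + 1 = L * (i div L) + (i mod L + 1)" by simp
      have "(i + 1) div L = i div L" "(i + 1) mod L = i mod L + 1"
        using int_div_pos_eq[OF i] int_mod_pos_eq[OF i] lt by simp_all
      then show ?thesis using lt by (simp add: st_def nat_add_distrib)
    qed
    finally show ?thesis by simp
  qed
  have per: "st (i + L) = shift \<tau> (st i)" "repeat_word W (i + L) = repeat_word W i" for i
    using L by (simp_all add: st_def shift_shift repeat_word_def L_def algebra_simps)
  have "\<exists>\<gamma>. (\<forall>s. \<gamma> (s + \<tau>) = \<gamma> s) \<and> billiard_path (corner x1 x2 (1, p, q)) \<gamma> (repeat_word W)"
    by (rule billiard_path_of_unfolding[where st = st and l = "norm (q - p)" and L = L])
       ((rule ang scaled cr fl L per assms(3) | simp add: assms(4))+)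
  then have "has_periodic_billiard_path (corner x1 x2 (1, p, q)) W"
    using W assms(3) unfolding has_periodic_billiard_path_def by blast
  then show ?thesis
    using x corner_triangle_with_angles[OF ang assms(4)] unfolding orbit_tile_def by blast
qed

text \<open>Half of the fans turn about \<open>A 2\<close>, and some of them are below the axis.  These cases are reduced to fans
about \<open>A 1\<close> above the axis by two symmetries: exchanging the labels 1 and 2, which reverses the
orientation, and complex conjugation.\<close>
definition relabel :: "nat \<Rightarrow> nat" where
  "relabel j = (if j = 1 then 2 else if j = 2 then 1 else j)"

lemma runs_relabel:
  assumes "sin (x1 + x2) \<noteq> 0" "s \<in> {1, -1}" "runs x1 x2 w (s, p, q) (s', p', q')"
  shows "runs x2 x1 (map relabel w) (- s, q, p) (- s', q', p')"
  using assms(2,3)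
proof (induction w arbitrary: s p q)
  case (Cons j w)
  have j: "j \<in> {1, 2, 3}" and cr: "crosses x1 x2 j (s, p, q)" using Cons.prems by (auto simp: crosses_def)
  have c3: "corner x2 x1 (- s, q, p) 3 = corner x1 x2 (s, p, q) 3"
    using apex_from_both_ends[OF assms(1) Cons.prems(1), of p q] by simp
  have "crosses x2 x1 (relabel j) (- s, q, p)"
    using cr j c3 by (auto simp: crosses_def relabel_def sides_eq simp del: corner.simps) auto
  moreover obtain a b where fl: "flip x1 x2 j (s, p, q) = (- s, a, b)"
    "flip x2 x1 (relabel j) (- s, q, p) = (s, b, a)"
    using j by (auto simp: relabel_def)
  moreover have "runs x2 x1 (map relabel w) (s, b, a) (- s', q', p')"
    using Cons.IH[of "- s" a b] Cons.prems fl by auto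
  ultimately show ?case by simp
qed auto

lemma runs_mirror:
  assumes "runs x1 x2 w (s, p, q) (s', p', q')"
  shows "runs x1 x2 w (- s, cnj p, cnj q) (- s', cnj p', cnj q')"
  using assms
proof (induction w arbitrary: s p q)
  case (Cons j w)
  have j: "j \<in> {1, 2, 3}" and cr: "crosses x1 x2 j (s, p, q)" using Cons.prems by (auto simp: crosses_def)
  have c: "corner x1 x2 (- s, cnj p, cnj q) m = cnj (corner x1 x2 (s, p, q) m)" for m
    by (simp add: cis_cnj)
  have "crosses x1 x2 j (- s, cnj p, cnj q)"
    using cr j by (auto simp: crosses_def sides_eq c simp del: corner.simps)
  moreover obtain a b where fl: "flip x1 x2 j (s, p, q) = (- s, a, b)"
    "flip x1 x2 j (- s, cnj p, cnj q) = (s, cnj a, cnj b)"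
    using j by (auto simp: cis_cnj)
  moreover have "runs x1 x2 w (s, cnj a, cnj b) (- s', cnj p', cnj q')"
    using Cons.IH[of "- s" a b] Cons.prems fl by auto
  ultimately show ?case by simp
qed auto

section \<open>Fans about a pivot\<close>
text \<open>The word \<open>(23)^M\<close> rotates the triangle about \<open>p\<close>, which has to stay above the axis.  The vertices
opposite to \<open>p\<close> lie in the directions \<open>- cis (\<psi> + i x1)\<close> from \<open>p\<close>; for even \<open>i\<close> it is \<open>A 2\<close> at
distance 1, for odd \<open>i\<close> it is \<open>A 3\<close> at distance \<^term>\<open>side_ratio x1 x2\<close>.\<close>
lemma fan:
  assumes "Im p > 0"
    and "\<And>i. i < M \<Longrightarrow> Im p < side_ratio x1 x2 * sin (\<psi> + real (2 * i + 1) * x1)"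
    and "\<And>i. i < M \<Longrightarrow> Im p < sin (\<psi> + real (2 * i + 2) * x1)"
  shows "runs x1 x2 (word_power [2, 3] M) (1, p, p - cis \<psi>) (1, p, p - cis (\<psi> + real (2 * M) * x1))"
  using assms(2,3)
proof (induction M arbitrary: \<psi>)
  case (Suc M)
  have 1: "crosses x1 x2 2 (1, p, p - cis \<psi>)"
    using assms(1) Suc.prems(1)[of 0]
    by (simp add: crosses_def sides_eq sin_add algebra_simps)
  have f3: "flip x1 x2 3 (-1, p, p - cis (\<psi> + 2 * x1)) = (1, p, p - cis (\<psi> + 2 * x1))" by simp
  have f: "flip x1 x2 2 (1, p, p - cis \<psi>) = (-1, p, p - cis (\<psi> + 2 * x1))"
    by (simp add: cis_mult[symmetric] mult.commute)
  have 2: "crosses x1 x2 3 (-1, p, p - cis (\<psi> + 2 * x1))"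
    using assms(1) Suc.prems(2)[of 0] by (simp add: crosses_def sides_eq)
  have "runs x1 x2 (word_power [2, 3] M) (1, p, p - cis (\<psi> + 2 * x1))
     (1, p, p - cis (\<psi> + 2 * x1 + real (2 * M) * x1))"
  proof (rule Suc.IH)
    fix i assume "i < M"
    then show "Im p < side_ratio x1 x2 * sin (\<psi> + 2 * x1 + real (2 * i + 1) * x1)"
      "Im p < sin (\<psi> + 2 * x1 + real (2 * i + 2) * x1)"
      using Suc.prems(1)[of "Suc i"] Suc.prems(2)[of "Suc i"] by (simp_all add: algebra_simps)
  qed
  also have "\<psi> + 2 * x1 + real (2 * M) * x1 = \<psi> + real (2 * Suc M) * x1" by (simp add: algebra_simps)
  finally show ?case using 1 2 by (simp add: word_power_def f f3 del: flip.simps)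
qed (simp add: word_power_def)

text \<open>Without the last letter 3 the last copy of \<open>A 2\<close> may be on either side of the axis.  This happens where the
path passes around \<open>A 3\<close> and the next fan begins.\<close>
lemma fan_open:
  assumes "Im p > 0"
    and "\<And>i. i \<le> M \<Longrightarrow> Im p < side_ratio x1 x2 * sin (\<psi> + real (2 * i + 1) * x1)"
    and "\<And>i. i < M \<Longrightarrow> Im p < sin (\<psi> + real (2 * i + 2) * x1)"
  shows "runs x1 x2 (word_power [2, 3] M @ [2]) (1, p, p - cis \<psi>)
    (-1, p, p - cis (\<psi> + real (2 * M + 2) * x1))"
proof (rule runs_appendI)
  show "runs x1 x2 (word_power [2, 3] M) (1, p, p - cis \<psi>) (1, p, p - cis (\<psi> + real (2 * M) * x1))"
    using assms by (intro fan) auto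
  have "crosses x1 x2 2 (1, p, p - cis (\<psi> + real (2 * M) * x1))"
    using assms(1) assms(2)[of M] by (simp add: crosses_def sides_eq sin_add cos_add algebra_simps)
  moreover have "flip x1 x2 2 (1, p, p - cis (\<psi> + real (2 * M) * x1)) = (-1, p, p - cis (\<psi> + real (2 * M + 2) * x1))"
    by (simp add: cis_mult algebra_simps)
  ultimately show "runs x1 x2 [2] (1, p, p - cis (\<psi> + real (2 * M) * x1))
      (-1, p, p - cis (\<psi> + real (2 * M + 2) * x1))" by simp
qed

lemma sin_ge_min:
  assumes "0 \<le> a" "a \<le> c" "c \<le> b" "b \<le> pi" "h < sin a" "h < sin b"
  shows "h < sin c"
proof (cases "c \<le> pi / 2")
  case True
  then have "sin a \<le> sin c" using assms by (intro sin_monotone_2pi_le) auto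
  then show ?thesis using assms by simp
next
  case False
  then have "sin (pi - b) \<le> sin (pi - c)" using assms by (intro sin_monotone_2pi_le) auto
  then show ?thesis using assms by simp
qed

lemma sin_above_on_progression:
  assumes "r > 0" "x \<ge> 0" "0 \<le> \<psi> + a * x" "\<psi> + b * x \<le> pi" "a \<le> c" "c \<le> b"
    and "h < r * sin (\<psi> + a * x)" "h < r * sin (\<psi> + b * x)"
  shows "h < r * sin (\<psi> + c * x)"
proof -
  have "a * x \<le> c * x" "c * x \<le> b * x" using assms by (auto intro: mult_right_mono)
  moreover have "h / r < sin (\<psi> + a * x)" "h / r < sin (\<psi> + b * x)"
    using assms(1,7,8) by (simp_all add: pos_divide_less_eq mult.commute)
  ultimately have "h / r < sin (\<psi> + c * x)"
    using sin_ge_min[of "\<psi> + a * x" "\<psi> + c * x" "\<psi> + b * x" "h / r"] assms(3,4) by simp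
  then show ?thesis using assms(1) by (simp add: pos_divide_less_eq mult.commute)
qed

text \<open>On \<open>{0..pi}\<close> the sine is concave, so in a fan only the first and the last vertex of each kind
have to be checked.\<close>
lemma fan_ends:
  assumes "Im p > 0" "x1 > 0" "side_ratio x1 x2 > 0" "M \<ge> 1"
    and "0 \<le> \<psi> + x1" "\<psi> + real (2 * M) * x1 \<le> pi"
    and "Im p < side_ratio x1 x2 * sin (\<psi> + x1)"
    and "Im p < side_ratio x1 x2 * sin (\<psi> + real (2 * M - 1) * x1)"
    and "Im p < sin (\<psi> + 2 * x1)" "Im p < sin (\<psi> + real (2 * M) * x1)"
  shows "runs x1 x2 (word_power [2, 3] M) (1, p, p - cis \<psi>) (1, p, p - cis (\<psi> + real (2 * M) * x1))"
proof (rule fan[OF assms(1)])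
  fix i assume i: "i < M"
  have "real (2 * M - 1) * x1 \<le> real (2 * M) * x1" using assms(2) by (intro mult_right_mono) auto
  then have "\<psi> + real (2 * M - 1) * x1 \<le> pi" using assms(6) by linarith
  with i show "Im p < side_ratio x1 x2 * sin (\<psi> + real (2 * i + 1) * x1)"
    using sin_above_on_progression[of "side_ratio x1 x2" x1 \<psi> 1 "real (2 * M - 1)" "real (2 * i + 1)" "Im p"] assms by auto
  have "Im p < 1 * sin (\<psi> + real (2 * i + 2) * x1)"
    using sin_above_on_progression[of 1 x1 \<psi> 2 "real (2 * M)" "real (2 * i + 2)" "Im p"] assms i by auto
  then show "Im p < sin (\<psi> + real (2 * i + 2) * x1)" by simp
qed

lemma fan_open_ends:
  assumes "Im p > 0" "x1 > 0" "side_ratio x1 x2 > 0" "M \<ge> 1"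
    and "0 \<le> \<psi> + x1" "\<psi> + real (2 * M + 1) * x1 \<le> pi"
    and "Im p < side_ratio x1 x2 * sin (\<psi> + x1)"
    and "Im p < side_ratio x1 x2 * sin (\<psi> + real (2 * M + 1) * x1)"
    and "Im p < sin (\<psi> + 2 * x1)" "Im p < sin (\<psi> + real (2 * M) * x1)"
  shows "runs x1 x2 (word_power [2, 3] M @ [2]) (1, p, p - cis \<psi>)
    (-1, p, p - cis (\<psi> + real (2 * M + 2) * x1))"
proof (rule fan_open[OF assms(1)])
  fix i
  have "real (2 * M) * x1 \<le> real (2 * M + 1) * x1" using assms(2) by (intro mult_right_mono) auto
  then have "\<psi> + real (2 * M) * x1 \<le> pi" using assms(6) by linarith
  moreover assume i: "i < M"
  ultimately have "Im p < 1 * sin (\<psi> + real (2 * i + 2) * x1)"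
    using sin_above_on_progression[of 1 x1 \<psi> 2 "real (2 * M)" "real (2 * i + 2)" "Im p"] assms by auto
  then show "Im p < sin (\<psi> + real (2 * i + 2) * x1)" by simp
next
  fix i assume i: "i \<le> M"
  with i show "Im p < side_ratio x1 x2 * sin (\<psi> + real (2 * i + 1) * x1)"
    using sin_above_on_progression[of "side_ratio x1 x2" x1 \<psi> 1 "real (2 * M + 1)" "real (2 * i + 1)" "Im p"] assms by auto
qed

lemma map_relabel_power: "map relabel (word_power [2, 3] M) = word_power [1, 3] M"
  by (simp add: word_power_def map_concat relabel_def)

lemma runs_upside_down:
  assumes "sin (x1 + x2) \<noteq> 0"
    and "runs x2 x1 w (1, cnj q, cnj p) (s', cnj q', cnj p')"
  shows "runs x1 x2 (map relabel w) (1, p, q) (s', p', q')"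
  using runs_relabel[OF _ _ runs_mirror[OF assms(2)]] assms(1) by (simp add: add.commute)

lemma fan_ends_bottom:
  assumes "Im q < 0" "x2 > 0" "side_ratio x2 x1 > 0" "M \<ge> 1" "sin (x1 + x2) \<noteq> 0"
    and "0 \<le> \<psi> + x2" "\<psi> + real (2 * M) * x2 \<le> pi"
    and "- Im q < side_ratio x2 x1 * sin (\<psi> + x2)"
    and "- Im q < side_ratio x2 x1 * sin (\<psi> + real (2 * M - 1) * x2)"
    and "- Im q < sin (\<psi> + 2 * x2)" "- Im q < sin (\<psi> + real (2 * M) * x2)"
  shows "runs x1 x2 (word_power [1, 3] M) (1, q - cis (- \<psi>), q)
    (1, q - cis (- (\<psi> + real (2 * M) * x2)), q)"
  unfolding map_relabel_power[symmetric]
  by (rule runs_upside_down[OF assms(5)])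
     (use fan_ends[of "cnj q" x2 x1 M \<psi>] assms in \<open>simp add: cis_cnj add.commute\<close>)

lemma fan_open_ends_bottom:
  assumes "Im q < 0" "x2 > 0" "side_ratio x2 x1 > 0" "M \<ge> 1" "sin (x1 + x2) \<noteq> 0"
    and "0 \<le> \<psi> + x2" "\<psi> + real (2 * M + 1) * x2 \<le> pi"
    and "- Im q < side_ratio x2 x1 * sin (\<psi> + x2)"
    and "- Im q < side_ratio x2 x1 * sin (\<psi> + real (2 * M + 1) * x2)"
    and "- Im q < sin (\<psi> + 2 * x2)" "- Im q < sin (\<psi> + real (2 * M) * x2)"
  shows "runs x1 x2 (word_power [1, 3] M @ [1]) (1, q - cis (- \<psi>), q)
    (-1, q - cis (- (\<psi> + real (2 * M + 2) * x2)), q)"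
proof -
  have w: "word_power [1, 3] M @ [1] = map relabel (word_power [2, 3] M @ [2])"
    by (simp add: map_relabel_power) (simp add: relabel_def)
  show ?thesis unfolding w
    by (rule runs_upside_down[OF assms(5)])
       (use fan_open_ends[of "cnj q" x2 x1 M \<psi>] assms in \<open>simp add: cis_cnj add.commute\<close>)
qed

section \<open>The words as products of fans\<close>
lemma word_power_swap: "a # word_power [c, a] m = word_power [a, c] m @ [a]"
  by (induction m) (simp_all add: word_power_def)

lemma word_power_rotate: "u @ word_power (x @ u) m = word_power (u @ x) m @ u"
  by (induction m) (simp_all add: word_power_def)

lemma word_H_eq: "word_H n = word_power [2, 3] (n - 1) @ [2]"
  and word_h_eq: "word_h n = word_power [2, 3] (n - 2) @ [2]"
  and word_u_eq: "word_u n = word_power [1, 3] (n - 1) @ [1]"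
  and word_v_eq: "word_v n = word_power [1, 3] (n - 2) @ [1]"
  using word_power_swap by (simp_all add: word_H_def word_h_def word_u_def word_v_def)

lemma power_snoc: "word_power w m @ w = word_power w (Suc m)"
  by (induction m) (simp_all add: word_power_def)

text \<open>Each of the four factors is a zone: full fans alternately about the two pivots, with a special
long fan at the beginning or at the end.  Where a factor does not end with 3, the path
passes around \<open>A 3\<close> to the next factor.\<close>
lemma word_W_eq:
  assumes "n \<ge> 2"
  defines "h3 \<equiv> word_power [2, 3] (n - 1)" and "v3 \<equiv> word_power [1, 3] (n - 1)"
  shows "word_W n k =
    (word_power (h3 @ v3) (k + 1) @ h3 @ word_v n) @
    (word_power [2, 3] n @ word_power (v3 @ h3) k @ v3 @ word_h n) @
    (word_power [1, 3] n @ word_power (h3 @ v3) k @ word_H n) @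
    (word_power (v3 @ h3) (k + 1) @ word_u n)"
proof -
  have Suc: "Suc (n - 2) = n - 1" "Suc (n - 1) = n" "Suc (n - Suc 0) = n" using assms(1) by simp_all
  have h: "word_h n @ [3] = h3" and v: "word_v n @ [3] = v3"
    and H: "word_H n @ [3] = word_power [2, 3] n" and u: "word_u n @ [3] = word_power [1, 3] n"
    using power_snoc[of "[2, 3]" "n - 2"] power_snoc[of "[1, 3]" "n - 2"]
      power_snoc[of "[2, 3]" "n - 1"] power_snoc[of "[1, 3]" "n - 1"]
    by (simp_all add: word_h_eq word_v_eq word_H_eq word_u_eq h3_def v3_def Suc)
  have "word_v n @ word_power ([3] @ word_h n @ [3] @ word_v n) k @ [3] =
      (word_v n @ word_power (([3] @ word_h n @ [3]) @ word_v n) k) @ [3]" by simp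
  also have "\<dots> = word_power (word_v n @ [3] @ word_h n @ [3]) k @ word_v n @ [3]"
    unfolding word_power_rotate by simp
  finally have B: "word_v n @ word_power ([3] @ word_h n @ [3] @ word_v n) k @ [3] =
      word_power (v3 @ h3) k @ v3"
    by (simp add: v flip: h) (simp flip: v)
  have B': "word_H n @ [3] @ word_v n @ word_power ([3] @ word_h n @ [3] @ word_v n) k @ [3] @ word_h n
      = (word_H n @ [3]) @ (word_v n @ word_power ([3] @ word_h n @ [3] @ word_v n) k @ [3]) @ word_h n"
    by simp
  have hv: "word_h n @ [3] @ word_v n @ [3] = h3 @ v3" "word_v n @ [3] @ word_h n @ [3] = v3 @ h3"
    by (simp_all flip: h v)
  show ?thesis
    unfolding word_W_def Let_def hv B' B H
    using u by (simp flip: h)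
qed

section \<open>Zigzags of small slope\<close>
definition base_angle :: "nat \<Rightarrow> real" where
  "base_angle n = pi / (2 * real n)"

text \<open>The slope of a zigzag is the angle \<open>\<phi>\<close> between its direction and the axis; its ascending edges
have the angle \<open>v + \<phi>\<close>.  This predicate collects the inequalities on the vertices that are not
critical, together with bounds that keep all the angles in the range where they are used.  All of
them are strict at \<open>y1 = y2 = \<phi> = 0\<close>, so that by continuity they cost nothing near \<open>V n\<close>
(\<open>tame_near\<close>).\<close>
definition tame :: "nat \<Rightarrow> real \<Rightarrow> real \<Rightarrow> real \<Rightarrow> bool" where
  "tame n y1 y2 \<phi> \<longleftrightarrow> (let v = base_angle n; r1 = side_ratio (v + y1) (v + y2);
      r2 = side_ratio (v + y2) (v + y1);
      a1 = (2 * real n - 2) * y1; a2 = (2 * real n - 2) * y2 in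
    0 < r1 \<and> 0 < r2 \<and> r2 < cos (v - a1 / 2) \<and> r1 < cos (v - a2 / 2) \<and>
    \<bar>\<phi>\<bar> + a1 + a2 + 2 * y1 + 2 * y2 < v \<and>
    r2 * sin (y2 - \<phi>) + sin (v + \<phi>) < sin (3 * v + \<phi> + 2 * y1) \<and>
    sin (v - \<phi> - a1) < sin (3 * v - \<phi> - a1 + 2 * y2) \<and>
    sin (v - \<phi> - a1) < sin (3 * v + \<phi> + a1 - a2 + 2 * y2) \<and>
    - r1 * sin (\<phi> + a1 + y1) < sin (v - \<phi> - a1) \<and>
    sin (y2 - \<phi>) < sin (2 * v + \<phi> - a2 - y2) \<and>
    r2 * sin (y2 - \<phi>) < sin (v - \<phi> + 2 * y2) \<and>
    r2 * sin (y2 - \<phi>) < sin (v + \<phi> - a2 - 2 * y2))"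

text \<open>Heights of the third vertex, measured from either end of side 3.\<close>
lemma ratio_sin:
  assumes "sin (x1 + x2) \<noteq> 0"
  shows "side_ratio x1 x2 * sin (t + x1) + side_ratio x2 x1 * sin (t - x2) = sin t"
    and "side_ratio x1 x2 * sin (t - x1) + side_ratio x2 x1 * sin (t + x2) = sin t"
proof -
  have *: "side_ratio x1 x2 * cos x1 + side_ratio x2 x1 * cos x2 = 1"
    and **: "side_ratio x1 x2 * sin x1 = side_ratio x2 x1 * sin x2"
    using assms by (simp_all add: side_ratio_def add.commute[of x2 x1] flip: add_divide_distrib)
      (simp add: sin_add algebra_simps)
  have "side_ratio x1 x2 * sin (t + x1) + side_ratio x2 x1 * sin (t - x2) =
     sin t * (side_ratio x1 x2 * cos x1 + side_ratio x2 x1 * cos x2)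
      + cos t * (side_ratio x1 x2 * sin x1 - side_ratio x2 x1 * sin x2)"
    by (simp add: sin_add sin_diff algebra_simps)
  then show "side_ratio x1 x2 * sin (t + x1) + side_ratio x2 x1 * sin (t - x2) = sin t"
    by (simp add: * **)
  have "side_ratio x1 x2 * sin (t - x1) + side_ratio x2 x1 * sin (t + x2) =
     sin t * (side_ratio x1 x2 * cos x1 + side_ratio x2 x1 * cos x2)
      - cos t * (side_ratio x1 x2 * sin x1 - side_ratio x2 x1 * sin x2)"
    by (simp add: sin_add sin_diff algebra_simps)
  then show "side_ratio x1 x2 * sin (t - x1) + side_ratio x2 x1 * sin (t + x2) = sin t"
    by (simp add: * **)
qed

lemma sin_neg: "- pi < t \<Longrightarrow> t < 0 \<Longrightarrow> sin t < 0"
  using sin_gt_zero[of "- t"] by simp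

text \<open>The pivots above the axis are copies of \<open>A 1\<close> and those below are copies of \<open>A 2\<close>; the opposite case is the
same locale with \<open>y1\<close> and \<open>y2\<close> exchanged.\<close>
locale small_angles =
  fixes n :: nat and y1 y2 :: real
  assumes n3: "n \<ge> 3" and y: "0 \<le> y1" "0 \<le> y2"
    and sum_less: "2 * base_angle n + y1 + y2 < pi / 2"
begin

abbreviation "v \<equiv> base_angle n"
abbreviation "x1 \<equiv> v + y1"
abbreviation "x2 \<equiv> v + y2"
abbreviation "r1 \<equiv> side_ratio x1 x2"
abbreviation "r2 \<equiv> side_ratio x2 x1"
abbreviation "a1 \<equiv> (2 * real n - 2) * y1"
abbreviation "a2 \<equiv> (2 * real n - 2) * y2"

lemma v_pos: "0 < v" using n3 by (simp add: base_angle_def)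

lemma x_pos: "0 < x1" "0 < x2" using v_pos y by auto

lemma sin_x: "sin (x1 + x2) \<noteq> 0"
proof -
  have "0 < x1 + x2" "x1 + x2 < pi" using x_pos sum_less y pi_gt_zero by linarith+
  then have "0 < sin (x1 + x2)" by (intro sin_gt_zero)
  then show ?thesis by simp
qed

lemma n_v: "real n * v = pi / 2"
  using n3 by (simp add: base_angle_def)

lemma a_nonneg: "0 \<le> a1" "0 \<le> a2" using y n3 by auto

lemma tameD:
  assumes "tame n y1 y2 \<phi>"
  shows "0 < r1" "0 < r2" "r2 < cos (v - a1 / 2)" "r1 < cos (v - a2 / 2)"
    "\<bar>\<phi>\<bar> + a1 + a2 + 2 * y1 + 2 * y2 < v"
    "r2 * sin (y2 - \<phi>) + sin (v + \<phi>) < sin (3 * v + \<phi> + 2 * y1)"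
    "sin (v - \<phi> - a1) < sin (3 * v - \<phi> - a1 + 2 * y2)"
    "sin (v - \<phi> - a1) < sin (3 * v + \<phi> + a1 - a2 + 2 * y2)"
    "- r1 * sin (\<phi> + a1 + y1) < sin (v - \<phi> - a1)"
    "sin (y2 - \<phi>) < sin (2 * v + \<phi> - a2 - y2)"
    "r2 * sin (y2 - \<phi>) < sin (v - \<phi> + 2 * y2)"
    "r2 * sin (y2 - \<phi>) < sin (v + \<phi> - a2 - 2 * y2)"
  using assms unfolding tame_def Let_def by blast+

lemma turn1: "real (2 * (n - 1)) * x1 = pi - 2 * v + a1"
  and turn2: "real (2 * (n - 1)) * x2 = pi - 2 * v + a2"
  using n3 n_v by (simp_all add: algebra_simps of_nat_diff)

lemma sin_pi_plus: "sin (pi + t) = - sin t" by (simp add: sin_add)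

text \<open>One period of the zigzag goes up from \<open>b\<close> to the next upper pivot and down to the next lower one.\<close>
definition peak :: "complex \<Rightarrow> real \<Rightarrow> complex" where "peak b \<phi> = b + cis (v + \<phi>)"
definition next_foot :: "complex \<Rightarrow> real \<Rightarrow> complex" where
  "next_foot b \<phi> = b + cis (v + \<phi>) + cis (\<phi> + a1 - v)"

lemma next_foot_eq: "next_foot b \<phi> = peak b \<phi> - cis (v + \<phi> + real (2 * (n - 1)) * x1)"
proof -
  have "cis (v + \<phi> + real (2 * (n - 1)) * x1) = cis (pi + (\<phi> + a1 - v))"
    unfolding turn1 by (simp add: algebra_simps)
  also have "\<dots> = - cis (\<phi> + a1 - v)" unfolding cis_mult[symmetric] by simp
  finally show ?thesis by (simp add: next_foot_def peak_def)
qed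

text \<open>A fan about an upper pivot.  The hypotheses on \<open>b\<close> and \<^term>\<open>next_foot b \<phi>\<close> say that the first and the
last copy of \<open>A 3\<close> are below the axis; the rest follows from \<^const>\<open>tame\<close>.\<close>
lemma top_fan:
  assumes t: "tame n y1 y2 \<phi>" and neg: "\<phi> + 2 * real n * (y1 + y2) < 0"
    and peak: "Im (peak b \<phi>) > 0"
    and low: "Im b + r2 * sin (\<phi> - y2) < 0"
    and low': "Im (next_foot b \<phi>) - r2 * sin (\<phi> + a1 + y2) < 0"
  shows "runs x1 x2 (word_power [2, 3] (n - 1)) (1, peak b \<phi>, b) (1, peak b \<phi>, next_foot b \<phi>)"
proof -
  note T = tameD[OF t]
  have ny: "real n * (y1 + y2) \<ge> 0" "real n * y1 \<ge> 0" "real n * y2 \<ge> 0" using y by simp_all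
  have lin: "\<phi> + a1 + y2 < 0" "- v < \<phi> + a1 + y2"
    using neg T(5) y n3 a_nonneg ny by (auto simp: algebra_simps)
  have "sin (\<phi> + a1 + y2) < 0"
    using lin v_pos sum_less y by (intro sin_neg) auto
  then have "r2 * sin (\<phi> + a1 + y2) < 0" using T(2) by (simp add: mult_pos_neg)
  then have nb: "Im (next_foot b \<phi>) < 0" using low' by simp
  have ht: "Im (peak b \<phi>) = Im b + sin (v + \<phi>)" by (simp add: peak_def)
  have hnb: "Im (next_foot b \<phi>) = Im (peak b \<phi>) - sin (v + \<phi> + real (2 * (n - 1)) * x1)"
    by (simp add: next_foot_eq)
  have s1: "sin (v + \<phi>) = r1 * sin (v + \<phi> + x1) + r2 * sin (\<phi> - y2)"
    using ratio_sin(1)[OF sin_x, of "v + \<phi>"] by simp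
  have s2: "sin (v + \<phi> + real (2 * (n - 1)) * x1) =
      r1 * sin (v + \<phi> + real (2 * (n - 1) - 1) * x1) - r2 * sin (\<phi> + a1 + y2)"
  proof -
    have "v + \<phi> + real (2 * (n - 1)) * x1 - x1 = v + \<phi> + real (2 * (n - 1) - 1) * x1"
      using n3 by (simp add: of_nat_diff algebra_simps)
    moreover have "v + \<phi> + real (2 * (n - 1)) * x1 + x2 = pi + (\<phi> + a1 + y2)"
      unfolding turn1 by simp
    ultimately show ?thesis
      using ratio_sin(2)[OF sin_x, of "v + \<phi> + real (2 * (n - 1)) * x1"] sin_pi_plus[of "\<phi> + a1 + y2"]
      by (metis add_diff_cancel_right' diff_conv_add_uminus mult_minus_right)
  qed
  have s3: "Im (peak b \<phi>) < sin (v + \<phi> + 2 * x1)"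
    using ht low T(6) sin_minus[of "\<phi> - y2"] by (simp add: algebra_simps)
  have b: "b = peak b \<phi> - cis (v + \<phi>)" by (simp add: peak_def)
  have r1: "0 \<le> v + \<phi> + x1" "v + \<phi> + real (2 * (n - 1)) * x1 \<le> pi"
    unfolding turn1 using lin T(5) y a_nonneg by (auto simp: algebra_simps)
  have "runs x1 x2 (word_power [2, 3] (n - 1)) (1, peak b \<phi>, peak b \<phi> - cis (v + \<phi>))
     (1, peak b \<phi>, peak b \<phi> - cis (v + \<phi> + real (2 * (n - 1)) * x1))"
    by (rule fan_ends[OF peak x_pos(1) T(1)])
       (use n3 r1 s3 nb hnb s1 s2 ht low low' in auto)
  then show ?thesis unfolding next_foot_eq b[symmetric] .
qed

text \<open>The axis rises relative to the zigzag, and by more than all the perturbations of the angles that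
occur within one period.\<close>
lemma sin_signs:
  assumes t: "tame n y1 y2 \<phi>" and neg: "\<phi> + 2 * real n * (y1 + y2) < 0"
  shows "sin (\<phi> - y1) < 0" "sin (\<phi> - y2) < 0" "sin (\<phi> + a1 + y1) < 0" "sin (\<phi> + a1 + y2) < 0"
    "sin (\<phi> + a1 / 2) < 0" "sin (\<phi> + a1 - a2 / 2) < 0"
    "\<phi> + a1 + y1 < 0" "\<phi> + a1 + y2 < 0"
proof -
  note T = tameD[OF t]
  have ny: "real n * (y1 + y2) \<ge> 0" "real n * y1 \<ge> 0" "real n * y2 \<ge> 0" using y by simp_all
  have v2: "v < pi" using sum_less y v_pos pi_gt_zero by linarith
  have na: "a1 = 2 * (real n * y1) - 2 * y1" "a2 = 2 * (real n * y2) - 2 * y2"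
    "2 * real n * (y1 + y2) = 2 * (real n * y1) + 2 * (real n * y2)" by (simp_all add: algebra_simps)
  have *: "\<phi> - y1 < 0" "\<phi> - y2 < 0" "\<phi> + a1 + y1 < 0" "\<phi> + a1 + y2 < 0"
    "\<phi> + a1 / 2 < 0" "\<phi> + a1 - a2 / 2 < 0"
    using neg y n3 a_nonneg ny na mult_right_mono[of 1 "real n" y2] mult_right_mono[of 1 "real n" y1] by linarith+
  have "- pi < \<phi> - y1" "- pi < \<phi> - y2" "- pi < \<phi> + a1 + y1" "- pi < \<phi> + a1 + y2"
    "- pi < \<phi> + a1 / 2" "- pi < \<phi> + a1 - a2 / 2"
    using T(5) y a_nonneg v2 by linarith+
  then show "sin (\<phi> - y1) < 0" "sin (\<phi> - y2) < 0" "sin (\<phi> + a1 + y1) < 0" "sin (\<phi> + a1 + y2) < 0"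
    "sin (\<phi> + a1 / 2) < 0" "sin (\<phi> + a1 - a2 / 2) < 0"
    using * sin_neg by auto
  show "\<phi> + a1 + y1 < 0" "\<phi> + a1 + y2 < 0" using * by auto
qed

lemma sin_add_sin: "sin (a + d) + sin (a - d) = 2 * sin a * cos d" for a d :: real
  by (simp add: sin_add sin_diff)

text \<open>The critical lower vertices of one period are in decreasing order: the copy of \<open>A 3\<close> after \<open>b\<close>, the copy of
\<open>A 3\<close> before the next foot, and the next foot itself.  The first comparison holds because a period
is at least twice as long as the side \<open>r2\<close>, that is, \<open>r2 < cos (v - a1 / 2)\<close>.\<close>
lemma low_step:
  assumes t: "tame n y1 y2 \<phi>" and neg: "\<phi> + 2 * real n * (y1 + y2) < 0"
    and low: "Im b + r2 * sin (\<phi> - y2) < 0"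
  shows "Im (next_foot b \<phi>) - r2 * sin (\<phi> + a1 + y2) < 0" "Im (next_foot b \<phi>) < 0"
proof -
  note T = tameD[OF t] and S = sin_signs[OF t neg]
  have "Im (next_foot b \<phi>) - Im b = 2 * sin (\<phi> + a1 / 2) * cos (v - a1 / 2)"
    using sin_add_sin[of "\<phi> + a1 / 2" "v - a1 / 2"] by (simp add: next_foot_def algebra_simps)
  moreover have "sin (\<phi> + a1 + y2) + sin (\<phi> - y2) = 2 * sin (\<phi> + a1 / 2) * cos (a1 / 2 + y2)"
    using sin_add_sin[of "\<phi> + a1 / 2" "a1 / 2 + y2"] by (simp add: algebra_simps)
  moreover have "r2 * cos (a1 / 2 + y2) \<le> r2 * 1" using T(2) by (intro mult_left_mono) auto
  then have "2 * sin (\<phi> + a1 / 2) * (cos (v - a1 / 2) - r2 * cos (a1 / 2 + y2)) \<le> 0"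
    using S(5) T(3) by (simp add: mult_nonpos_nonneg)
  ultimately have "Im (next_foot b \<phi>) - Im b \<le> r2 * (sin (\<phi> + a1 + y2) + sin (\<phi> - y2))"
    by (simp add: algebra_simps)
  then show *: "Im (next_foot b \<phi>) - r2 * sin (\<phi> + a1 + y2) < 0"
    using low by (simp add: algebra_simps)
  have "r2 * sin (\<phi> + a1 + y2) < 0" using S(4) T(2) by (simp add: mult_pos_neg)
  then show "Im (next_foot b \<phi>) < 0" using * by simp
qed

text \<open>The same comparison for the upper vertices: the copy of \<open>A 3\<close> before the next peak is not higher
than the copy after this one.\<close>
lemma up_step:
  assumes t: "tame n y1 y2 \<phi>" and neg: "\<phi> + 2 * real n * (y1 + y2) < 0"
  defines "\<phi>' \<equiv> \<phi> + (a1 - a2)"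
  shows "Im (peak (next_foot b \<phi>) \<phi>') - r1 * sin (\<phi>' - y1) \<le> Im (peak b \<phi>) + r1 * sin (\<phi> + a1 + y1)"
proof -
  note T = tameD[OF t] and S = sin_signs[OF t neg]
  have "Im (peak (next_foot b \<phi>) \<phi>') - Im (peak b \<phi>) = 2 * sin (\<phi> + a1 - a2 / 2) * cos (v - a2 / 2)"
    using sin_add_sin[of "\<phi> + a1 - a2 / 2" "v - a2 / 2"]
    by (simp add: next_foot_def peak_def \<phi>'_def algebra_simps)
  moreover have "sin (\<phi> + a1 + y1) + sin (\<phi>' - y1) = 2 * sin (\<phi> + a1 - a2 / 2) * cos (a2 / 2 + y1)"
    using sin_add_sin[of "\<phi> + a1 - a2 / 2" "a2 / 2 + y1"] by (simp add: \<phi>'_def algebra_simps)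
  moreover have "r1 * cos (a2 / 2 + y1) \<le> r1 * 1" using T(1) by (intro mult_left_mono) auto
  then have "2 * sin (\<phi> + a1 - a2 / 2) * (cos (v - a2 / 2) - r1 * cos (a2 / 2 + y1)) \<le> 0"
    using S(6) T(4) by (simp add: mult_nonpos_nonneg)
  ultimately have "Im (peak (next_foot b \<phi>) \<phi>') - Im (peak b \<phi>) \<le> r1 * (sin (\<phi> + a1 + y1) + sin (\<phi>' - y1))"
    by (simp add: algebra_simps)
  then show ?thesis by (simp add: algebra_simps)
qed

text \<open>The fan \<open>H\<close> at the end of a zone.  It is so wide that its last copy of \<open>A 3\<close> is level with the pivot, up to
the slope; \<open>gate\<close> says that it is below the axis.\<close>
lemma top_fan_open:
  assumes t: "tame n y1 y2 \<phi>" and neg: "\<phi> + 2 * real n * (y1 + y2) < 0"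
    and peak: "Im (peak b \<phi>) > 0"
    and low: "Im b + r2 * sin (\<phi> - y2) < 0"
    and gate: "Im (peak b \<phi>) + r1 * sin (\<phi> + a1 + y1) < 0"
  shows "runs x1 x2 (word_H n) (1, peak b \<phi>, b) (-1, peak b \<phi>, peak (peak b \<phi>) (\<phi> + a1 + 2 * y1))"
proof -
  note T = tameD[OF t] and S = sin_signs[OF t neg]
  have ht: "Im (peak b \<phi>) = Im b + sin (v + \<phi>)" by (simp add: peak_def)
  have s1: "sin (v + \<phi>) = r1 * sin (v + \<phi> + x1) + r2 * sin (\<phi> - y2)"
    using ratio_sin(1)[OF sin_x, of "v + \<phi>"] by simp
  have s3: "Im (peak b \<phi>) < sin (v + \<phi> + 2 * x1)"
    using ht low T(6) sin_minus[of "\<phi> - y2"] by (simp add: algebra_simps)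
  have b: "b = peak b \<phi> - cis (v + \<phi>)" by (simp add: peak_def)
  have turn: "v + \<phi> + real (2 * (n - 1)) * x1 = pi - (v - \<phi> - a1)"
    "v + \<phi> + real (2 * (n - 1) + 1) * x1 = pi + (\<phi> + a1 + y1)"
    "v + \<phi> + real (2 * (n - 1) + 2) * x1 = pi + (v + (\<phi> + a1 + 2 * y1))"
    using turn1 by (simp_all add: distrib_right)
  have r: "0 \<le> v + \<phi> + x1" "v + \<phi> + real (2 * (n - 1) + 1) * x1 \<le> pi"
    unfolding turn using S T(5) y a_nonneg by (auto simp: algebra_simps)
  have g: "Im (peak b \<phi>) < r1 * sin (v + \<phi> + real (2 * (n - 1) + 1) * x1)"
    unfolding turn sin_pi_plus using gate by simp
  have e: "Im (peak b \<phi>) < sin (v + \<phi> + real (2 * (n - 1)) * x1)"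
    unfolding turn using gate T(9) by simp
  have "runs x1 x2 (word_H n) (1, peak b \<phi>, peak b \<phi> - cis (v + \<phi>))
     (-1, peak b \<phi>, peak b \<phi> - cis (v + \<phi> + real (2 * (n - 1) + 2) * x1))"
    unfolding word_H_eq
    by (rule fan_open_ends[OF peak x_pos(1) T(1)])
       (use n3 r s3 s1 ht low g e in auto)
  moreover have "peak b \<phi> - cis (v + \<phi> + real (2 * (n - 1) + 2) * x1) = peak (peak b \<phi>) (\<phi> + a1 + 2 * y1)"
    unfolding turn cis_mult[of pi, symmetric] by (simp add: peak_def)
  ultimately show ?thesis unfolding b[symmetric] by simp
qed

lemma bottom_fan_facts:
  assumes t: "tame n y1 y2 \<phi>" and neg: "\<phi> + 2 * real n * (y1 + y2) < 0"
    and peak: "Im (peak b \<phi>) > 0"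
    and up: "Im (peak b \<phi>) + r1 * sin (\<phi> + a1 + y1) > 0"
  defines "b' \<equiv> next_foot b \<phi>" and "\<phi>' \<equiv> \<phi> + (a1 - a2)" and "\<psi> \<equiv> v - \<phi> - a1"
  assumes up': "Im (peak b' \<phi>') - r1 * sin (\<phi>' - y1) > 0"
  shows "0 \<le> \<psi> + x2" "\<psi> + real (2 * (n - 1)) * x2 = pi - (v + \<phi>')" "0 \<le> v + \<phi>'"
    "- Im b' < r2 * sin (\<psi> + x2)" "- Im b' < r2 * sin (\<psi> + real (2 * (n - 1) - 1) * x2)"
    "- Im b' < sin \<psi>" "- Im b' < sin (\<psi> + 2 * x2)" "Im (peak b' \<phi>') = Im b' + sin (v + \<phi>')"
    "b' - cis (- \<psi>) = peak b \<phi>" "b' - cis (- (pi - (v + \<phi>'))) = peak b' \<phi>'"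
proof -
  note T = tameD[OF t] and S = sin_signs[OF t neg]
  show turn: "\<psi> + real (2 * (n - 1)) * x2 = pi - (v + \<phi>')"
    unfolding turn2 by (simp add: \<psi>_def \<phi>'_def)
  show "0 \<le> \<psi> + x2" "0 \<le> v + \<phi>'"
    using T(5) y a_nonneg v_pos unfolding \<psi>_def \<phi>'_def by linarith+
  have c: "cis (- \<psi>) = cis (\<phi> + a1 - v)" by (simp add: \<psi>_def algebra_simps)
  show p: "b' - cis (- \<psi>) = peak b \<phi>" unfolding c by (simp add: b'_def next_foot_def peak_def)
  have ht: "Im (peak b \<phi>) = Im b' + sin \<psi>" unfolding p[symmetric] by simp
  then show "- Im b' < sin \<psi>" using peak by simp
  then show "- Im b' < sin (\<psi> + 2 * x2)" using T(7) by (simp add: \<psi>_def algebra_simps)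
  show ht': "Im (peak b' \<phi>') = Im b' + sin (v + \<phi>')" by (simp add: peak_def)
  have "cis (- (pi - (v + \<phi>'))) = cis (v + \<phi>') * cis (- pi)" unfolding cis_mult by (simp add: algebra_simps)
  moreover have "cis (- pi) = -1" by (simp add: complex_eq_iff)
  ultimately show "b' - cis (- (pi - (v + \<phi>'))) = peak b' \<phi>'" by (simp add: peak_def)
  have "sin \<psi> = - r1 * sin (\<phi> + a1 + y1) + r2 * sin (\<psi> + x2)"
    using ratio_sin(2)[OF sin_x, of \<psi>] sin_minus[of "\<phi> + a1 + y1"] by (simp add: \<psi>_def algebra_simps)
  then show "- Im b' < r2 * sin (\<psi> + x2)" using ht up by simp
  have "\<psi> + real (2 * (n - 1) - 1) * x2 = pi - (v + \<phi>') - x2"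
    unfolding turn[symmetric] using n3 by (simp add: of_nat_diff algebra_simps)
  moreover have "sin (pi - (v + \<phi>') + x1) = sin (\<phi>' - y1)"
    using sin_pi_minus[of "\<phi>' - y1"] by (simp add: algebra_simps)
  moreover have "sin (pi - (v + \<phi>')) = sin (v + \<phi>')" by (rule sin_pi_minus)
  ultimately have "sin (v + \<phi>') = r1 * sin (\<phi>' - y1) + r2 * sin (\<psi> + real (2 * (n - 1) - 1) * x2)"
    using ratio_sin(1)[OF sin_x, of "pi - (v + \<phi>')"] by metis
  then show "- Im b' < r2 * sin (\<psi> + real (2 * (n - 1) - 1) * x2)" using ht' up' by simp
qed

lemma bottom_fan:
  assumes t: "tame n y1 y2 \<phi>" and neg: "\<phi> + 2 * real n * (y1 + y2) < 0"
    and peak: "Im (peak b \<phi>) > 0"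
    and up: "Im (peak b \<phi>) + r1 * sin (\<phi> + a1 + y1) > 0"
  defines "b' \<equiv> next_foot b \<phi>" and "\<phi>' \<equiv> \<phi> + (a1 - a2)"
  assumes up': "Im (peak b' \<phi>') - r1 * sin (\<phi>' - y1) > 0"
    and b': "Im b' < 0"
  shows "Im (peak b' \<phi>') > 0 \<Longrightarrow>
      runs x1 x2 (word_power [1, 3] (n - 1)) (1, peak b \<phi>, b') (1, peak b' \<phi>', b')"
    and "runs x1 x2 (word_v n) (1, peak b \<phi>, b') (-1, peak b' \<phi>', b')"
proof -
  note T = tameD[OF t]
  note F = bottom_fan_facts[OF t neg peak up up'[unfolded b'_def \<phi>'_def], folded b'_def \<phi>'_def]
  show "runs x1 x2 (word_power [1, 3] (n - 1)) (1, peak b \<phi>, b') (1, peak b' \<phi>', b')"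
    if "Im (peak b' \<phi>') > 0"
    using fan_ends_bottom[OF b' x_pos(2) T(2) _ sin_x F(1), of "n - 1"] F(2-9) that n3
    unfolding F(2) F(9) F(10) by (simp add: sin_pi_minus del: minus_diff_eq)
  have e: "v - \<phi> - a1 + real (2 * (n - 2)) * x2 = pi - (3 * v + \<phi>' + 2 * y2)"
    "v - \<phi> - a1 + real (2 * (n - 2) + 2) * x2 = pi - (v + \<phi>')"
    "v - \<phi> - a1 + real (2 * (n - 2) + 1) * x2 = v - \<phi> - a1 + real (2 * (n - 1) - 1) * x2"
    "v - \<phi> - a1 + real (2 * (n - 1) - 1) * x2 = pi - (v + \<phi>') - x2"
    using F(2) n3 by (simp_all add: of_nat_diff algebra_simps)
  have r: "v - \<phi> - a1 + real (2 * (n - 2) + 1) * x2 \<le> pi"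
    unfolding e(3,4) using F(3) x_pos by simp
  have last: "- Im b' < sin (v - \<phi> - a1 + real (2 * (n - 2)) * x2)"
    unfolding e(1) sin_pi_minus using F(6) T(8) by (simp add: \<phi>'_def algebra_simps)
  show "runs x1 x2 (word_v n) (1, peak b \<phi>, b') (-1, peak b' \<phi>', b')"
    using fan_open_ends_bottom[OF b' x_pos(2) T(2) _ sin_x F(1) r F(4) _ F(7) last] n3 F(5)
    unfolding e(3) e(2) F(9) F(10) word_v_eq by simp
qed

text \<open>The fan \<open>u\<close> at the beginning of a zone, about a pivot \<open>q\<close> below the axis.  The first copy of \<open>A 3\<close> is level
with the pivot, and \<open>gate\<close> puts it above the axis.\<close>
lemma start_fan:
  assumes t: "tame n y1 y2 \<phi>" and neg: "\<phi> + 2 * real n * (y1 + y2) < 0"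
    and q: "Im q < 0" and gate: "Im q - r2 * sin (\<phi> - y2) > 0"
  shows "runs x1 x2 (word_power [1, 3] n) (1, q - cis (v + \<phi>), q) (1, peak q (\<phi> - a2 - 2 * y2), q)"
proof -
  note T = tameD[OF t] and S = sin_signs[OF t neg]
  have q': "- Im q < r2 * sin (y2 - \<phi>)" using gate sin_minus[of "y2 - \<phi>"] by simp
  have nx: "real (2 * n) * x2 = pi + a2 + 2 * y2"
    using n_v by (simp add: algebra_simps)
  have e: "- (v + \<phi>) + x2 = y2 - \<phi>" "- (v + \<phi>) + 2 * x2 = v - \<phi> + 2 * y2"
    "- (v + \<phi>) + real (2 * n) * x2 = pi - (v + \<phi> - a2 - 2 * y2)"
    "- (v + \<phi>) + real (2 * n - 1) * x2 = pi - (2 * v + \<phi> - a2 - y2)"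
    using nx n3 by (simp_all add: of_nat_diff algebra_simps)
  have T10: "r2 * sin (y2 - \<phi>) < r2 * sin (2 * v + \<phi> - a2 - y2)" using T(2,10) by simp
  have r: "0 \<le> - (v + \<phi>) + x2" "- (v + \<phi>) + real (2 * n) * x2 \<le> pi"
    unfolding e using T(5) S y a_nonneg by (auto simp: algebra_simps)
  have c: "cis (- (pi - (v + \<phi> - a2 - 2 * y2))) = - cis (v + \<phi> - a2 - 2 * y2)"
  proof -
    have "cis (- (pi - (v + \<phi> - a2 - 2 * y2))) = cis (- pi) * cis (v + \<phi> - a2 - 2 * y2)"
      unfolding cis_mult by (simp add: algebra_simps)
    then show ?thesis by (simp add: cis.ctr complex_eq_iff)
  qed
  have "runs x1 x2 (word_power [1, 3] n) (1, q - cis (- (- (v + \<phi>))), q)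
     (1, q - cis (- (- (v + \<phi>) + real (2 * n) * x2)), q)"
    by (rule fan_ends_bottom[OF q x_pos(2) T(2) _ sin_x r])
       (unfold e sin_pi_minus, use n3 q' T10 T(11,12) in auto)
  then show ?thesis unfolding e c by (simp add: peak_def algebra_simps)
qed

end

context small_angles
begin

abbreviation "turn \<equiv> a1 - a2"

text \<open>The lower pivots of a zone.  The slope changes by \<open>turn\<close> from one period to the next.\<close>
definition zig :: "complex \<Rightarrow> real \<Rightarrow> nat \<Rightarrow> complex" where
  "zig b \<phi> j = b + (\<Sum>i<j. cis (v + (\<phi> + real i * turn)) + cis (\<phi> + real i * turn + a1 - v))"

lemma zig_0 [simp]: "zig b \<phi> 0 = b"
  and zig_Suc: "zig b \<phi> (Suc j) = next_foot (zig b \<phi> j) (\<phi> + real j * turn)"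
  by (simp_all add: zig_def next_foot_def)

definition good :: "real \<Rightarrow> bool" where
  "good \<phi> \<longleftrightarrow> tame n y1 y2 \<phi> \<and> \<phi> + 2 * real n * (y1 + y2) < 0"

lemma goodD: "good \<phi> \<Longrightarrow> tame n y1 y2 \<phi>" "good \<phi> \<Longrightarrow> \<phi> + 2 * real n * (y1 + y2) < 0"
  by (auto simp: good_def)

lemma good_signs:
  assumes "good \<phi>"
  shows "r1 * sin (\<phi> - y1) < 0" "r2 * sin (\<phi> - y2) < 0" "r1 * sin (\<phi> + a1 + y1) < 0"
  using sin_signs[OF goodD[OF assms]] tameD(1,2)[OF goodD(1)[OF assms]] by (auto simp: mult_pos_neg)

text \<open>The upper vertices decrease along the zone, so it is enough that the last one of them is above
the axis.\<close>
lemma zone_tops: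
  assumes good: "\<And>j. j \<le> N \<Longrightarrow> good (\<phi> + real j * turn)"
    and up: "Im (peak (zig b \<phi> N) (\<phi> + real N * turn)) - r1 * sin (\<phi> + real N * turn - y1) > 0"
    and "j \<le> N"
  shows "Im (peak (zig b \<phi> j) (\<phi> + real j * turn)) - r1 * sin (\<phi> + real j * turn - y1) > 0 \<and>
    (j < N \<longrightarrow> Im (peak (zig b \<phi> j) (\<phi> + real j * turn)) > 0 \<and>
      Im (peak (zig b \<phi> j) (\<phi> + real j * turn)) + r1 * sin (\<phi> + real j * turn + a1 + y1) > 0)"
  using \<open>j \<le> N\<close>
proof (induction rule: inc_induct)
  case (step j)
  then have g: "good (\<phi> + real j * turn)" using good by simp
  have e: "\<phi> + real j * turn + (a1 - a2) = \<phi> + real (Suc j) * turn" by (simp add: algebra_simps)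
  show ?case
    using up_step[OF goodD[OF g], of "zig b \<phi> j", folded zig_Suc, unfolded e] conjunct1[OF step.IH] good_signs[OF g]
    by linarith
qed (use up in simp)

lemma period:
  assumes g: "good \<phi>" "good (\<phi> + turn)" and low: "Im b + r2 * sin (\<phi> - y2) < 0"
    and peak: "Im (peak b \<phi>) > 0" "Im (peak (next_foot b \<phi>) (\<phi> + turn)) > 0"
  shows "runs x1 x2 (word_power [2, 3] (n - 1) @ word_power [1, 3] (n - 1)) (1, peak b \<phi>, b)
      (1, peak (next_foot b \<phi>) (\<phi> + turn), next_foot b \<phi>)"
    and "Im (next_foot b \<phi>) + r2 * sin (\<phi> + turn - y2) < 0"
proof -
  note G = goodD[OF g(1)] and S = good_signs[OF g(1)] and S' = good_signs[OF g(2)]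
  note L = low_step[OF G low]
  have U: "Im (peak (next_foot b \<phi>) (\<phi> + turn)) - r1 * sin (\<phi> + turn - y1) > 0" using peak(2) S' by simp
  show "runs x1 x2 (word_power [2, 3] (n - 1) @ word_power [1, 3] (n - 1)) (1, peak b \<phi>, b)
      (1, peak (next_foot b \<phi>) (\<phi> + turn), next_foot b \<phi>)"
    using up_step[OF G, of b] U
    by (intro runs_appendI[OF top_fan[OF G peak(1) low L(1)]] bottom_fan(1)[OF G peak(1) _ U L(2) peak(2)]) simp
  show "Im (next_foot b \<phi>) + r2 * sin (\<phi> + turn - y2) < 0" using L(2) S' by simp
qed

lemma zone_periods:
  assumes good: "\<And>j. j \<le> M \<Longrightarrow> good (\<phi> + real j * turn)"
    and low: "Im b + r2 * sin (\<phi> - y2) < 0"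
    and peak: "\<And>j. j \<le> M \<Longrightarrow> Im (peak (zig b \<phi> j) (\<phi> + real j * turn)) > 0"
  shows "runs x1 x2 (word_power (word_power [2, 3] (n - 1) @ word_power [1, 3] (n - 1)) M) (1, peak b \<phi>, b)
      (1, peak (zig b \<phi> M) (\<phi> + real M * turn), zig b \<phi> M) \<and>
      Im (zig b \<phi> M) + r2 * sin (\<phi> + real M * turn - y2) < 0"
  using good peak
proof (induction M)
  case 0
  then show ?case using low by (simp add: word_power_def)
next
  case (Suc M)
  have e: "\<phi> + real M * turn + turn = \<phi> + real (Suc M) * turn" by (simp add: algebra_simps)
  have IH: "runs x1 x2 (word_power (word_power [2, 3] (n - 1) @ word_power [1, 3] (n - 1)) M) (1, peak b \<phi>, b)
      (1, peak (zig b \<phi> M) (\<phi> + real M * turn), zig b \<phi> M)"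
    "Im (zig b \<phi> M) + r2 * sin (\<phi> + real M * turn - y2) < 0"
    using Suc.IH Suc.prems by auto
  note P = period[of "\<phi> + real M * turn" "zig b \<phi> M", unfolded e, folded zig_Suc,
      OF Suc.prems(1)[of M] Suc.prems(1)[of "Suc M"] IH(2) Suc.prems(2)[of M] Suc.prems(2)[of "Suc M"]]
  show ?case unfolding power_snoc[symmetric]
    using runs_appendI[OF IH(1) P(1)] P(2) by simp
qed

text \<open>A zone that ends by passing around \<open>A 3\<close> from above a lower pivot.  The next pivot may be on
either side of the axis; what has to be above is the copy of \<open>A 3\<close> before it.\<close>
lemma zone_open:
  assumes good: "\<And>j. j \<le> Suc M \<Longrightarrow> good (\<phi> + real j * turn)"
    and low: "Im b + r2 * sin (\<phi> - y2) < 0"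
    and up: "Im (peak (zig b \<phi> (Suc M)) (\<phi> + real (Suc M) * turn)) - r1 * sin (\<phi> + real (Suc M) * turn - y1) > 0"
  shows "runs x1 x2 (word_power (word_power [2, 3] (n - 1) @ word_power [1, 3] (n - 1)) M @
        word_power [2, 3] (n - 1) @ word_v n) (1, peak b \<phi>, b)
      (-1, peak (zig b \<phi> (Suc M)) (\<phi> + real (Suc M) * turn), zig b \<phi> (Suc M))"
proof -
  have e: "\<phi> + real M * turn + turn = \<phi> + real (Suc M) * turn" by (simp add: algebra_simps)
  note tops = zone_tops[where N = "Suc M", OF good up]
  have Z: "runs x1 x2 (word_power (word_power [2, 3] (n - 1) @ word_power [1, 3] (n - 1)) M) (1, peak b \<phi>, b)
      (1, peak (zig b \<phi> M) (\<phi> + real M * turn), zig b \<phi> M) \<and>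
      Im (zig b \<phi> M) + r2 * sin (\<phi> + real M * turn - y2) < 0"
    using good tops by (intro zone_periods low) auto
  have g: "good (\<phi> + real M * turn)" using good by simp
  note G = goodD[OF g] and L = low_step[OF goodD[OF g] conjunct2[OF Z]]
  have peak: "Im (peak (zig b \<phi> M) (\<phi> + real M * turn)) > 0"
    "Im (peak (zig b \<phi> M) (\<phi> + real M * turn)) + r1 * sin (\<phi> + real M * turn + a1 + y1) > 0"
    using tops[of M] by auto
  note B = bottom_fan(2)[OF G peak, unfolded e, folded zig_Suc, OF up L(2)[folded zig_Suc]]
  show ?thesis
    using runs_appendI[OF conjunct1[OF Z] runs_appendI[OF top_fan[OF G peak(1) conjunct2[OF Z] L(1), folded zig_Suc] B]] .
qed

text \<open>A zone that ends with the special fan \<open>H\<close> about its last upper pivot.\<close>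
lemma zone_closed:
  assumes good: "\<And>j. j \<le> N \<Longrightarrow> good (\<phi> + real j * turn)"
    and low: "Im b + r2 * sin (\<phi> - y2) < 0"
  defines "t \<equiv> peak (zig b \<phi> N) (\<phi> + real N * turn)"
  assumes peak: "Im t > 0" and gate: "Im t + r1 * sin (\<phi> + real N * turn + a1 + y1) < 0"
  shows "runs x1 x2 (word_power (word_power [2, 3] (n - 1) @ word_power [1, 3] (n - 1)) N @ word_H n)
      (1, peak b \<phi>, b) (-1, t, peak t (\<phi> + real N * turn + a1 + 2 * y1))"
proof -
  have g: "good (\<phi> + real N * turn)" using good by simp
  note G = goodD[OF g]
  have up: "Im (peak (zig b \<phi> N) (\<phi> + real N * turn)) - r1 * sin (\<phi> + real N * turn - y1) > 0"
    using peak good_signs[OF g] by (simp add: t_def)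
  have "Im (peak (zig b \<phi> j) (\<phi> + real j * turn)) > 0" if "j \<le> N" for j
    using zone_tops[OF good up that] that peak by (cases "j = N") (auto simp: t_def)
  then have Z: "runs x1 x2 (word_power (word_power [2, 3] (n - 1) @ word_power [1, 3] (n - 1)) N) (1, peak b \<phi>, b)
      (1, t, zig b \<phi> N) \<and> Im (zig b \<phi> N) + r2 * sin (\<phi> + real N * turn - y2) < 0"
    unfolding t_def using good by (intro zone_periods low) auto
  show ?thesis
    using runs_appendI[OF conjunct1[OF Z] top_fan_open[OF G peak[unfolded t_def] conjunct2[OF Z] gate[unfolded t_def],
        folded t_def]] .
qed

lemma small_angles_swap: "small_angles n y2 y1"
  using n3 y sum_less by unfold_locales auto

end

lemma between_ends:
  fixes t :: real
  assumes "lo \<le> \<phi>" "\<phi> \<le> hi" "lo \<le> \<phi> + real N * t" "\<phi> + real N * t \<le> hi" "j \<le> N"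
  shows "lo \<le> \<phi> + real j * t" "\<phi> + real j * t \<le> hi"
proof -
  have "real j * t \<le> real N * t \<and> 0 \<le> real j * t \<or> real N * t \<le> real j * t \<and> real j * t \<le> 0"
    using assms(5) by (cases "t \<ge> 0") (auto intro: mult_right_mono mult_right_mono_neg simp: mult_nonneg_nonpos)
  then show "lo \<le> \<phi> + real j * t" "\<phi> + real j * t \<le> hi" using assms(1-4) by linarith+
qed

lemma relabel_words:
  "map relabel (word_power [1, 3] M) = word_power [2, 3] M"
  "map relabel (word_power (u @ w) M) = word_power (map relabel u @ map relabel w) M"
  "map relabel (word_v n) = word_h n" "map relabel (word_H n) = word_u n"
  by (simp_all add: word_power_def map_concat relabel_def word_v_def word_h_def word_H_def word_u_def)

context small_angles
begin

text \<open>The slopes \<open>w0\<close>, \<open>w1\<close>, \<open>w2\<close>, \<open>w3\<close> belong to the edges where the path passes around \<open>A 3\<close>, and \<open>G0\<close>, \<open>G1\<close>, \<open>G2\<close>,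
\<open>G3\<close> are the pivots of the special fans there.  Along the zones the slope changes by \<open>a1 - a2\<close> per period, with
the opposite sign in the second and fourth zone, where the roles of \<open>A 1\<close> and \<open>A 2\<close> are exchanged; a special fan
turns it by \<open>a1 + 2 y1\<close> or \<open>a2 + 2 y2\<close>.  All these changes cancel, so that the last slope is \<open>w0\<close> again.
The pivots \<open>G0\<close> and \<open>G3\<close> are above the axis and \<open>G1\<close> and \<open>G2\<close> below it; the second inequality for each of them
concerns the copy of \<open>A 3\<close> at distance \<open>r1\<close> or \<open>r2\<close> from it, on the other side of the axis.\<close>
lemma runs_word_W:
  fixes k :: nat and G0 :: complex and w0 lo hi :: real
  defines "w1 \<equiv> w0 + real (k + 2) * (a1 - a2)"
  defines "w2 \<equiv> w1 - a1 - 2 * y1 + real (k + 1) * (a2 - a1)"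
  defines "w3 \<equiv> w2 - a2 - 2 * y2 + real k * (a1 - a2) + a1 + 2 * y1"
  defines "G1 \<equiv> peak (zig G0 w0 (k + 2)) w1"
  defines "G2 \<equiv> peak (small_angles.zig n y2 y1 G1 (w1 - a1 - 2 * y1) (k + 1)) w2"
  defines "G3 \<equiv> peak (zig G2 (w2 - a2 - 2 * y2) k) (w2 - a2 - 2 * y2 + real k * (a1 - a2))"
  defines "G4 \<equiv> peak (small_angles.zig n y2 y1 G3 w3 (k + 1)) (w3 + real (k + 1) * (a2 - a1))"
  assumes tame: "\<And>\<psi>. lo \<le> \<psi> \<Longrightarrow> \<psi> \<le> hi \<Longrightarrow> tame n y1 y2 \<psi> \<and> tame n y2 y1 \<psi>"
    and hi: "hi + 2 * real n * (y1 + y2) < 0"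
    and range: "{w0, w1, w1 - a1 - 2 * y1, w2, w2 - a2 - 2 * y2, w2 - a2 - 2 * y2 + real k * (a1 - a2),
      w3, w3 + real (k + 1) * (a2 - a1)} \<subseteq> {lo..hi}"
    and gate0: "Im G0 > 0" "Im G0 + r2 * sin (w0 - y2) < 0"
    and gate1: "Im G1 < 0" "Im G1 - r1 * sin (w1 - y1) > 0"
    and gate2: "Im G2 < 0" "Im G2 - r2 * sin (w2 - y2) > 0"
    and gate3: "Im G3 > 0" "Im G3 + r1 * sin (w3 - y1) < 0"
    and closes: "Im G4 = Im G0"
  shows "runs x1 x2 (word_W n k) (1, peak G0 w0, G0) (1, peak G4 w0, G4)"
proof -
  interpret sw: small_angles n y2 y1 by (rule small_angles_swap)
  have sin_x': "sin (x2 + x1) \<noteq> 0" using sin_x by (simp add: add.commute)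
  have good: "good \<psi>" "sw.good \<psi>" if "lo \<le> \<psi>" "\<psi> \<le> hi" for \<psi>
    using tame[OF that] that hi by (auto simp: good_def sw.good_def add.commute)
  have rng: "w0 \<in> {lo..hi}" "w1 \<in> {lo..hi}" "w1 - a1 - 2 * y1 \<in> {lo..hi}" "w2 \<in> {lo..hi}"
    "w2 - a2 - 2 * y2 \<in> {lo..hi}" "w2 - a2 - 2 * y2 + real k * (a1 - a2) \<in> {lo..hi}"
    "w3 \<in> {lo..hi}" "w3 + real (k + 1) * (a2 - a1) \<in> {lo..hi}"
    using range by auto
  have w4: "w3 + real (k + 1) * (a2 - a1) + a2 + 2 * y2 = w0"
    by (simp add: w3_def w2_def w1_def algebra_simps)
  let ?h3 = "word_power [2, 3] (n - 1)" and ?v3 = "word_power [1, 3] (n - 1)"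
  have A: "runs x1 x2 (word_power (?h3 @ ?v3) (k + 1) @ ?h3 @ word_v n) (1, peak G0 w0, G0)
      (-1, G1, zig G0 w0 (k + 2))"
  proof -
    have "good (w0 + real j * turn)" if "j \<le> Suc (k + 1)" for j
      using between_ends[of lo w0 hi "Suc (k + 1)" turn j] rng(1,2) that
      by (intro good) (auto simp: w1_def)
    from zone_open[where M = "k + 1", OF this gate0(2)] show ?thesis
      using gate1(2) by (simp add: G1_def w1_def)
  qed
  have B: "runs x1 x2 (word_power [2, 3] n @ word_power (?v3 @ ?h3) k @ ?v3 @ word_h n)
      (-1, G1, zig G0 w0 (k + 2)) (1, sw.zig G1 (w1 - a1 - 2 * y1) (k + 1), G2)"
  proof -
    have z: "zig G0 w0 (k + 2) = G1 - cis (v + w1)" by (simp add: G1_def peak_def)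
    have g: "sw.good w1" "sw.good (w1 - a1 - 2 * y1)" using rng by (auto intro: good)
    have 1: "runs x2 x1 (word_power [1, 3] n) (1, G1 - cis (v + w1), G1) (1, peak G1 (w1 - a1 - 2 * y1), G1)"
      using sw.start_fan[OF sw.goodD[OF g(1)] gate1] .
    have "sw.good (w1 - a1 - 2 * y1 + real j * sw.turn)" if "j \<le> Suc k" for j
      using between_ends[of lo "w1 - a1 - 2 * y1" hi "Suc k" sw.turn j] rng(3,4) that
      by (intro good) (auto simp: w2_def)
    moreover have "Im G1 + r1 * sin (w1 - a1 - 2 * y1 - y1) < 0" using gate1 sw.good_signs[OF g(2)] by simp
    ultimately have 2: "runs x2 x1 (word_power (?h3 @ ?v3) k @ ?h3 @ word_v n) (1, peak G1 (w1 - a1 - 2 * y1), G1)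
        (-1, G2, sw.zig G1 (w1 - a1 - 2 * y1) (k + 1))"
      using sw.zone_open[of k "w1 - a1 - 2 * y1" G1] gate2(2) by (simp add: G2_def w2_def)
    show ?thesis
      using runs_relabel[OF sin_x' insertI1 runs_appendI[OF 1 2]] unfolding z
      by (simp only: map_append relabel_words map_relabel_power minus_minus)
  qed
  have C: "runs x1 x2 (word_power [1, 3] n @ word_power (?h3 @ ?v3) k @ word_H n)
      (1, sw.zig G1 (w1 - a1 - 2 * y1) (k + 1), G2) (-1, G3, peak G3 w3)"
  proof -
    have z: "sw.zig G1 (w1 - a1 - 2 * y1) (k + 1) = G2 - cis (v + w2)" by (simp add: G2_def peak_def)
    have g: "good w2" "good (w2 - a2 - 2 * y2)" using rng by (auto intro: good)
    have 1: "runs x1 x2 (word_power [1, 3] n) (1, G2 - cis (v + w2), G2) (1, peak G2 (w2 - a2 - 2 * y2), G2)"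
      using start_fan[OF goodD[OF g(1)] gate2] .
    have gd: "good (w2 - a2 - 2 * y2 + real j * turn)" if "j \<le> k" for j
      using between_ends[of lo "w2 - a2 - 2 * y2" hi k turn j] rng(5,6) that
      by (intro good) auto
    have low: "Im G2 + r2 * sin (w2 - a2 - 2 * y2 - y2) < 0" using gate2 good_signs[OF g(2)] by simp
    have "w3 - y1 = w2 - a2 - 2 * y2 + real k * turn + a1 + y1" by (simp add: w3_def)
    then have gate: "Im G3 + r1 * sin (w2 - a2 - 2 * y2 + real k * turn + a1 + y1) < 0" using gate3(2) by metis
    have 2: "runs x1 x2 (word_power (?h3 @ ?v3) k @ word_H n) (1, peak G2 (w2 - a2 - 2 * y2), G2)
        (-1, G3, peak G3 w3)"
      using zone_closed[OF gd low gate3(1)[unfolded G3_def] gate[unfolded G3_def], folded G3_def, folded w3_def] .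
    show ?thesis unfolding z by (rule runs_appendI[OF 1 2])
  qed
  have D: "runs x1 x2 (word_power (?v3 @ ?h3) (k + 1) @ word_u n) (-1, G3, peak G3 w3) (1, peak G4 w0, G4)"
  proof -
    have gd: "sw.good (w3 + real j * sw.turn)" if "j \<le> k + 1" for j
      using between_ends[of lo w3 hi "k + 1" sw.turn j] rng(7,8) that
      by (intro good) auto
    have top: "Im G4 > 0" using gate0 closes by simp
    have "w0 - y2 = w3 + real (k + 1) * sw.turn + a2 + y2" using w4 by simp
    then have gate: "Im G4 + r2 * sin (w3 + real (k + 1) * sw.turn + a2 + y2) < 0"
      using gate0(2) closes by metis
    have "runs x2 x1 (word_power (?h3 @ ?v3) (k + 1) @ word_H n) (1, peak G3 w3, G3)
        (-1, G4, peak G4 w0)"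
      using sw.zone_closed[OF gd gate3(2) top[unfolded G4_def] gate[unfolded G4_def], folded G4_def, unfolded w4] .
    from runs_relabel[OF sin_x' insertI1 this] show ?thesis
      by (simp only: map_append relabel_words map_relabel_power minus_minus)
  qed
  have "n \<ge> 2" using n3 by simp
  show ?thesis unfolding word_W_eq[OF \<open>n \<ge> 2\<close>]
    by (rule runs_appendI[OF A runs_appendI[OF B runs_appendI[OF C D]]])
qed

end

section \<open>Limits of long zigzags\<close>
lemma base_angle_bounds:
  assumes "n \<ge> 3"
  shows "0 < base_angle n" "3 * base_angle n \<le> pi / 2"
proof -
  have "real n \<ge> 3" using assms by simp
  then have "base_angle n \<le> pi / (2 * 3)" unfolding base_angle_def by (intro divide_left_mono) auto
  then show "0 < base_angle n" "3 * base_angle n \<le> pi / 2" using assms by (auto simp: base_angle_def)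
qed

lemma side_ratio_isosceles:
  assumes "sin v \<noteq> 0" "cos v \<noteq> 0"
  shows "side_ratio v v = 1 / (2 * cos v)"
  using assms by (simp add: side_ratio_def sin_double flip: mult_2)

lemma tendsto_less:
  fixes f g :: "'a \<Rightarrow> real"
  assumes "(f \<longlongrightarrow> a) F" "(g \<longlongrightarrow> b) F" "a < b"
  shows "eventually (\<lambda>x. f x < g x) F"
proof -
  have "((\<lambda>x. g x - f x) \<longlongrightarrow> b - a) F" using assms by (intro tendsto_diff)
  from order_tendstoD(1)[OF this, of 0] show ?thesis using assms(3) by (simp add: algebra_simps)
qed

lemma tendsto_side_ratio:
  assumes "(f \<longlongrightarrow> x) F" "(g \<longlongrightarrow> x') F" "sin (x + x') \<noteq> 0"
  shows "((\<lambda>z. side_ratio (f z) (g z)) \<longlongrightarrow> side_ratio x x') F"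
  unfolding side_ratio_def by (rule tendsto_divide isCont_tendsto_compose[OF isCont_sin] tendsto_add assms)+

text \<open>At the point 0 the inequalities reduce to \<open>sin v < sin (3 v)\<close>, which needs \<open>3 v \<le> pi / 2\<close>, to
\<open>1 / (2 cos v) < cos v\<close>, and to signs.\<close>
lemma tame_near:
  assumes n: "n \<ge> 3"
  obtains \<kappa> where "\<kappa> > 0" "\<And>y1 y2 \<phi>. \<bar>y1\<bar> < \<kappa> \<Longrightarrow> \<bar>y2\<bar> < \<kappa> \<Longrightarrow> \<bar>\<phi>\<bar> < \<kappa> \<Longrightarrow> tame n y1 y2 \<phi>"
proof -
  define v where "v = base_angle n"
  note vb = base_angle_bounds[OF n, folded v_def]
  have v2: "2 * v < pi" "v < pi / 2" using vb pi_gt_zero by linarith+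
  have s: "0 < sin v" "0 < sin (2 * v)" using vb v2 by (auto intro!: sin_gt_zero)
  have c: "0 < cos v" using vb v2 by (intro cos_gt_zero) auto
  have s3: "sin v < sin (3 * v)" using vb by (intro sin_monotone_2pi) auto
  have "cos (pi / 4) < cos v" using vb by (intro cos_monotone_0_pi) auto
  then have "(cos (pi / 4))\<^sup>2 < (cos v)\<^sup>2" by (intro power_strict_mono) (auto intro: cos_ge_zero)
  then have c2: "1 < 2 * (cos v * cos v)" by (simp add: cos_45 power2_eq_square power_divide)
  define r where "r = side_ratio v v"
  have r: "r = 1 / (2 * cos v)" using side_ratio_isosceles[of v] s c by (simp add: r_def)
  have r1: "0 < r" "r < cos v" using c c2 by (auto simp: r field_simps)
  define F where "F = nhds (0 :: real \<times> real \<times> real)"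
  define y1 y2 ph where "y1 z = fst z" "y2 z = fst (snd z)" "ph z = snd (snd z)" for z :: "real \<times> real \<times> real"
  have id: "((\<lambda>z. z) \<longlongrightarrow> 0) F" by (simp add: F_def filterlim_ident)
  have lims: "(y1 \<longlongrightarrow> 0) F" "(y2 \<longlongrightarrow> 0) F" "(ph \<longlongrightarrow> 0) F"
    unfolding y1_y2_ph_def using tendsto_fst[OF id] tendsto_snd[OF id]
      tendsto_fst[OF tendsto_snd[OF id]] tendsto_snd[OF tendsto_snd[OF id]] by simp_all
  have x: "((\<lambda>z. v + y1 z) \<longlongrightarrow> v) F" "((\<lambda>z. v + y2 z) \<longlongrightarrow> v) F"
    using tendsto_add[OF tendsto_const lims(1), of v] tendsto_add[OF tendsto_const lims(2), of v] by simp_all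
  have sv: "sin (v + v) \<noteq> 0" using s by (simp flip: mult_2)
  have R: "((\<lambda>z. side_ratio (v + y1 z) (v + y2 z)) \<longlongrightarrow> r) F" "((\<lambda>z. side_ratio (v + y2 z) (v + y1 z)) \<longlongrightarrow> r) F"
    unfolding r_def by (rule tendsto_side_ratio[OF x(1,2) sv] tendsto_side_ratio[OF x(2,1) sv])+
  note L = tendsto_eq_intros lims R
  have e1: "eventually (\<lambda>z. 0 < side_ratio (v + y1 z) (v + y2 z)) F"
    by (rule tendsto_less[where a = "0" and b = "r"]) (use s s3 r1 vb in \<open>auto intro!: L\<close>)
  have e2: "eventually (\<lambda>z. 0 < side_ratio (v + y2 z) (v + y1 z)) F"
    by (rule tendsto_less[where a = "0" and b = "r"]) (use s s3 r1 vb in \<open>auto intro!: L\<close>)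
  have e3: "eventually (\<lambda>z. side_ratio (v + y2 z) (v + y1 z) < cos (v - (2 * real n - 2) * y1 z / 2)) F"
    by (rule tendsto_less[where a = "r" and b = "cos v"]) (use s s3 r1 vb in \<open>auto intro!: L\<close>)
  have e4: "eventually (\<lambda>z. side_ratio (v + y1 z) (v + y2 z) < cos (v - (2 * real n - 2) * y2 z / 2)) F"
    by (rule tendsto_less[where a = "r" and b = "cos v"]) (use s s3 r1 vb in \<open>auto intro!: L\<close>)
  have e5: "eventually (\<lambda>z. \<bar>ph z\<bar> + (2 * real n - 2) * y1 z + (2 * real n - 2) * y2 z + 2 * y1 z + 2 * y2 z < v) F"
    by (rule tendsto_less[where a = "0" and b = "v"]) (use s s3 r1 vb in \<open>auto intro!: L\<close>)
  have e6: "eventually (\<lambda>z. side_ratio (v + y2 z) (v + y1 z) * sin (y2 z - ph z) + sin (v + ph z) < sin (3 * v + ph z + 2 * y1 z)) F"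
    by (rule tendsto_less[where a = "sin v" and b = "sin (3 * v)"]) (use s s3 r1 vb in \<open>auto intro!: L\<close>)
  have e7: "eventually (\<lambda>z. sin (v - ph z - (2 * real n - 2) * y1 z) < sin (3 * v - ph z - (2 * real n - 2) * y1 z + 2 * y2 z)) F"
    by (rule tendsto_less[where a = "sin v" and b = "sin (3 * v)"]) (use s s3 r1 vb in \<open>auto intro!: L\<close>)
  have e8: "eventually (\<lambda>z. sin (v - ph z - (2 * real n - 2) * y1 z) < sin (3 * v + ph z + (2 * real n - 2) * y1 z - (2 * real n - 2) * y2 z + 2 * y2 z)) F"
    by (rule tendsto_less[where a = "sin v" and b = "sin (3 * v)"]) (use s s3 r1 vb in \<open>auto intro!: L\<close>)
  have e9: "eventually (\<lambda>z. - side_ratio (v + y1 z) (v + y2 z) * sin (ph z + (2 * real n - 2) * y1 z + y1 z) < sin (v - ph z - (2 * real n - 2) * y1 z)) F"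
    by (rule tendsto_less[where a = "0" and b = "sin v"]) (use s s3 r1 vb in \<open>auto intro!: L\<close>)
  have e10: "eventually (\<lambda>z. sin (y2 z - ph z) < sin (2 * v + ph z - (2 * real n - 2) * y2 z - y2 z)) F"
    by (rule tendsto_less[where a = "0" and b = "sin (2 * v)"]) (use s s3 r1 vb in \<open>auto intro!: L\<close>)
  have e11: "eventually (\<lambda>z. side_ratio (v + y2 z) (v + y1 z) * sin (y2 z - ph z) < sin (v - ph z + 2 * y2 z)) F"
    by (rule tendsto_less[where a = "0" and b = "sin v"]) (use s s3 r1 vb in \<open>auto intro!: L\<close>)
  have e12: "eventually (\<lambda>z. side_ratio (v + y2 z) (v + y1 z) * sin (y2 z - ph z) < sin (v + ph z - (2 * real n - 2) * y2 z - 2 * y2 z)) F"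
    by (rule tendsto_less[where a = "0" and b = "sin v"]) (use s s3 r1 vb in \<open>auto intro!: L\<close>)
  have "eventually (\<lambda>z. tame n (y1 z) (y2 z) (ph z)) F"
    using e1 e2 e3 e4 e5 e6 e7 e8 e9 e10 e11 e12
    unfolding tame_def Let_def v_def[symmetric] by eventually_elim blast
  then obtain d where d: "d > 0" "\<And>z. dist z 0 < d \<Longrightarrow> tame n (y1 z) (y2 z) (ph z)"
    unfolding F_def eventually_nhds_metric by blast
  show ?thesis
  proof (rule that[of "d / 3"])
    fix a b f :: real assume *: "\<bar>a\<bar> < d / 3" "\<bar>b\<bar> < d / 3" "\<bar>f\<bar> < d / 3"
    have "norm (a, b, f) \<le> norm a + (norm b + norm f)"
      using norm_Pair_le[of a "(b, f)"] norm_Pair_le[of b f] by linarith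
    then have "dist (a, b, f) 0 < d" using * by (simp add: dist_norm)
    from d(2)[OF this] show "tame n a b f" by (simp add: y1_y2_ph_def)
  qed (use d in auto)
qed

text \<open>The vector from the first pivot to the last in a zone of \<open>N\<close> periods and one more ascending edge;
\<open>2 cos (v - a / 2)\<close> is the length of a period.\<close>
definition chain_vec :: "real \<Rightarrow> real \<Rightarrow> real \<Rightarrow> real \<Rightarrow> nat \<Rightarrow> complex" where
  "chain_vec v a \<theta> \<phi> N = of_real (2 * cos (v - a / 2)) * (\<Sum>i<N. cis (\<phi> + real i * \<theta> + a / 2)) + cis (v + (\<phi> + real N * \<theta>))"

lemma chain_vec_rotate: "chain_vec v a \<theta> (u + \<phi>) N = cis u * chain_vec v a \<theta> \<phi> N"
proof -
  have "cis (u + \<phi> + real i * \<theta> + a / 2) = cis u * cis (\<phi> + real i * \<theta> + a / 2)"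
    "cis (v + (u + \<phi> + real i * \<theta>)) = cis u * cis (v + (\<phi> + real i * \<theta>))" for i
    unfolding cis_mult by (simp_all add: algebra_simps)
  then show ?thesis by (simp add: chain_vec_def sum_distrib_left algebra_simps)
qed

context small_angles
begin

lemma peak_zig: "peak (zig b \<phi> N) (\<phi> + real N * turn) = b + chain_vec v a1 turn \<phi> N"
proof -
  have "cis (v + p) + cis (p + a1 - v) = of_real (2 * cos (v - a1 / 2)) * cis (p + a1 / 2)" for p
  proof -
    have "cis (v + p) = cis (v - a1 / 2) * cis (p + a1 / 2)"
      "cis (p + a1 - v) = cis (- (v - a1 / 2)) * cis (p + a1 / 2)"
      unfolding cis_mult by (simp_all add: algebra_simps)
    moreover have "cis t + cis (- t) = of_real (2 * cos t)" for t by (simp add: complex_eq_iff)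
    ultimately show ?thesis by (metis distrib_right)
  qed
  then show ?thesis by (simp add: zig_def peak_def chain_vec_def sum_distrib_left)
qed

end

text \<open>Everything is scaled by a factor that tends to infinity; a scaled limit implies that the
quantity itself tends to 0.\<close>
lemma tendsto_inverse_scale:
  assumes "filterlim K at_top sequentially" "(\<lambda>m. K m * x m) \<longlonglongrightarrow> (l :: real)"
  shows "x \<longlonglongrightarrow> 0"
proof -
  have "(\<lambda>m. inverse (K m) * (K m * x m)) \<longlonglongrightarrow> 0 * l"
    using assms by (intro tendsto_mult tendsto_inverse_0_at_top)
  moreover have "eventually (\<lambda>m. inverse (K m) * (K m * x m) = x m) sequentially"
    using filterlim_at_top_dense[THEN iffD1, OF assms(1), rule_format, of 0] by eventually_elim simp
  ultimately show ?thesis by (simp add: tendsto_cong)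
qed

lemma sin_cubic: "\<bar>sin z - z\<bar> \<le> \<bar>z\<bar> ^ 3" for z :: real
proof -
  have "\<bar>sin z - (\<Sum>m<3. sin_coeff m * z ^ m)\<bar> \<le> inverse (fact 3) * \<bar>z\<bar> ^ 3"
    by (rule Maclaurin_sin_bound)
  also have "(\<Sum>m<3. sin_coeff m * z ^ m) = z" by (simp add: numeral_3_eq_3 sin_coeff_def)
  also have "inverse (fact 3) * \<bar>z\<bar> ^ 3 \<le> 1 * \<bar>z\<bar> ^ 3" by (intro mult_right_mono) (auto simp: fact_numeral)
  finally show ?thesis by simp
qed

lemma cos_quadratic: "\<bar>cos z - 1\<bar> \<le> \<bar>z\<bar> ^ 2" for z :: real
proof -
  have "cos z = 1 - 2 * (sin (z / 2))\<^sup>2" using cos_double_sin[of "z / 2"] by simp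
  moreover have "(sin (z / 2))\<^sup>2 \<le> (z / 2)\<^sup>2"
    using abs_sin_x_le_abs_x[of "z / 2"] unfolding abs_le_square_iff .
  moreover have "(z / 2)\<^sup>2 = z\<^sup>2 / 4" by (simp add: power_divide)
  moreover have "0 \<le> (sin (z / 2))\<^sup>2" by simp
  ultimately show ?thesis unfolding power2_abs by linarith
qed

lemma scaled_sin:
  assumes "filterlim K at_top sequentially" "(\<lambda>m. K m * x m) \<longlonglongrightarrow> (l :: real)"
  shows "(\<lambda>m. K m * sin (x m)) \<longlonglongrightarrow> l" "(\<lambda>m. K m * (cos (x m) - 1)) \<longlonglongrightarrow> 0"
    "(\<lambda>m. K m * (sin (x m) - x m)) \<longlonglongrightarrow> 0"
proof -
  note x0 = tendsto_inverse_scale[OF assms]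
  have K0: "eventually (\<lambda>m. 0 < K m) sequentially"
    using filterlim_at_top_dense[THEN iffD1, OF assms(1), rule_format, of 0] .
  have "(\<lambda>m. \<bar>K m * x m\<bar> * \<bar>x m\<bar>) \<longlonglongrightarrow> \<bar>l\<bar> * \<bar>0\<bar>" by (intro tendsto_intros assms x0)
  then have q: "(\<lambda>m. \<bar>K m * x m\<bar> * \<bar>x m\<bar>) \<longlonglongrightarrow> 0" by simp
  have "(\<lambda>m. \<bar>K m * x m\<bar> * (\<bar>x m\<bar> * \<bar>x m\<bar>)) \<longlonglongrightarrow> \<bar>l\<bar> * (\<bar>0\<bar> * \<bar>0\<bar>)" by (intro tendsto_intros assms x0)
  then have c: "(\<lambda>m. \<bar>K m * x m\<bar> * (\<bar>x m\<bar> * \<bar>x m\<bar>)) \<longlonglongrightarrow> 0" by simp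
  show "(\<lambda>m. K m * (cos (x m) - 1)) \<longlonglongrightarrow> 0"
    using K0 cos_quadratic by (intro Lim_null_comparison[OF _ q])
      (eventually_elim, auto simp: abs_mult power2_eq_square mult.assoc intro!: mult_left_mono)
  show d: "(\<lambda>m. K m * (sin (x m) - x m)) \<longlonglongrightarrow> 0"
  proof (rule Lim_null_comparison[OF _ c], use K0 in eventually_elim)
    fix m assume "0 < K m"
    then show "norm (K m * (sin (x m) - x m)) \<le> \<bar>K m * x m\<bar> * (\<bar>x m\<bar> * \<bar>x m\<bar>)"
      using mult_left_mono[OF sin_cubic[of "x m"], of "K m"] by (simp add: abs_mult power3_eq_cube mult.assoc)
  qed
  show "(\<lambda>m. K m * sin (x m)) \<longlonglongrightarrow> l"
    using tendsto_add[OF assms(2) d] by (simp add: algebra_simps)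
qed


text \<open>A zone of about \<open>K\<close> periods whose slopes are of order \<open>1 / K\<close> and change by the order \<open>1 / K^2\<close> per
period.  In its height the sine can be replaced by its argument: the error is
\<open>O(N / K^3)\<close>, which vanishes even after multiplication by \<open>K\<close>.  The sum of the slopes is evaluated
exactly, since it is multiplied by \<open>K\<close> as well and so may not be approximated.\<close>
lemma chain_vec_limit:
  fixes K \<theta> \<phi> a :: "nat \<Rightarrow> real" and N :: "nat \<Rightarrow> nat"
  assumes K: "filterlim K at_top sequentially" and N: "(\<lambda>m. real (N m) / K m) \<longlonglongrightarrow> 1"
    and \<phi>: "(\<lambda>m. K m * \<phi> m) \<longlonglongrightarrow> f" and \<theta>: "(\<lambda>m. K m * K m * \<theta> m) \<longlonglongrightarrow> \<tau>"
    and a: "(\<lambda>m. K m * K m * a m) \<longlonglongrightarrow> A"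
  shows "(\<lambda>m. Re (chain_vec v (a m) (\<theta> m) (\<phi> m) (N m)) / K m) \<longlonglongrightarrow> 2 * cos v"
    and "(\<lambda>m. K m * (Im (chain_vec v (a m) (\<theta> m) (\<phi> m) (N m)) - sin v) - 2 * cos v * (K m *
       (real (N m) * \<phi> m + \<theta> m * (real (N m) * (real (N m) - 1) / 2) + real (N m) * (a m / 2))))
      \<longlonglongrightarrow> cos v * (f + \<tau>)"
proof -
  have K0: "eventually (\<lambda>m. 0 < K m) sequentially"
    using filterlim_at_top_dense[THEN iffD1, OF K, rule_format, of 0] .
  have iK: "(\<lambda>m. inverse (K m)) \<longlonglongrightarrow> 0" using K by (rule tendsto_inverse_0_at_top)
  have Ka: "(\<lambda>m. K m * a m) \<longlonglongrightarrow> 0"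
    by (rule tendsto_inverse_scale[OF K]) (use a in \<open>simp add: mult.assoc\<close>)
  have a0: "a \<longlonglongrightarrow> 0" by (rule tendsto_inverse_scale[OF K Ka])
  have N\<theta>: "(\<lambda>m. K m * (real (N m) * \<theta> m)) \<longlonglongrightarrow> \<tau>"
  proof -
    have "(\<lambda>m. real (N m) / K m * (K m * K m * \<theta> m)) \<longlonglongrightarrow> 1 * \<tau>" by (intro tendsto_mult N \<theta>)
    moreover have "eventually (\<lambda>m. real (N m) / K m * (K m * K m * \<theta> m) = K m * (real (N m) * \<theta> m)) sequentially"
      using K0 by eventually_elim simp
    ultimately show ?thesis by (simp add: tendsto_cong)
  qed
  define Z where "Z m = \<bar>\<phi> m\<bar> + \<bar>real (N m) * \<theta> m\<bar> + \<bar>a m\<bar>" for m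
  have KZ: "(\<lambda>m. K m * Z m) \<longlonglongrightarrow> \<bar>f\<bar> + \<bar>\<tau>\<bar> + \<bar>0\<bar>"
  proof -
    have "(\<lambda>m. \<bar>K m * \<phi> m\<bar> + \<bar>K m * (real (N m) * \<theta> m)\<bar> + \<bar>K m * a m\<bar>) \<longlonglongrightarrow> \<bar>f\<bar> + \<bar>\<tau>\<bar> + \<bar>0\<bar>"
      by (intro tendsto_intros \<phi> N\<theta> Ka)
    moreover have "eventually (\<lambda>m. \<bar>K m * \<phi> m\<bar> + \<bar>K m * (real (N m) * \<theta> m)\<bar> + \<bar>K m * a m\<bar> = K m * Z m) sequentially"
      using K0 by eventually_elim (simp add: Z_def abs_mult algebra_simps)
    ultimately show ?thesis by (simp only: tendsto_cong)
  qed
  have Z0: "Z \<longlonglongrightarrow> 0" by (rule tendsto_inverse_scale[OF K KZ])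
  have NZ: "(\<lambda>m. real (N m) * Z m) \<longlonglongrightarrow> 1 * (\<bar>f\<bar> + \<bar>\<tau>\<bar> + \<bar>0\<bar>)"
  proof -
    have "(\<lambda>m. real (N m) / K m * (K m * Z m)) \<longlonglongrightarrow> 1 * (\<bar>f\<bar> + \<bar>\<tau>\<bar> + \<bar>0\<bar>)" by (intro tendsto_mult N KZ)
    moreover have "eventually (\<lambda>m. real (N m) / K m * (K m * Z m) = real (N m) * Z m) sequentially"
      using K0 by eventually_elim simp
    ultimately show ?thesis by (simp only: tendsto_cong)
  qed
  define z where "z m i = \<phi> m + real i * \<theta> m + a m / 2" for m i
  have z: "\<bar>z m i\<bar> \<le> Z m" if "i < N m" for m i
  proof -
    have "\<bar>real i * \<theta> m\<bar> \<le> \<bar>real (N m) * \<theta> m\<bar>" using that by (auto simp: abs_mult intro!: mult_right_mono)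
    then show ?thesis unfolding z_def Z_def by linarith
  qed
  define S where "S m = real (N m) * \<phi> m + \<theta> m * (real (N m) * (real (N m) - 1) / 2) + real (N m) * (a m / 2)" for m
  have sum_z: "(\<Sum>i<N m. z m i) = S m" for m
  proof -
    have g: "(\<Sum>i<M. real i) = real M * (real M - 1) / 2" for M by (induction M) (auto simp: field_simps)
    show ?thesis unfolding z_def S_def by (simp add: sum.distrib g flip: sum_distrib_right)
  qed
  define E where "E m = (\<Sum>i<N m. sin (z m i)) - S m" for m
  define E' where "E' m = (\<Sum>i<N m. cos (z m i)) - real (N m)" for m
  have Eb: "\<bar>E m\<bar> \<le> real (N m) * Z m ^ 3" for m
  proof -
    have "\<bar>E m\<bar> = \<bar>\<Sum>i<N m. sin (z m i) - z m i\<bar>" unfolding E_def sum_z[symmetric] by (simp add: sum_subtractf)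
    also have "\<dots> \<le> (\<Sum>i<N m. Z m ^ 3)"
    proof (rule order_trans[OF sum_abs], rule sum_mono)
      fix i assume "i \<in> {..<N m}"
      then show "\<bar>sin (z m i) - z m i\<bar> \<le> Z m ^ 3"
        using sin_cubic[of "z m i"] power_mono[OF z[of i m], of 3] by simp
    qed
    finally show ?thesis by simp
  qed
  have E: "(\<lambda>m. K m * E m) \<longlonglongrightarrow> 0"
  proof -
    have "(\<lambda>m. real (N m) * Z m * (K m * Z m) * Z m) \<longlonglongrightarrow> 1 * (\<bar>f\<bar> + \<bar>\<tau>\<bar> + \<bar>0\<bar>) * (\<bar>f\<bar> + \<bar>\<tau>\<bar> + \<bar>0\<bar>) * 0"
      by (intro tendsto_mult NZ KZ Z0)
    then have lim: "(\<lambda>m. real (N m) * Z m * (K m * Z m) * Z m) \<longlonglongrightarrow> 0" by simp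
    show ?thesis
    proof (rule Lim_null_comparison[OF _ lim], use K0 in eventually_elim)
      fix m assume "0 < K m"
      then show "norm (K m * E m) \<le> real (N m) * Z m * (K m * Z m) * Z m"
        using mult_left_mono[OF Eb[of m], of "K m"]
        by (simp add: abs_mult power3_eq_cube mult_ac)
    qed
  qed
  have E'b: "\<bar>E' m\<bar> \<le> real (N m) * Z m ^ 2" for m
  proof -
    have "\<bar>E' m\<bar> = \<bar>\<Sum>i<N m. cos (z m i) - 1\<bar>" unfolding E'_def by (simp add: sum_subtractf)
    also have "\<dots> \<le> (\<Sum>i<N m. Z m ^ 2)"
    proof (rule order_trans[OF sum_abs], rule sum_mono)
      fix i assume "i \<in> {..<N m}"
      then show "\<bar>cos (z m i) - 1\<bar> \<le> Z m ^ 2"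
        using cos_quadratic[of "z m i"] power_mono[OF z[of i m], of 2] by simp
    qed
    finally show ?thesis by simp
  qed
  have "(\<lambda>m. real (N m) * Z m * Z m) \<longlonglongrightarrow> 1 * (\<bar>f\<bar> + \<bar>\<tau>\<bar> + \<bar>0\<bar>) * 0" by (intro tendsto_mult NZ Z0)
  then have lim: "(\<lambda>m. real (N m) * Z m ^ 2) \<longlonglongrightarrow> 0" by (simp add: power2_eq_square mult.assoc)
  have E': "E' \<longlonglongrightarrow> 0"
    by (rule Lim_null_comparison[OF always_eventually lim]) (simp add: E'b)
  define w where "w m = \<phi> m + real (N m) * \<theta> m" for m
  have Kw: "(\<lambda>m. K m * w m) \<longlonglongrightarrow> f + \<tau>"
    using tendsto_add[OF \<phi> N\<theta>] by (simp add: w_def algebra_simps)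
  have w0: "w \<longlonglongrightarrow> 0" by (rule tendsto_inverse_scale[OF K Kw])
  define C where "C m = cos (v - a m / 2)" for m
  have C: "C \<longlonglongrightarrow> cos v"
    unfolding C_def using a0 by (auto intro!: tendsto_eq_intros isCont_tendsto_compose[OF isCont_cos])
  have Re: "Re (chain_vec v (a m) (\<theta> m) (\<phi> m) (N m)) = 2 * C m * (real (N m) + E' m) + cos (v + w m)" for m
    by (simp add: chain_vec_def E'_def C_def w_def z_def)
  have Im: "Im (chain_vec v (a m) (\<theta> m) (\<phi> m) (N m)) = 2 * C m * (S m + E m) + sin (v + w m)" for m
    by (simp add: chain_vec_def E_def C_def w_def z_def)
  have cw: "(\<lambda>m. cos (v + w m)) \<longlonglongrightarrow> cos (v + 0)"
    by (intro isCont_tendsto_compose[OF isCont_cos] tendsto_add tendsto_const w0)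
  have "(\<lambda>m. 2 * C m * (real (N m) / K m + E' m * inverse (K m)) + cos (v + w m) * inverse (K m)) \<longlonglongrightarrow>
      2 * cos v * (1 + 0 * 0) + cos (v + 0) * 0"
    by (intro tendsto_intros C N E' iK cw)
  then show "(\<lambda>m. Re (chain_vec v (a m) (\<theta> m) (\<phi> m) (N m)) / K m) \<longlonglongrightarrow> 2 * cos v"
    unfolding Re by (simp add: divide_inverse algebra_simps)
  have dC: "(\<lambda>m. K m * (C m - cos v)) \<longlonglongrightarrow> 0"
  proof -
    have Ka': "(\<lambda>m. K m * (- a m / 2)) \<longlonglongrightarrow> 0" using tendsto_mult_right[OF Ka, of "- 1 / 2"] by (simp add: algebra_simps)
    have "(\<lambda>m. cos v * (K m * (cos (- a m / 2) - 1)) - sin v * (K m * sin (- a m / 2))) \<longlonglongrightarrow> cos v * 0 - sin v * 0"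
      by (intro tendsto_intros scaled_sin[OF K Ka'])
    moreover have "cos v * (K m * (cos (- a m / 2) - 1)) - sin v * (K m * sin (- a m / 2)) = K m * (C m - cos v)" for m
      using cos_add[of v "- a m / 2"] by (simp add: C_def algebra_simps)
    ultimately show ?thesis by simp
  qed
  have S: "S \<longlonglongrightarrow> f + \<tau> / 2"
  proof -
    have N\<phi>: "(\<lambda>m. real (N m) / K m * (K m * \<phi> m)) \<longlonglongrightarrow> 1 * f" by (intro tendsto_mult N \<phi>)
    have NN: "(\<lambda>m. real (N m) / K m * (K m * (real (N m) * \<theta> m))) \<longlonglongrightarrow> 1 * \<tau>" by (intro tendsto_mult N N\<theta>)
    have N1: "(\<lambda>m. real (N m) * \<theta> m) \<longlonglongrightarrow> 0" by (rule tendsto_inverse_scale[OF K N\<theta>])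
    have Na: "(\<lambda>m. real (N m) / K m * (K m * a m)) \<longlonglongrightarrow> 1 * 0" by (intro tendsto_mult N Ka)
    have "(\<lambda>m. real (N m) / K m * (K m * \<phi> m) + (real (N m) / K m * (K m * (real (N m) * \<theta> m)) - real (N m) * \<theta> m) * (1 / 2)
        + real (N m) / K m * (K m * a m) * (1 / 2)) \<longlonglongrightarrow> 1 * f + (1 * \<tau> - 0) * (1 / 2) + 1 * 0 * (1 / 2)"
      by (intro tendsto_add tendsto_mult[OF _ tendsto_const] tendsto_diff N\<phi> NN N1 Na)
    moreover have "eventually (\<lambda>m. real (N m) / K m * (K m * \<phi> m) + (real (N m) / K m * (K m * (real (N m) * \<theta> m)) - real (N m) * \<theta> m) * (1 / 2)
        + real (N m) / K m * (K m * a m) * (1 / 2) = S m) sequentially"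
      using K0 by eventually_elim (simp add: S_def field_simps)
    ultimately show ?thesis by (simp add: tendsto_cong)
  qed
  have "(\<lambda>m. 2 * (K m * (C m - cos v)) * S m + 2 * C m * (K m * E m) +
      (sin v * (K m * (cos (w m) - 1)) + cos v * (K m * sin (w m)))) \<longlonglongrightarrow>
      2 * 0 * (f + \<tau> / 2) + 2 * cos v * 0 + (sin v * 0 + cos v * (f + \<tau>))"
    by (intro tendsto_add tendsto_mult tendsto_const dC S C E scaled_sin[OF K Kw])
  moreover have "2 * (K m * (C m - cos v)) * S m + 2 * C m * (K m * E m) +
      (sin v * (K m * (cos (w m) - 1)) + cos v * (K m * sin (w m))) =
      K m * (Im (chain_vec v (a m) (\<theta> m) (\<phi> m) (N m)) - sin v) - 2 * cos v * (K m * S m)" for m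
    unfolding Im sin_add by (simp add: algebra_simps)
  ultimately show "(\<lambda>m. K m * (Im (chain_vec v (a m) (\<theta> m) (\<phi> m) (N m)) - sin v) - 2 * cos v * (K m *
       (real (N m) * \<phi> m + \<theta> m * (real (N m) * (real (N m) - 1) / 2) + real (N m) * (a m / 2))))
      \<longlonglongrightarrow> cos v * (f + \<tau>)"
    unfolding S_def[symmetric] by simp
qed

section \<open>Rescaled sequences of triangles\<close>
lemma scaled_arctan:
  assumes K: "filterlim K at_top sequentially" and z: "(\<lambda>m. K m * z m) \<longlonglongrightarrow> (l :: real)"
  shows "(\<lambda>m. K m * arctan (z m)) \<longlonglongrightarrow> l"
proof -
  note z0 = tendsto_inverse_scale[OF K z]
  have w0: "(\<lambda>m. arctan (z m)) \<longlonglongrightarrow> 0" using tendsto_arctan[OF z0] by simp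
  have K0: "eventually (\<lambda>m. 0 < K m) sequentially"
    using filterlim_at_top_dense[THEN iffD1, OF K, rule_format, of 0] .
  have le: "\<bar>arctan t\<bar> \<le> \<bar>t\<bar>" for t :: real
    using abs_arctan_le by blast
  have s: "(\<lambda>m. K m * z m * cos (arctan (z m))) \<longlonglongrightarrow> l * cos 0"
    by (intro tendsto_mult z isCont_tendsto_compose[OF isCont_cos] w0)
  have sin: "K m * z m * cos (arctan (z m)) = K m * sin (arctan (z m))" for m
    using tan_arctan[of "z m"] cos_arctan_not_zero[of "z m"] by (simp add: tan_def field_simps)
  have "(\<lambda>m. \<bar>K m * z m\<bar> * (\<bar>z m\<bar> * \<bar>z m\<bar>)) \<longlonglongrightarrow> \<bar>l\<bar> * (\<bar>0\<bar> * \<bar>0\<bar>)" by (intro tendsto_intros z z0)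
  then have c: "(\<lambda>m. \<bar>K m * z m\<bar> * (\<bar>z m\<bar> * \<bar>z m\<bar>)) \<longlonglongrightarrow> 0" by simp
  have d: "(\<lambda>m. K m * (sin (arctan (z m)) - arctan (z m))) \<longlonglongrightarrow> 0"
  proof (rule Lim_null_comparison[OF _ c], use K0 in eventually_elim)
    fix m assume "0 < K m"
    moreover have "\<bar>sin (arctan (z m)) - arctan (z m)\<bar> \<le> \<bar>z m\<bar> ^ 3"
      by (rule order_trans[OF sin_cubic power_mono[OF le abs_ge_zero]])
    ultimately show "norm (K m * (sin (arctan (z m)) - arctan (z m))) \<le> \<bar>K m * z m\<bar> * (\<bar>z m\<bar> * \<bar>z m\<bar>)"
      using mult_left_mono[of "\<bar>sin (arctan (z m)) - arctan (z m)\<bar>" "\<bar>z m\<bar> ^ 3" "K m"]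
      by (simp add: abs_mult power3_eq_cube mult.assoc)
  qed
  show ?thesis using tendsto_diff[OF s d] unfolding sin by (simp add: algebra_simps)
qed

text \<open>A sequence of triangles that tends to \<open>V n\<close> and a number \<open>k m\<close> for each of them, chosen such that
the rescaled perturbation converges.\<close>
locale shrinking =
  fixes n :: nat and k :: "nat \<Rightarrow> nat" and Y1 Y2 :: "nat \<Rightarrow> real" and \<eta>1 \<eta>2 :: real
  assumes n3: "n \<ge> 3" and k: "filterlim (\<lambda>m. real (k m)) at_top sequentially"
    and \<eta>1: "(\<lambda>m. real (k m) * real (k m) * Y1 m) \<longlonglongrightarrow> \<eta>1"
    and \<eta>2: "(\<lambda>m. real (k m) * real (k m) * Y2 m) \<longlonglongrightarrow> \<eta>2"
    and Y_nonneg: "\<And>m. 0 \<le> Y1 m" "\<And>m. 0 \<le> Y2 m"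
begin

abbreviation "K m \<equiv> real (k m)"
abbreviation "v \<equiv> base_angle n"
abbreviation "c \<equiv> cos v"
abbreviation "s \<equiv> sin v"
abbreviation "A \<equiv> 2 * real n - 2"
abbreviation "al m \<equiv> A * Y1 m"
abbreviation "be m \<equiv> A * Y2 m"
abbreviation "\<delta> \<equiv> \<eta>1 - \<eta>2"

text \<open>The slopes of \<open>runs_word_W\<close>.  The parameter \<open>u\<close> is the mean slope of each zone, up to terms of
order \<open>1 / k^2\<close>; it will be chosen such that the unfolding closes up along the axis.\<close>
definition "w0 u m = u - K m * (al m - be m) / 2" for u m
definition "w1 u m = w0 u m + real (k m + 2) * (al m - be m)" for u m
definition "w2 u m = w1 u m - al m - 2 * Y1 m + real (k m + 1) * (be m - al m)" for u m
definition "w3 u m = w2 u m - be m - 2 * Y2 m + real (k m) * (al m - be m) + al m + 2 * Y1 m" for u m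

text \<open>The vectors from one gate to the next; their sum \<open>T\<close> is the translation by which the unfolding
closes up.\<close>
definition "R0 u m = chain_vec v (al m) (al m - be m) (w0 u m) (k m + 2)" for u m
definition "R1 u m = chain_vec v (be m) (be m - al m) (w1 u m - al m - 2 * Y1 m) (k m + 1)" for u m
definition "R2 u m = chain_vec v (al m) (al m - be m) (w2 u m - be m - 2 * Y2 m) (k m)" for u m
definition "R3 u m = chain_vec v (be m) (be m - al m) (w3 u m) (k m + 1)" for u m
definition "T u m = R0 u m + R1 u m + R2 u m + R3 u m" for u m

lemma T_rotate: "T u m = cis u * T 0 m"
proof -
  have w: "w0 u m = u + w0 0 m" "w1 u m - al m - 2 * Y1 m = u + (w1 0 m - al m - 2 * Y1 m)"
    "w2 u m - be m - 2 * Y2 m = u + (w2 0 m - be m - 2 * Y2 m)" "w3 u m = u + w3 0 m"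
    by (simp_all add: w0_def w1_def w2_def w3_def)
  show ?thesis unfolding T_def R0_def R1_def R2_def R3_def w chain_vec_rotate by (simp add: algebra_simps)
qed

lemma K_pos: "eventually (\<lambda>m. 0 < K m) sequentially"
  using filterlim_at_top_dense[THEN iffD1, OF k, rule_format, of 0] .

lemma linear_limits:
  shows "(\<lambda>m. K m * K m * (p * Y1 m + q * Y2 m)) \<longlonglongrightarrow> p * \<eta>1 + q * \<eta>2"
    and "(\<lambda>m. K m * (p * Y1 m + q * Y2 m)) \<longlonglongrightarrow> 0"
    and "(\<lambda>m. p * Y1 m + q * Y2 m) \<longlonglongrightarrow> 0"
proof -
  have "(\<lambda>m. p * (K m * K m * Y1 m) + q * (K m * K m * Y2 m)) \<longlonglongrightarrow> p * \<eta>1 + q * \<eta>2"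
    by (intro tendsto_intros \<eta>1 \<eta>2)
  then show 1: "(\<lambda>m. K m * K m * (p * Y1 m + q * Y2 m)) \<longlonglongrightarrow> p * \<eta>1 + q * \<eta>2"
    by (simp add: algebra_simps)
  show 2: "(\<lambda>m. K m * (p * Y1 m + q * Y2 m)) \<longlonglongrightarrow> 0"
    by (rule tendsto_inverse_scale[OF k]) (use 1 in \<open>simp only: mult.assoc\<close>)
  show "(\<lambda>m. p * Y1 m + q * Y2 m) \<longlonglongrightarrow> 0"
    by (rule tendsto_inverse_scale[OF k 2])
qed

lemma count_limit: "(\<lambda>m. real (k m + j) / K m) \<longlonglongrightarrow> 1"
proof -
  have "(\<lambda>m. 1 + real j * inverse (K m)) \<longlonglongrightarrow> 1 + real j * 0"
    by (intro tendsto_intros tendsto_inverse_0_at_top k)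
  moreover have "eventually (\<lambda>m. 1 + real j * inverse (K m) = real (k m + j) / K m) sequentially"
    using K_pos by eventually_elim (simp add: field_simps)
  ultimately show ?thesis by (simp add: tendsto_cong)
qed

context
  fixes U :: "nat \<Rightarrow> real" and L :: real
  assumes U: "(\<lambda>m. K m * U m) \<longlonglongrightarrow> L"
begin

lemma affine_limit:
  assumes "\<And>m. x m = U m + K m * (p * Y1 m + q * Y2 m) + (p' * Y1 m + q' * Y2 m)"
  shows "(\<lambda>m. K m * x m) \<longlonglongrightarrow> L + (p * \<eta>1 + q * \<eta>2)"
proof -
  have "(\<lambda>m. K m * U m + K m * K m * (p * Y1 m + q * Y2 m) + K m * (p' * Y1 m + q' * Y2 m))
      \<longlonglongrightarrow> L + (p * \<eta>1 + q * \<eta>2) + 0"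
    by (intro tendsto_add U linear_limits)
  then show ?thesis unfolding assms by (simp add: algebra_simps)
qed

lemma w_limits:
  "(\<lambda>m. K m * w0 (U m) m) \<longlonglongrightarrow> L - A * \<delta> / 2"
  "(\<lambda>m. K m * w1 (U m) m) \<longlonglongrightarrow> L + A * \<delta> / 2"
  "(\<lambda>m. K m * (w1 (U m) m - al m - 2 * Y1 m)) \<longlonglongrightarrow> L + A * \<delta> / 2"
  "(\<lambda>m. K m * w2 (U m) m) \<longlonglongrightarrow> L - A * \<delta> / 2"
  "(\<lambda>m. K m * (w2 (U m) m - be m - 2 * Y2 m)) \<longlonglongrightarrow> L - A * \<delta> / 2"
  "(\<lambda>m. K m * (w2 (U m) m - be m - 2 * Y2 m + K m * (al m - be m))) \<longlonglongrightarrow> L + A * \<delta> / 2"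
  "(\<lambda>m. K m * w3 (U m) m) \<longlonglongrightarrow> L + A * \<delta> / 2"
  "(\<lambda>m. K m * (w3 (U m) m + real (k m + 1) * (be m - al m))) \<longlonglongrightarrow> L - A * \<delta> / 2"
proof -
  have e: "L + (- A / 2 * \<eta>1 + A / 2 * \<eta>2) = L - A * \<delta> / 2" "L + (A / 2 * \<eta>1 + - A / 2 * \<eta>2) = L + A * \<delta> / 2"
    by (simp_all add: field_simps)
  note d = w0_def w1_def w2_def w3_def
  show "(\<lambda>m. K m * w0 (U m) m) \<longlonglongrightarrow> L - A * \<delta> / 2"
    unfolding e[symmetric] by (rule affine_limit[where p' = 0 and q' = 0]) (simp add: d field_simps)
  show "(\<lambda>m. K m * w1 (U m) m) \<longlonglongrightarrow> L + A * \<delta> / 2"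
    unfolding e[symmetric] by (rule affine_limit[where p' = "2 * A" and q' = "- 2 * A"]) (simp add: d field_simps)
  show "(\<lambda>m. K m * (w1 (U m) m - al m - 2 * Y1 m)) \<longlonglongrightarrow> L + A * \<delta> / 2"
    unfolding e[symmetric] by (rule affine_limit[where p' = "A - 2" and q' = "- 2 * A"]) (simp add: d field_simps)
  show "(\<lambda>m. K m * w2 (U m) m) \<longlonglongrightarrow> L - A * \<delta> / 2"
    unfolding e[symmetric] by (rule affine_limit[where p' = "- 2" and q' = "- A"]) (simp add: d field_simps)
  show "(\<lambda>m. K m * (w2 (U m) m - be m - 2 * Y2 m)) \<longlonglongrightarrow> L - A * \<delta> / 2"
    unfolding e[symmetric] by (rule affine_limit[where p' = "- 2" and q' = "- 2 * A - 2"]) (simp add: d field_simps)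
  show "(\<lambda>m. K m * (w2 (U m) m - be m - 2 * Y2 m + K m * (al m - be m))) \<longlonglongrightarrow> L + A * \<delta> / 2"
    unfolding e[symmetric] by (rule affine_limit[where p' = "- 2" and q' = "- 2 * A - 2"]) (simp add: d field_simps)
  show "(\<lambda>m. K m * w3 (U m) m) \<longlonglongrightarrow> L + A * \<delta> / 2"
    unfolding e[symmetric] by (rule affine_limit[where p' = A and q' = "- 2 * A - 2"]) (simp add: d field_simps)
  show "(\<lambda>m. K m * (w3 (U m) m + real (k m + 1) * (be m - al m))) \<longlonglongrightarrow> L - A * \<delta> / 2"
    unfolding e[symmetric] by (rule affine_limit[where p' = 0 and q' = "- A - 2"]) (simp add: d field_simps)
qed

text \<open>The mean slope of a period in the four zones is \<open>u\<close> plus these numbers.  They are of order \<open>1 / k^2\<close>,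
since the changes of the slope along a zone, which add up to order \<open>1 / k\<close>, cancel in the mean.\<close>
definition "bend0 m = A * Y1 m + (- A / 2) * Y2 m" for m
definition "bend1 m = (A - 2) * Y1 m + (- 3 / 2 * A) * Y2 m" for m
definition "bend2 m = - 2 * Y1 m + (- 3 / 2 * A - 2) * Y2 m" for m
definition "bend3 m = A * Y1 m + (- 3 / 2 * A - 2) * Y2 m" for m

lemma arc_heights:
  "(\<lambda>m. K m * (Im (R0 (U m) m) - s) - 2 * c * (K m * ((K m + 2) * (U m + bend0 m)))) \<longlonglongrightarrow> c * (L + A * \<delta> / 2)"
  "(\<lambda>m. K m * (Im (R1 (U m) m) - s) - 2 * c * (K m * ((K m + 1) * (U m + bend1 m)))) \<longlonglongrightarrow> c * (L - A * \<delta> / 2)"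
  "(\<lambda>m. K m * (Im (R2 (U m) m) - s) - 2 * c * (K m * (K m * (U m + bend2 m)))) \<longlonglongrightarrow> c * (L + A * \<delta> / 2)"
  "(\<lambda>m. K m * (Im (R3 (U m) m) - s) - 2 * c * (K m * ((K m + 1) * (U m + bend3 m)))) \<longlonglongrightarrow> c * (L - A * \<delta> / 2)"
  "(\<lambda>m. Re (T (U m) m) / K m) \<longlonglongrightarrow> 8 * c"
proof -
  have a: "(\<lambda>m. K m * K m * al m) \<longlonglongrightarrow> A * \<eta>1" "(\<lambda>m. K m * K m * be m) \<longlonglongrightarrow> A * \<eta>2"
    using linear_limits(1)[of A 0] linear_limits(1)[of 0 A] by simp_all
  have th: "(\<lambda>m. K m * K m * (al m - be m)) \<longlonglongrightarrow> A * \<delta>" "(\<lambda>m. K m * K m * (be m - al m)) \<longlonglongrightarrow> - A * \<delta>"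
    using tendsto_diff[OF a] tendsto_diff[OF a(2,1)] by (simp_all add: algebra_simps)
  note N0 = count_limit[of 0, unfolded add_0_right]
  note R = chain_vec_limit[OF k count_limit[of 2] w_limits(1) th(1) a(1), of v]
    chain_vec_limit[OF k count_limit[of 1] w_limits(3) th(2) a(2), of v]
    chain_vec_limit[OF k N0 w_limits(5) th(1) a(1), of v]
    chain_vec_limit[OF k count_limit[of 1] w_limits(7) th(2) a(2), of v]
  note d = w0_def w1_def w2_def w3_def
  have P0: "real (k m + 2) * w0 (U m) m + (al m - be m) * (real (k m + 2) * (real (k m + 2) - 1) / 2) +
      real (k m + 2) * (al m / 2) = (K m + 2) * (U m + bend0 m)" for m
    by (simp add: d bend0_def field_simps)
  have P1: "real (k m + 1) * (w1 (U m) m - al m - 2 * Y1 m) + (be m - al m) * (real (k m + 1) * (real (k m + 1) - 1) / 2) +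
      real (k m + 1) * (be m / 2) = (K m + 1) * (U m + bend1 m)" for m
    by (simp add: d bend1_def field_simps)
  have P2: "real (k m) * (w2 (U m) m - be m - 2 * Y2 m) + (al m - be m) * (real (k m) * (real (k m) - 1) / 2) +
      real (k m) * (al m / 2) = K m * (U m + bend2 m)" for m
    by (simp add: d bend2_def field_simps)
  have P3: "real (k m + 1) * w3 (U m) m + (be m - al m) * (real (k m + 1) * (real (k m + 1) - 1) / 2) +
      real (k m + 1) * (be m / 2) = (K m + 1) * (U m + bend3 m)" for m
    by (simp add: d bend3_def field_simps)
  have e: "L - A * \<delta> / 2 + A * \<delta> = L + A * \<delta> / 2" "L + A * \<delta> / 2 + - A * \<delta> = L - A * \<delta> / 2"
    by (simp_all add: field_simps)
  show "(\<lambda>m. K m * (Im (R0 (U m) m) - s) - 2 * c * (K m * ((K m + 2) * (U m + bend0 m)))) \<longlonglongrightarrow> c * (L + A * \<delta> / 2)"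
    using R(2) unfolding P0 e R0_def[symmetric] .
  show "(\<lambda>m. K m * (Im (R1 (U m) m) - s) - 2 * c * (K m * ((K m + 1) * (U m + bend1 m)))) \<longlonglongrightarrow> c * (L - A * \<delta> / 2)"
    using R(4) unfolding P1 e R1_def[symmetric] .
  show "(\<lambda>m. K m * (Im (R2 (U m) m) - s) - 2 * c * (K m * (K m * (U m + bend2 m)))) \<longlonglongrightarrow> c * (L + A * \<delta> / 2)"
    using R(6) unfolding P2 e R2_def[symmetric] .
  show "(\<lambda>m. K m * (Im (R3 (U m) m) - s) - 2 * c * (K m * ((K m + 1) * (U m + bend3 m)))) \<longlonglongrightarrow> c * (L - A * \<delta> / 2)"
    using R(8) unfolding P3 e R3_def[symmetric] .
  show "(\<lambda>m. Re (T (U m) m) / K m) \<longlonglongrightarrow> 8 * c"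
    using tendsto_add[OF tendsto_add[OF R(1) R(3)] tendsto_add[OF R(5) R(7)]]
    unfolding R0_def[symmetric] R1_def[symmetric] R2_def[symmetric] R3_def[symmetric] T_def
    by (simp add: add_divide_distrib algebra_simps)
qed

lemma bend_limits:
  "(\<lambda>m. K m * K m * bend0 m) \<longlonglongrightarrow> A * \<eta>1 + (- A / 2) * \<eta>2"
  "(\<lambda>m. K m * K m * bend1 m) \<longlonglongrightarrow> (A - 2) * \<eta>1 + (- 3 / 2 * A) * \<eta>2"
  "(\<lambda>m. K m * K m * bend2 m) \<longlonglongrightarrow> - 2 * \<eta>1 + (- 3 / 2 * A - 2) * \<eta>2"
  "(\<lambda>m. K m * K m * bend3 m) \<longlonglongrightarrow> A * \<eta>1 + (- 3 / 2 * A - 2) * \<eta>2"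
  unfolding bend0_def bend1_def bend2_def bend3_def by (rule linear_limits(1))+

lemma scaled_bend_limits:
  "(\<lambda>m. K m * bend0 m) \<longlonglongrightarrow> 0" "(\<lambda>m. K m * bend1 m) \<longlonglongrightarrow> 0" "(\<lambda>m. K m * bend2 m) \<longlonglongrightarrow> 0" "(\<lambda>m. K m * bend3 m) \<longlonglongrightarrow> 0"
  using bend_limits[unfolded mult.assoc[of "K _" "K _"]] by (auto intro: tendsto_inverse_scale[OF k])

text \<open>Each height contains the terms \<open>s\<close> and \<open>2 c k u\<close>, both of order 1, which become unbounded when multiplied by
\<open>k\<close>.  Subtracting a quarter of the total height, which is 0, removes them, and with them the need to
know \<open>u\<close> more precisely than to the order \<open>1 / k\<close>.\<close>
lemma gate_limits:
  assumes closed: "eventually (\<lambda>m. Im (T (U m) m) = 0) sequentially"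
  shows "(\<lambda>m. K m * Im (R0 (U m) m)) \<longlonglongrightarrow> 2 * c * L + 2 * real n * c * (\<eta>1 + \<eta>2)"
    "(\<lambda>m. K m * Im (R1 (U m) m)) \<longlonglongrightarrow> - 2 * c * \<delta>"
    "(\<lambda>m. K m * Im (R2 (U m) m)) \<longlonglongrightarrow> - (2 * c * L + 2 * real n * c * (\<eta>1 + \<eta>2))"
proof -
  define D0 D1 D2 D3 where
    "D0 m = K m * (Im (R0 (U m) m) - s) - 2 * c * (K m * ((K m + 2) * (U m + bend0 m)))"
    "D1 m = K m * (Im (R1 (U m) m) - s) - 2 * c * (K m * ((K m + 1) * (U m + bend1 m)))"
    "D2 m = K m * (Im (R2 (U m) m) - s) - 2 * c * (K m * (K m * (U m + bend2 m)))"
    "D3 m = K m * (Im (R3 (U m) m) - s) - 2 * c * (K m * ((K m + 1) * (U m + bend3 m)))" for m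
  note D = arc_heights(1-4)[folded D0_D1_D2_D3_def]
  note tl = bend_limits and kt = scaled_bend_limits
  have "(\<lambda>m. D0 m - (D0 m + D1 m + D2 m + D3 m) / 4 + 2 * c * (K m * U m +
       (K m * K m * bend0 m - (K m * K m * bend0 m + K m * K m * bend1 m + K m * K m * bend2 m + K m * K m * bend3 m) / 4) +
       (2 * (K m * bend0 m) - (2 * (K m * bend0 m) + K m * bend1 m + K m * bend3 m) / 4))) \<longlonglongrightarrow>
     c * (L + A * \<delta> / 2) - (c * (L + A * \<delta> / 2) + c * (L - A * \<delta> / 2) + c * (L + A * \<delta> / 2) + c * (L - A * \<delta> / 2)) / 4 +
      2 * c * (L + ((A * \<eta>1 + (- A / 2) * \<eta>2) - ((A * \<eta>1 + (- A / 2) * \<eta>2) + ((A - 2) * \<eta>1 + (- 3 / 2 * A) * \<eta>2)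
        + (- 2 * \<eta>1 + (- 3 / 2 * A - 2) * \<eta>2) + (A * \<eta>1 + (- 3 / 2 * A - 2) * \<eta>2)) / 4) + (2 * 0 - (2 * 0 + 0 + 0) / 4))"
    (is "?f0 \<longlonglongrightarrow> ?l0")
    by (intro tendsto_intros D tl kt U) simp_all
  moreover have "?l0 = 2 * c * L + 2 * real n * c * (\<eta>1 + \<eta>2)" by (simp add: field_simps)
  moreover have "eventually (\<lambda>m. ?f0 m = K m * Im (R0 (U m) m)) sequentially"
    using closed
  proof eventually_elim
    case (elim m)
    have "?f0 m = K m * Im (R0 (U m) m) - K m * Im (T (U m) m) / 4"
      by (simp add: D0_D1_D2_D3_def T_def field_simps)
    then show ?case using elim by simp
  qed
  ultimately show "(\<lambda>m. K m * Im (R0 (U m) m)) \<longlonglongrightarrow> 2 * c * L + 2 * real n * c * (\<eta>1 + \<eta>2)"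
    by (simp only: tendsto_cong)
  have "(\<lambda>m. D1 m - (D0 m + D1 m + D2 m + D3 m) / 4 + 2 * c * (
       (K m * K m * bend1 m - (K m * K m * bend0 m + K m * K m * bend1 m + K m * K m * bend2 m + K m * K m * bend3 m) / 4) +
       (K m * bend1 m - (2 * (K m * bend0 m) + K m * bend1 m + K m * bend3 m) / 4))) \<longlonglongrightarrow>
     c * (L - A * \<delta> / 2) - (c * (L + A * \<delta> / 2) + c * (L - A * \<delta> / 2) + c * (L + A * \<delta> / 2) + c * (L - A * \<delta> / 2)) / 4 +
      2 * c * ((((A - 2) * \<eta>1 + (- 3 / 2 * A) * \<eta>2) - ((A * \<eta>1 + (- A / 2) * \<eta>2) + ((A - 2) * \<eta>1 + (- 3 / 2 * A) * \<eta>2)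
        + (- 2 * \<eta>1 + (- 3 / 2 * A - 2) * \<eta>2) + (A * \<eta>1 + (- 3 / 2 * A - 2) * \<eta>2)) / 4) + (0 - (2 * 0 + 0 + 0) / 4))"
    (is "?f1 \<longlonglongrightarrow> ?l1")
    by (intro tendsto_intros D tl kt U) simp_all
  moreover have "?l1 = - 2 * c * \<delta>" by (simp add: field_simps)
  moreover have "eventually (\<lambda>m. ?f1 m = K m * Im (R1 (U m) m)) sequentially"
    using closed
  proof eventually_elim
    case (elim m)
    have "?f1 m = K m * Im (R1 (U m) m) - K m * Im (T (U m) m) / 4"
      by (simp add: D0_D1_D2_D3_def T_def field_simps)
    then show ?case using elim by simp
  qed
  ultimately show "(\<lambda>m. K m * Im (R1 (U m) m)) \<longlonglongrightarrow> - 2 * c * \<delta>"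
    by (simp only: tendsto_cong)
  have "(\<lambda>m. D2 m - (D0 m + D1 m + D2 m + D3 m) / 4 + 2 * c * (- (K m * U m) +
       (K m * K m * bend2 m - (K m * K m * bend0 m + K m * K m * bend1 m + K m * K m * bend2 m + K m * K m * bend3 m) / 4) +
       (- ((2 * (K m * bend0 m) + K m * bend1 m + K m * bend3 m) / 4)))) \<longlonglongrightarrow>
     c * (L + A * \<delta> / 2) - (c * (L + A * \<delta> / 2) + c * (L - A * \<delta> / 2) + c * (L + A * \<delta> / 2) + c * (L - A * \<delta> / 2)) / 4 +
      2 * c * (- L + ((- 2 * \<eta>1 + (- 3 / 2 * A - 2) * \<eta>2) - ((A * \<eta>1 + (- A / 2) * \<eta>2) + ((A - 2) * \<eta>1 + (- 3 / 2 * A) * \<eta>2)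
        + (- 2 * \<eta>1 + (- 3 / 2 * A - 2) * \<eta>2) + (A * \<eta>1 + (- 3 / 2 * A - 2) * \<eta>2)) / 4) + (- ((2 * 0 + 0 + 0) / 4)))"
    (is "?f2 \<longlonglongrightarrow> ?l2")
    by (intro tendsto_intros D tl kt U) simp_all
  moreover have "?l2 = - (2 * c * L + 2 * real n * c * (\<eta>1 + \<eta>2))" by (simp add: field_simps)
  moreover have "eventually (\<lambda>m. ?f2 m = K m * Im (R2 (U m) m)) sequentially"
    using closed
  proof eventually_elim
    case (elim m)
    have "?f2 m = K m * Im (R2 (U m) m) - K m * Im (T (U m) m) / 4"
      by (simp add: D0_D1_D2_D3_def T_def field_simps)
    then show ?case using elim by simp
  qed
  ultimately show "(\<lambda>m. K m * Im (R2 (U m) m)) \<longlonglongrightarrow> - (2 * c * L + 2 * real n * c * (\<eta>1 + \<eta>2))"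
    by (simp only: tendsto_cong)
qed

end

text \<open>The rotation that makes the translation of the unfolding horizontal.\<close>
definition "tilt m = - arctan (Im (T 0 m) / Re (T 0 m))" for m

lemma c_pos: "0 < c" and s_pos: "0 < s"
  using base_angle_bounds[OF n3] pi_gt_zero by (auto intro!: cos_gt_zero sin_gt_zero)

text \<open>The unfolding climbs four levels of height \<open>s\<close> within about \<open>4 k\<close> periods of length \<open>2 c\<close>.\<close>
lemma T0_limits: "(\<lambda>m. Re (T 0 m) / K m) \<longlonglongrightarrow> 8 * c" "(\<lambda>m. Im (T 0 m)) \<longlonglongrightarrow> 4 * s"
proof -
  have U: "(\<lambda>m. K m * 0) \<longlonglongrightarrow> 0" by simp
  note H = arc_heights[OF U]
  show "(\<lambda>m. Re (T 0 m) / K m) \<longlonglongrightarrow> 8 * c" using H(5) .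
  note kt = scaled_bend_limits[OF U]
  note t = tendsto_inverse_scale[OF k kt(1)] tendsto_inverse_scale[OF k kt(2)]
    tendsto_inverse_scale[OF k kt(3)] tendsto_inverse_scale[OF k kt(4)]
  define P where "P m = (K m + 2) * bend0 m + (K m + 1) * bend1 m + K m * bend2 m + (K m + 1) * bend3 m" for m
  have "(\<lambda>m. (K m * bend0 m + 2 * bend0 m) + (K m * bend1 m + bend1 m) + K m * bend2 m + (K m * bend3 m + bend3 m)) \<longlonglongrightarrow>
      (0 + 2 * 0) + (0 + 0) + 0 + (0 + 0)"
    by (intro tendsto_intros kt t)
  then have P: "P \<longlonglongrightarrow> 0" by (simp add: P_def[abs_def] algebra_simps)
  have x: "(\<lambda>m. K m * (Im (T 0 m) - 4 * s - 2 * c * P m)) \<longlonglongrightarrow>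
      c * (0 + A * \<delta> / 2) + c * (0 - A * \<delta> / 2) + (c * (0 + A * \<delta> / 2) + c * (0 - A * \<delta> / 2))"
    using tendsto_add[OF tendsto_add[OF H(1) H(2)] tendsto_add[OF H(3) H(4)]]
    by (simp add: P_def T_def algebra_simps)
  have "(\<lambda>m. Im (T 0 m) - 4 * s - 2 * c * P m + 4 * s + 2 * c * P m) \<longlonglongrightarrow> 0 + 4 * s + 2 * c * 0"
    by (intro tendsto_add tendsto_const tendsto_mult P tendsto_inverse_scale[OF k x])
  then show "(\<lambda>m. Im (T 0 m)) \<longlonglongrightarrow> 4 * s" by simp
qed

lemma Re_T0_pos: "eventually (\<lambda>m. Re (T 0 m) > 0) sequentially"
proof -
  have "eventually (\<lambda>m. 0 < Re (T 0 m) / K m) sequentially"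
    using order_tendstoD(1)[OF T0_limits(1), of 0] c_pos by simp
  with K_pos show ?thesis by eventually_elim (simp add: zero_less_divide_iff)
qed

lemma tilt_limit: "(\<lambda>m. K m * tilt m) \<longlonglongrightarrow> - s / (2 * c)"
proof -
  have "(\<lambda>m. Im (T 0 m) / (Re (T 0 m) / K m)) \<longlonglongrightarrow> 4 * s / (8 * c)"
    using c_pos by (intro tendsto_divide T0_limits) auto
  then have "(\<lambda>m. K m * (Im (T 0 m) / Re (T 0 m))) \<longlonglongrightarrow> s / (2 * c)" by (simp add: mult.commute)
  from tendsto_minus[OF scaled_arctan[OF k this]] show ?thesis by (simp add: tilt_def)
qed

lemma T_tilt:
  assumes "Re (T 0 m) > 0"
  shows "Im (T (tilt m) m) = 0" "Re (T (tilt m) m) > 0"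
proof -
  define X Y where "X = Re (T 0 m)" "Y = Im (T 0 m)"
  define a where "a = arctan (Y / X)"
  have X: "X > 0" using assms by (simp add: X_Y_def)
  have ca: "cos a > 0" unfolding a_def by (simp add: cos_arctan add_pos_nonneg)
  have "sin a = Y / X * cos a" using tan_arctan[of "Y / X"] ca by (simp add: tan_def a_def field_simps)
  then have sa: "sin a * X = cos a * Y" using X by (simp add: field_simps)
  have t: "tilt m = - a" by (simp add: tilt_def a_def X_Y_def)
  have R: "T (tilt m) m = cis (- a) * T 0 m" using T_rotate[of "tilt m" m] by (simp only: t)
  have "Im (T (tilt m) m) = cos a * Y - sin a * X" unfolding R X_Y_def by simp
  then show "Im (T (tilt m) m) = 0" using sa by simp
  have "Re (T (tilt m) m) * X = cos a * (X * X) + (sin a * X) * Y"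
    unfolding R X_Y_def by (simp add: algebra_simps)
  also have "\<dots> = cos a * (X * X + Y * Y)" unfolding sa by (simp add: algebra_simps)
  also have "\<dots> > 0" using ca X by (intro mult_pos_pos add_pos_nonneg) auto
  finally show "Re (T (tilt m) m) > 0" using X by (simp add: zero_less_mult_iff)
qed

end

lemma tendsto_scaled_less:
  fixes K f g :: "nat \<Rightarrow> real"
  assumes "eventually (\<lambda>m. 0 < K m) sequentially"
    and "(\<lambda>m. K m * f m) \<longlonglongrightarrow> a" "(\<lambda>m. K m * g m) \<longlonglongrightarrow> b" "a < b"
  shows "eventually (\<lambda>m. f m < g m) sequentially"
  using assms(1) tendsto_less[OF assms(2-4)] by eventually_elim simp

context shrinking
begin

text \<open>The line is placed at height \<open>- e0 / k\<close> relative to the first gate, with \<open>e0 = E / 2 + c \<delta>\<close>.  Then the scaled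
heights of the four gates tend to \<open>e0\<close>, \<open>- (E / 2 - c \<delta>)\<close>, \<open>- e0\<close> and \<open>E / 2 - c \<delta>\<close>, so that each of
the four hypotheses takes care of two gates.\<close>
lemma eventually_in_tile:
  defines "E \<equiv> s - 2 * real n * c * (\<eta>1 + \<eta>2)"
  assumes c1: "E / 2 + c * \<delta> > 0" and c2: "E / 2 - c * \<delta> > 0"
    and c3: "E / 2 + c * \<delta> < s / (4 * c * c) + (real n - 1) * \<delta> / (2 * c)"
    and c4: "E / 2 - c * \<delta> < s / (4 * c * c) - (real n - 1) * \<delta> / (2 * c)"
  shows "eventually (\<lambda>m. (v + Y1 m, v + Y2 m) \<in> orbit_tile (word_W n (k m))) sequentially"
proof -
  note vb = base_angle_bounds[OF n3]
  obtain \<kappa> where \<kappa>: "\<kappa> > 0" "\<And>y1 y2 \<phi>. \<bar>y1\<bar> < \<kappa> \<Longrightarrow> \<bar>y2\<bar> < \<kappa> \<Longrightarrow> \<bar>\<phi>\<bar> < \<kappa> \<Longrightarrow> tame n y1 y2 \<phi>"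
    using tame_near[OF n3] by blast
  define L where "L = - s / (2 * c)"
  note U = tilt_limit[folded L_def]
  have closes: "eventually (\<lambda>m. Im (T (tilt m) m) = 0) sequentially"
    using Re_T0_pos by eventually_elim (rule T_tilt)
  note G = gate_limits[OF U closes]
  have cL: "2 * c * L + 2 * real n * c * (\<eta>1 + \<eta>2) = - E" using c_pos by (simp add: L_def E_def field_simps)
  note W = w_limits[OF U]
  define b where "b = 1 / (2 * c)"
  have b: "b > 0" using c_pos by (simp add: b_def)
  define e0 where "e0 = E / 2 + c * \<delta>"
  \<comment> \<open>The limits of the scaled slopes: \<open>l0\<close> at the gates 0 and 2, \<open>l1\<close> at the gates 1 and 3.\<close>
  define l0 l1 where "l0 = L - A * \<delta> / 2" "l1 = L + A * \<delta> / 2"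
  have g0: "e0 + b * l0 < 0" and g1: "(E / 2 - c * \<delta>) + b * l1 < 0"
    using c3 c4 c_pos by (simp_all add: e0_def l0_l1_def b_def L_def field_simps)
  have l: "l0 < 0" "l1 < 0"
    using g0 g1 c1 c2 b by (smt (verit) e0_def mult_nonneg_nonneg)+
  \<comment> \<open>All slopes will be below \<open>h / k\<close>, which is negative and dominates the perturbations.\<close>
  define h where "h = max l0 l1 / 2"
  have h: "l0 < h" "l1 < h" "h < 0" using l by (auto simp: h_def)
  have Y0: "Y1 \<longlonglongrightarrow> 0" "Y2 \<longlonglongrightarrow> 0" "(\<lambda>m. K m * Y1 m) \<longlonglongrightarrow> 0" "(\<lambda>m. K m * Y2 m) \<longlonglongrightarrow> 0"
    using linear_limits(3)[of 1 0] linear_limits(3)[of 0 1] linear_limits(2)[of 1 0] linear_limits(2)[of 0 1] by simp_all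
  have small: "eventually (\<lambda>m. Y1 m < \<kappa>) sequentially" "eventually (\<lambda>m. Y2 m < \<kappa>) sequentially"
    using order_tendstoD(2)[OF Y0(1)] order_tendstoD(2)[OF Y0(2)] \<kappa>(1) by auto
  have obtuse: "eventually (\<lambda>m. 2 * v + Y1 m + Y2 m < pi / 2) sequentially"
    using vb by (intro tendsto_less[where a = "2 * v + 0 + 0"] tendsto_intros Y0) auto
  have range: "eventually (\<lambda>m. - \<kappa> / 2 \<le> w m \<and> w m \<le> h / K m) sequentially"
    if "(\<lambda>m. K m * w m) \<longlonglongrightarrow> l" "l < h" for w l
  proof -
    have "eventually (\<lambda>m. - \<kappa> / 2 < w m) sequentially"
      using order_tendstoD(1)[OF tendsto_inverse_scale[OF k that(1)]] \<kappa>(1) by simp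
    moreover have "eventually (\<lambda>m. K m * w m < h) sequentially"
      using order_tendstoD(2)[OF that(1)] that(2) by simp
    ultimately show ?thesis using K_pos by eventually_elim (simp add: field_simps)
  qed
  note r = range[OF W(1), folded l0_l1_def, OF h(1)] range[OF W(2), folded l0_l1_def, OF h(2)]
    range[OF W(3), folded l0_l1_def, OF h(2)] range[OF W(4), folded l0_l1_def, OF h(1)]
    range[OF W(5), folded l0_l1_def, OF h(1)] range[OF W(6), folded l0_l1_def, OF h(2)]
    range[OF W(7), folded l0_l1_def, OF h(2)] range[OF W(8), folded l0_l1_def, OF h(1)]
  have hi: "eventually (\<lambda>m. h / K m + 2 * real n * (Y1 m + Y2 m) < 0) sequentially"
  proof -
    have "(\<lambda>m. h + 2 * real n * (K m * Y1 m + K m * Y2 m)) \<longlonglongrightarrow> h + 2 * real n * (0 + 0)"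
      by (intro tendsto_intros Y0)
    then have "eventually (\<lambda>m. h + 2 * real n * (K m * Y1 m + K m * Y2 m) < 0) sequentially"
      using order_tendstoD(2) h(3) by fastforce
    then show ?thesis using K_pos
    proof eventually_elim
      case (elim m)
      then have "K m * (h / K m + 2 * real n * (Y1 m + Y2 m)) < 0" by (simp add: algebra_simps)
      then show ?case using elim(2) by (simp add: mult_less_0_iff)
    qed
  qed
  \<comment> \<open>The heights of the pivots \<open>G0\<close>, \<open>G1\<close>, \<open>G2\<close>, \<open>G3\<close> of \<open>runs_word_W\<close>.\<close>
  define H0 H1 H2 H3 where "H0 m = e0 / K m" "H1 m = H0 m + Im (R0 (tilt m) m)"
    "H2 m = H1 m + Im (R1 (tilt m) m)" "H3 m = H2 m + Im (R2 (tilt m) m)" for m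
  have H0: "(\<lambda>m. K m * H0 m) \<longlonglongrightarrow> e0"
  proof (rule tendsto_eventually)
    show "eventually (\<lambda>m. K m * H0 m = e0) sequentially"
      using K_pos by eventually_elim (simp add: H0_H1_H2_H3_def)
  qed
  have "(\<lambda>m. K m * H0 m + K m * Im (R0 (tilt m) m)) \<longlonglongrightarrow> e0 + - E"
    using tendsto_add[OF H0 G(1)] unfolding cL .
  then have H1: "(\<lambda>m. K m * H1 m) \<longlonglongrightarrow> - (E / 2 - c * \<delta>)"
    by (simp add: H0_H1_H2_H3_def e0_def algebra_simps)
  have "(\<lambda>m. K m * H1 m + K m * Im (R1 (tilt m) m)) \<longlonglongrightarrow> - (E / 2 - c * \<delta>) + - 2 * c * \<delta>"
    using tendsto_add[OF H1 G(2)] .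
  moreover have "- (E / 2 - c * \<delta>) + - 2 * c * \<delta> = - e0" by (simp add: e0_def algebra_simps)
  ultimately have H2: "(\<lambda>m. K m * H2 m) \<longlonglongrightarrow> - e0" by (simp add: H0_H1_H2_H3_def distrib_left)
  have "(\<lambda>m. K m * H2 m + K m * Im (R2 (tilt m) m)) \<longlonglongrightarrow> - e0 + - (- E)"
    using tendsto_add[OF H2 G(3)] unfolding cL .
  then have H3: "(\<lambda>m. K m * H3 m) \<longlonglongrightarrow> E / 2 - c * \<delta>"
    by (simp add: H0_H1_H2_H3_def e0_def algebra_simps)
  have sv: "s \<noteq> 0" "c \<noteq> 0" "sin (v + v) \<noteq> 0"
    using c_pos s_pos sin_double[of v] by (simp_all flip: mult_2)
  have x: "(\<lambda>m. v + Y1 m) \<longlonglongrightarrow> v" "(\<lambda>m. v + Y2 m) \<longlonglongrightarrow> v"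
    using tendsto_add[OF tendsto_const Y0(1), of v] tendsto_add[OF tendsto_const Y0(2), of v] by simp_all
  have ratio: "(\<lambda>m. side_ratio (v + Y1 m) (v + Y2 m)) \<longlonglongrightarrow> b" "(\<lambda>m. side_ratio (v + Y2 m) (v + Y1 m)) \<longlonglongrightarrow> b"
    using tendsto_side_ratio[OF x sv(3)] tendsto_side_ratio[OF x(2,1) sv(3)] side_ratio_isosceles[OF sv(1,2)]
    by (simp_all add: b_def)
  have slope: "(\<lambda>m. K m * (q m * sin (w m - y m))) \<longlonglongrightarrow> b * l"
    if "(\<lambda>m. K m * w m) \<longlonglongrightarrow> l" "(\<lambda>m. K m * y m) \<longlonglongrightarrow> 0" "q \<longlonglongrightarrow> b" for q w y l
  proof -
    have "(\<lambda>m. K m * (w m - y m)) \<longlonglongrightarrow> l" using tendsto_diff[OF that(1,2)] by (simp add: algebra_simps)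
    from tendsto_mult[OF that(3) scaled_sin(1)[OF k this]] show ?thesis by (simp add: mult.left_commute)
  qed
  have zero: "(\<lambda>m. K m * 0) \<longlonglongrightarrow> 0" by simp
  note less = tendsto_scaled_less[OF K_pos]
  define S0 S1 S2 S3 where
    "S0 m = side_ratio (v + Y2 m) (v + Y1 m) * sin (w0 (tilt m) m - Y2 m)"
    "S1 m = side_ratio (v + Y1 m) (v + Y2 m) * sin (w1 (tilt m) m - Y1 m)"
    "S2 m = side_ratio (v + Y2 m) (v + Y1 m) * sin (w2 (tilt m) m - Y2 m)"
    "S3 m = side_ratio (v + Y1 m) (v + Y2 m) * sin (w3 (tilt m) m - Y1 m)" for m
  have Sl: "(\<lambda>m. K m * S0 m) \<longlonglongrightarrow> b * l0" "(\<lambda>m. K m * S1 m) \<longlonglongrightarrow> b * l1"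
    "(\<lambda>m. K m * S2 m) \<longlonglongrightarrow> b * l0" "(\<lambda>m. K m * S3 m) \<longlonglongrightarrow> b * l1"
    unfolding S0_S1_S2_S3_def l0_l1_def by (intro slope W Y0 ratio)+
  have gates: "eventually (\<lambda>m. 0 < H0 m) sequentially" "eventually (\<lambda>m. H0 m + S0 m < 0) sequentially"
    "eventually (\<lambda>m. H1 m < 0) sequentially" "eventually (\<lambda>m. 0 < H1 m - S1 m) sequentially"
    "eventually (\<lambda>m. H2 m < 0) sequentially" "eventually (\<lambda>m. 0 < H2 m - S2 m) sequentially"
    "eventually (\<lambda>m. 0 < H3 m) sequentially" "eventually (\<lambda>m. H3 m + S3 m < 0) sequentially"
    using less[OF zero H0] less[OF H1 zero] less[OF H2 zero] less[OF zero H3]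
      less[OF tendsto_add[OF H0 Sl(1), folded distrib_left] zero]
      less[OF zero tendsto_diff[OF H1 Sl(2), folded right_diff_distrib]]
      less[OF zero tendsto_diff[OF H2 Sl(3), folded right_diff_distrib]]
      less[OF tendsto_add[OF H3 Sl(4), folded distrib_left] zero]
      c1 c2 g0 g1 by (simp_all add: e0_def)
  have "eventually (\<lambda>m. \<forall>w \<in> {w0 (tilt m) m, w1 (tilt m) m, w1 (tilt m) m - al m - 2 * Y1 m, w2 (tilt m) m,
      w2 (tilt m) m - be m - 2 * Y2 m, w2 (tilt m) m - be m - 2 * Y2 m + K m * (al m - be m),
      w3 (tilt m) m, w3 (tilt m) m + real (k m + 1) * (be m - al m)}. - \<kappa> / 2 \<le> w \<and> w \<le> h / K m) sequentially"
    using r by eventually_elim blast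
  then show ?thesis
    using small obtuse hi gates Re_T0_pos K_pos
  proof eventually_elim
    case (elim m)
    interpret sa: small_angles n "Y1 m" "Y2 m"
      using n3 Y_nonneg elim(4) by unfold_locales auto
    interpret sw: small_angles n "Y2 m" "Y1 m" by (rule sa.small_angles_swap)
    define u where "u = tilt m"
    define G0 where "G0 = Complex 0 (H0 m)"
    have tame: "tame n (Y1 m) (Y2 m) \<psi> \<and> tame n (Y2 m) (Y1 m) \<psi>" if "- \<kappa> / 2 \<le> \<psi>" "\<psi> \<le> h / K m" for \<psi>
    proof -
      have "h / K m < 0" using h(3) \<open>0 < K m\<close> by (simp add: divide_neg_pos)
      then have "\<bar>\<psi>\<bar> < \<kappa>" using that \<kappa>(1) by auto
      then show ?thesis using \<kappa>(2) Y_nonneg elim(2,3) by auto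
    qed
    have w1: "w0 u m + real (k m + 2) * (al m - be m) = w1 u m" by (simp add: w1_def)
    have w2: "w1 u m - al m - 2 * Y1 m + real (k m + 1) * (be m - al m) = w2 u m" by (simp add: w2_def)
    have w3: "w2 u m - be m - 2 * Y2 m + K m * (al m - be m) + al m + 2 * Y1 m = w3 u m" by (simp add: w3_def)
    have G1: "sa.peak (sa.zig G0 (w0 u m) (k m + 2)) (w1 u m) = G0 + R0 u m"
      using sa.peak_zig[of G0 "w0 u m" "k m + 2"] by (simp only: w1 R0_def)
    have G2: "sa.peak (sw.zig b (w1 u m - al m - 2 * Y1 m) (k m + 1)) (w2 u m) = b + R1 u m" for b
      using sw.peak_zig[of b "w1 u m - al m - 2 * Y1 m" "k m + 1"] by (simp only: w2 R1_def)
    have G3: "sa.peak (sa.zig b (w2 u m - be m - 2 * Y2 m) (k m)) (w2 u m - be m - 2 * Y2 m + K m * (al m - be m)) = b + R2 u m" for b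
      using sa.peak_zig[of b "w2 u m - be m - 2 * Y2 m" "k m"] by (simp only: R2_def)
    have G4: "sa.peak (sw.zig b (w3 u m) (k m + 1)) (w3 u m + real (k m + 1) * (be m - al m)) = b + R3 u m" for b
      using sw.peak_zig[of b "w3 u m" "k m + 1"] by (simp only: R3_def)
    \<comment> \<open>The choice of \<open>tilt\<close> makes the total translation real.\<close>
    define \<tau> where "\<tau> = Re (T u m)"
    have T: "R0 u m + R1 u m + R2 u m + R3 u m = of_real \<tau>" "\<tau> > 0"
      using T_tilt[OF \<open>Re (T 0 m) > 0\<close>] by (simp_all add: \<tau>_def u_def complex_eq_iff T_def)
    have run: "runs (v + Y1 m) (v + Y2 m) (word_W n (k m)) (1, sa.peak G0 (w0 u m), G0)
        (1, sa.peak (G0 + R0 u m + R1 u m + R2 u m + R3 u m) (w0 u m), G0 + R0 u m + R1 u m + R2 u m + R3 u m)"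
      using sa.runs_word_W[of "- \<kappa> / 2" "h / K m" "w0 u m" "k m" G0, unfolded w1 w2 w3 G1 G2 G3 G4, OF tame]
        elim T(1)
      by (simp add: H0_H1_H2_H3_def S0_S1_S2_S3_def u_def G0_def complex_eq_iff)
    have e: "G0 + R0 u m + R1 u m + R2 u m + R3 u m = G0 + of_real \<tau>" using T(1) by (simp add: add.assoc)
    have "(v + Y1 m, v + Y2 m) \<in> obtuse_param_space"
      using sa.x_pos elim(4) by (simp add: obtuse_param_space_def algebra_simps)
    moreover have "word_W n (k m) \<noteq> []" by (simp add: word_W_def word_h_def word_power_def Let_def)
    moreover have "G0 \<noteq> sa.peak G0 (w0 u m)" by (simp add: sa.peak_def)
    ultimately show ?case
      using T(2) run unfolding e
      by (intro orbit_tile_of_runs[of _ _ _ \<tau> G0 "sa.peak G0 (w0 u m)"]) (auto simp: sa.peak_def algebra_simps)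
  qed
qed

end


section \<open>The choice of k\<close>
lemma closure_N_pp_subset:
  assumes "x \<in> closure (N_pp n \<epsilon>)"
  shows "\<exists>y1 y2. x = V n + (y1, y2) \<and> 0 \<le> y1 \<and> 0 \<le> y2 \<and> y1\<^sup>2 + y2\<^sup>2 \<le> \<epsilon>\<^sup>2"
proof -
  define C where "C = {x. fst (V n) \<le> fst x \<and> snd (V n) \<le> snd x \<and>
      (fst x - fst (V n))\<^sup>2 + (snd x - snd (V n))\<^sup>2 \<le> \<epsilon>\<^sup>2}"
  have "closed C" unfolding C_def
    by (intro closed_Collect_conj closed_Collect_le continuous_intros)
  moreover have "N_pp n \<epsilon> \<subseteq> C" by (auto simp: N_pp_def C_def)
  ultimately have "x \<in> C" using assms closure_minimal by blast
  then show ?thesis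
    by (intro exI[of _ "fst x - fst (V n)"] exI[of _ "snd x - snd (V n)"]) (auto simp: C_def prod_eq_iff)
qed

text \<open>Rounding \<open>sqrt (Q / M)\<close> down changes it by at most 1, and this does not matter in the limit because
it tends to infinity.\<close>
lemma pinning_scale:
  fixes M :: "nat \<Rightarrow> real"
  assumes M: "M \<longlonglongrightarrow> 0" "\<And>m. M m > 0" and Q: "Q > 0"
  defines "k \<equiv> \<lambda>m. nat \<lfloor>sqrt (Q / M m)\<rfloor>"
  shows "filterlim (\<lambda>m. real (k m)) at_top sequentially"
    and "real (k m) * real (k m) * M m \<le> Q"
    and "(\<lambda>m. real (k m) * real (k m) * M m) \<longlonglongrightarrow> Q"
proof -
  define g where "g m = sqrt (Q / M m)" for m
  have g0: "0 \<le> g m" "g m * g m * M m = Q" "0 < g m" for m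
    using M(2)[of m] Q by (simp_all add: g_def)
  have k: "real (k m) \<le> g m" "g m - 1 \<le> real (k m)" for m
    using g0(1)[of m] by (auto simp: k_def g_def[symmetric])
  have g: "filterlim g at_top sequentially"
  proof -
    have "filterlim (\<lambda>m. Q * inverse (M m)) at_top sequentially"
      by (intro filterlim_tendsto_pos_mult_at_top[OF tendsto_const Q] filterlim_inverse_at_top M(1)) (simp add: M(2))
    then show ?thesis unfolding g_def divide_inverse by (rule filterlim_compose[OF sqrt_at_top])
  qed
  have "filterlim (\<lambda>m. - 1 + g m) at_top sequentially"
    by (rule filterlim_tendsto_add_at_top[OF tendsto_const g])
  then show "filterlim (\<lambda>m. real (k m)) at_top sequentially"
    by (rule filterlim_at_top_mono) (use k(2) in \<open>simp add: algebra_simps\<close>)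
  have up: "real (k m) * real (k m) * M m \<le> Q" for m
  proof -
    have "real (k m) * real (k m) \<le> g m * g m" using k(1) g0(1) by (intro mult_mono) auto
    then have "real (k m) * real (k m) * M m \<le> g m * g m * M m" using M(2)[of m] by (intro mult_right_mono) auto
    then show ?thesis using g0(2) by simp
  qed
  then show "real (k m) * real (k m) * M m \<le> Q" .
  have "(\<lambda>m. Q - 2 * (Q * inverse (g m)) + M m) \<longlonglongrightarrow> Q - 2 * (Q * 0) + 0"
    by (intro tendsto_intros tendsto_inverse_0_at_top g M(1))
  then have low: "(\<lambda>m. Q - 2 * (Q * inverse (g m)) + M m) \<longlonglongrightarrow> Q" by simp
  have "eventually (\<lambda>m. 1 < g m) sequentially"
    using filterlim_at_top_dense[THEN iffD1, OF g] by blast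
  then have ev: "eventually (\<lambda>m. Q - 2 * (Q * inverse (g m)) + M m \<le> real (k m) * real (k m) * M m) sequentially"
  proof eventually_elim
    case (elim m)
    have "(g m - 1) * (g m - 1) \<le> real (k m) * real (k m)" using k(2)[of m] elim by (intro mult_mono) auto
    then have "(g m - 1) * (g m - 1) * M m \<le> real (k m) * real (k m) * M m"
      using M(2)[of m] by (intro mult_right_mono) auto
    moreover have "Q * inverse (g m) = g m * M m" using g0[of m] by (simp add: field_simps)
    then have "(g m - 1) * (g m - 1) * M m = Q - 2 * (Q * inverse (g m)) + M m"
      using g0(2)[of m] by (simp add: algebra_simps)
    ultimately show ?case by simp
  qed
  show "(\<lambda>m. real (k m) * real (k m) * M m) \<longlonglongrightarrow> Q"
    by (rule tendsto_sandwich[OF ev _ low tendsto_const]) (simp add: up)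
qed

text \<open>On the curve, \<open>E / 2 = c \<bar>\<delta>\<bar> + s / (4 n + 4)\<close>, which gives the first two inequalities.  As \<open>c < 1\<close> and
\<open>n \<ge> 3\<close>, both of the others follow from
\<open>(n - 1) \<bar>\<delta>\<bar> / (2 c) + s / (4 n + 4) < s / (4 c^2)\<close>, where \<open>\<bar>\<delta>\<bar> \<le> \<eta>1 + \<eta>2\<close> implies \<open>(n + 1) \<bar>\<delta>\<bar> < s / (2 c)\<close>.\<close>
lemma gate_inequalities:
  fixes s c :: real and n :: nat
  assumes n: "n \<ge> 3" and pos: "0 < s" "0 < c" "c < 1" and \<eta>: "0 \<le> \<eta>1" "0 \<le> \<eta>2"
    and M: "2 * real n * c * (\<eta>1 + \<eta>2) + 2 * c * \<bar>\<eta>1 - \<eta>2\<bar> = s * (2 * real n + 1) / (2 * real n + 2)"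
  defines "E \<equiv> s - 2 * real n * c * (\<eta>1 + \<eta>2)" and "\<delta> \<equiv> \<eta>1 - \<eta>2"
  shows "E / 2 + c * \<delta> > 0" "E / 2 - c * \<delta> > 0"
    "E / 2 + c * \<delta> < s / (4 * c * c) + (real n - 1) * \<delta> / (2 * c)"
    "E / 2 - c * \<delta> < s / (4 * c * c) - (real n - 1) * \<delta> / (2 * c)"
proof -
  define N where "N = real n"
  have N: "N \<ge> 3" using n by (simp add: N_def)
  define d where "d = \<bar>\<delta>\<bar>"
  have d: "0 \<le> d" "d \<le> \<eta>1 + \<eta>2" using \<eta> by (auto simp: d_def \<delta>_def)
  have "s * (2 * N + 1) / (2 * N + 2) = s - s / (2 * N + 2)" using N by (simp add: field_simps)
  then have e1: "E = 2 * c * d + s / (2 * N + 2)"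
    using M unfolding N_def[symmetric] E_def d_def \<delta>_def by linarith
  have e2: "s / (4 * N + 4) = s / (2 * N + 2) / 2" using N by (simp add: field_simps)
  have E: "E / 2 = c * d + s / (4 * N + 4)" unfolding e1 e2 by (simp add: add_divide_distrib)
  have p: "s / (4 * N + 4) > 0" using N pos by simp
  have cd: "\<bar>c * \<delta>\<bar> = c * d" using pos by (simp add: d_def abs_mult)
  show "E / 2 + c * \<delta> > 0" "E / 2 - c * \<delta> > 0" using E p cd by linarith+
  have cc: "c * c < 1" using pos by (metis less_eq_real_def mult_strict_mono mult_1 zero_less_one)
  have "2 * c * ((N + 1) * d) \<le> 2 * N * c * (\<eta>1 + \<eta>2) + 2 * c * d"
    using mult_left_mono[OF d(2), of "2 * N * c"] pos N by (simp add: algebra_simps)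
  also have "\<dots> = s * (2 * N + 1) / (2 * N + 2)" using M by (simp add: N_def d_def \<delta>_def)
  also have "\<dots> < s" using pos N by (simp add: field_simps)
  finally have dN: "(N + 1) * d < s / (2 * c)" using pos by (simp add: field_simps)
  have bound: "c * d + s / (4 * N + 4) + ((N - 1) / (2 * c) - c) * d < s / (4 * c * c)"
  proof -
    have "(N - 1) * ((N + 1) * d) \<le> (N - 1) * (s / (2 * c))" using dN N by (intro mult_left_mono) auto
    then have "(N - 1) * d * (N + 1) / (2 * c) \<le> (N - 1) * (s / (2 * c)) / (2 * c)"
      using pos by (intro divide_right_mono) (auto simp: algebra_simps)
    then have 1: "(N - 1) * d / (2 * c) * (N + 1) \<le> (N - 1) * (s / (4 * c * c))" by (simp add: field_simps)
    have "s * (c * c) < s * 1" using cc pos by (intro mult_strict_left_mono) auto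
    then have "s < s / (c * c)" using pos by (simp add: field_simps)
    moreover have "s / (4 * N + 4) * (N + 1) = s / 4" using N by (simp add: field_simps)
    moreover have "s / (4 * c * c) = s / (c * c) / 4" by simp
    ultimately have 2: "s / (4 * N + 4) * (N + 1) < s / (4 * c * c)" by linarith
    have gen: "D * (N + 1) \<le> (N - 1) * Z \<Longrightarrow> S * (N + 1) < Z \<Longrightarrow> 0 \<le> Z \<Longrightarrow> (D + S) * (N + 1) < Z * (N + 1)"
      for D S Z :: real by (simp add: algebra_simps)
    have "((N - 1) * d / (2 * c) + s / (4 * N + 4)) * (N + 1) < s / (4 * c * c) * (N + 1)"
      using pos by (intro gen[OF 1 2]) simp
    then have "(N - 1) * d / (2 * c) + s / (4 * N + 4) < s / (4 * c * c)"
      by (rule mult_right_less_imp_less) (use N in simp)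
    then show ?thesis by (simp add: algebra_simps)
  qed
  have "c \<le> (N - 1) / (2 * c)" using cc pos N by (simp add: field_simps)
  then have co: "0 \<le> (N - 1) / (2 * c) - c" by simp
  have "\<bar>((N - 1) / (2 * c) - c) * \<delta>\<bar> = ((N - 1) / (2 * c) - c) * d" using co by (simp add: abs_mult d_def)
  then have "- (((N - 1) / (2 * c) - c) * d) \<le> ((N - 1) / (2 * c) - c) * \<delta>"
    "((N - 1) / (2 * c) - c) * \<delta> \<le> ((N - 1) / (2 * c) - c) * d" by linarith+
  then show "E / 2 + c * \<delta> < s / (4 * c * c) + (real n - 1) * \<delta> / (2 * c)"
    "E / 2 - c * \<delta> < s / (4 * c * c) - (real n - 1) * \<delta> / (2 * c)"
    using bound unfolding E N_def[symmetric] by (simp_all add: algebra_simps)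
qed

theorem theorem1p4:
  fixes n :: nat
  assumes "n \<ge> 3"
  shows "\<exists>\<epsilon>>0. closure (N_pp n \<epsilon>) - {V n} \<subseteq> (\<Union>k. orbit_tile (word_W n k))"
proof (rule ccontr)
  assume neg: "\<not> ?thesis"
  define s c where "s = sin (base_angle n)" "c = cos (base_angle n)"
  note vb = base_angle_bounds[OF assms]
  have s: "0 < s" and c: "0 < c" "c < 1"
    using vb pi_gt_zero cos_monotone_0_pi[of 0 "base_angle n"] unfolding s_c_def by (auto intro!: cos_gt_zero sin_gt_zero)
  define Q where "Q = s * (2 * real n + 1) / (2 * real n + 2)"
  have Q: "Q > 0" using s by (simp add: Q_def)
  have "\<exists>y1 y2. 0 \<le> y1 \<and> 0 \<le> y2 \<and> (y1, y2) \<noteq> (0, 0) \<and> y1\<^sup>2 + y2\<^sup>2 \<le> (1 / real (Suc m))\<^sup>2 \<and>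
      V n + (y1, y2) \<notin> (\<Union>k. orbit_tile (word_W n k))" for m
  proof -
    have "(0 :: real) < 1 / real (Suc m)" by simp
    then obtain x where x: "x \<in> closure (N_pp n (1 / real (Suc m)))" "x \<noteq> V n" "x \<notin> (\<Union>k. orbit_tile (word_W n k))"
      using neg by blast
    from closure_N_pp_subset[OF x(1)] obtain y1 y2 where y: "x = V n + (y1, y2)" "0 \<le> y1" "0 \<le> y2"
      "y1\<^sup>2 + y2\<^sup>2 \<le> (1 / real (Suc m))\<^sup>2" by blast
    have "(y1, y2) \<noteq> (0, 0)" using x(2) y(1) by (auto simp: V_def)
    then show ?thesis using x(3) y by blast
  qed
  then obtain Y1 Y2 where Y: "\<And>m. 0 \<le> Y1 m" "\<And>m. 0 \<le> Y2 m" "\<And>m. (Y1 m, Y2 m) \<noteq> (0, 0)"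
    "\<And>m. (Y1 m)\<^sup>2 + (Y2 m)\<^sup>2 \<le> (1 / real (Suc m))\<^sup>2"
    "\<And>m. V n + (Y1 m, Y2 m) \<notin> (\<Union>k. orbit_tile (word_W n k))"
    by metis
  have null: "(\<lambda>m. 1 / real (Suc m)) \<longlonglongrightarrow> 0" by (rule LIMSEQ_Suc[OF lim_1_over_n])
  have Y_le: "Y1 m \<le> 1 / real (Suc m)" "Y2 m \<le> 1 / real (Suc m)" for m
  proof -
    have "(Y1 m)\<^sup>2 \<le> (1 / real (Suc m))\<^sup>2" "(Y2 m)\<^sup>2 \<le> (1 / real (Suc m))\<^sup>2"
      using Y(4)[of m] zero_le_power2[of "Y1 m"] zero_le_power2[of "Y2 m"] by linarith+
    then show "Y1 m \<le> 1 / real (Suc m)" "Y2 m \<le> 1 / real (Suc m)"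
      by (auto intro: power2_le_imp_le)
  qed
  have Y0: "Y1 \<longlonglongrightarrow> 0" "Y2 \<longlonglongrightarrow> 0"
    by (rule tendsto_sandwich[OF _ _ tendsto_const null]; use Y(1,2) Y_le in simp)+
  define M where "M m = 2 * real n * c * (Y1 m + Y2 m) + 2 * c * \<bar>Y1 m - Y2 m\<bar>" for m
  have "(\<lambda>m. 2 * real n * c * (Y1 m + Y2 m) + 2 * c * \<bar>Y1 m - Y2 m\<bar>) \<longlonglongrightarrow> 2 * real n * c * (0 + 0) + 2 * c * \<bar>0 - 0\<bar>"
    by (intro tendsto_intros Y0)
  then have M0: "M \<longlonglongrightarrow> 0" by (simp add: M_def[abs_def])
  have M_pos: "M m > 0" for m
  proof -
    have "Y1 m + Y2 m > 0" using Y(1)[of m] Y(2)[of m] Y(3)[of m] by (auto simp: less_le)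
    then have "2 * real n * c * (Y1 m + Y2 m) > 0" using c assms by simp
    moreover have "2 * c * \<bar>Y1 m - Y2 m\<bar> \<ge> 0" using c by simp
    ultimately show ?thesis unfolding M_def by (rule add_pos_nonneg)
  qed
  \<comment> \<open>With this \<open>k\<close> the rescaled points approach the curve of \<open>gate_inequalities\<close>.\<close>
  define k where "k m = nat \<lfloor>sqrt (Q / M m)\<rfloor>" for m
  note P = pinning_scale[OF M0 M_pos Q, folded k_def]
  define KK where "KK m = real (k m) * real (k m)" for m
  have KK: "0 \<le> KK m" for m by (simp add: KK_def)
  define B where "B = Q / (2 * real n * c)"
  have nc: "0 < 2 * real n * c" using c assms by simp
  have bound: "KK m * Y1 m \<in> {0..B}" "KK m * Y2 m \<in> {0..B}" for m
  proof -
    have y: "2 * real n * c * y \<le> M m" if "y \<le> Y1 m + Y2 m" for y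
      using mult_left_mono[OF that, of "2 * real n * c"] nc c by (simp add: M_def add_increasing2)
    have "KK m * y \<le> B" if "y \<le> Y1 m + Y2 m" for y
    proof -
      have "KK m * (2 * real n * c * y) \<le> Q"
        using mult_left_mono[OF y[OF that] KK, of m] P(2)[of m] by (simp add: KK_def)
      then show ?thesis using nc by (simp add: B_def field_simps)
    qed
    then show "KK m * Y1 m \<in> {0..B}" "KK m * Y2 m \<in> {0..B}" using Y(1,2) KK by simp_all
  qed
  have "compact ({0..B} \<times> {0..B})" by (intro compact_Times compact_Icc)
  then have "seq_compact ({0..B} \<times> {0..B})" by (rule compact_imp_seq_compact)
  moreover have "\<forall>m. (KK m * Y1 m, KK m * Y2 m) \<in> {0..B} \<times> {0..B}" using bound by auto
  ultimately obtain l r where l: "l \<in> {0..B} \<times> {0..B}" and r: "strict_mono r"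
    and lim: "((\<lambda>m. (KK m * Y1 m, KK m * Y2 m)) \<circ> r) \<longlonglongrightarrow> l"
    unfolding seq_compact_def by meson
  obtain \<eta>1 \<eta>2 where \<eta>: "l = (\<eta>1, \<eta>2)" by (cases l)
  have lims: "(\<lambda>m. KK (r m) * Y1 (r m)) \<longlonglongrightarrow> \<eta>1" "(\<lambda>m. KK (r m) * Y2 (r m)) \<longlonglongrightarrow> \<eta>2"
    using tendsto_fst[OF lim] tendsto_snd[OF lim] by (simp_all add: \<eta> o_def)
  interpret shrinking n "\<lambda>m. k (r m)" "\<lambda>m. Y1 (r m)" "\<lambda>m. Y2 (r m)" \<eta>1 \<eta>2
  proof
    show "filterlim (\<lambda>m. real (k (r m))) at_top sequentially"
      by (rule filterlim_compose[OF P(1) filterlim_subseq[OF r]])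
  qed (use assms lims Y in \<open>simp_all add: KK_def\<close>)
  have "(\<lambda>m. KK m * M m) \<longlonglongrightarrow> Q" using P(3) by (simp add: KK_def)
  from LIMSEQ_subseq_LIMSEQ[OF this r] have "(\<lambda>m. KK (r m) * M (r m)) \<longlonglongrightarrow> Q" by (simp add: o_def)
  moreover have "(\<lambda>m. 2 * real n * c * (KK (r m) * Y1 (r m) + KK (r m) * Y2 (r m)) +
      2 * c * \<bar>KK (r m) * Y1 (r m) - KK (r m) * Y2 (r m)\<bar>) \<longlonglongrightarrow> 2 * real n * c * (\<eta>1 + \<eta>2) + 2 * c * \<bar>\<eta>1 - \<eta>2\<bar>"
    by (intro tendsto_intros lims)
  moreover have "2 * real n * c * (KK (r m) * Y1 (r m) + KK (r m) * Y2 (r m)) +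
      2 * c * \<bar>KK (r m) * Y1 (r m) - KK (r m) * Y2 (r m)\<bar> = KK (r m) * M (r m)" for m
  proof -
    have "\<bar>KK (r m) * Y1 (r m) - KK (r m) * Y2 (r m)\<bar> = KK (r m) * \<bar>Y1 (r m) - Y2 (r m)\<bar>"
      using KK[of "r m"] by (simp add: abs_mult flip: right_diff_distrib)
    then show ?thesis by (simp add: M_def algebra_simps)
  qed
  ultimately have "2 * real n * c * (\<eta>1 + \<eta>2) + 2 * c * \<bar>\<eta>1 - \<eta>2\<bar> = Q"
    using LIMSEQ_unique by simp
  from gate_inequalities[OF assms s c _ _ this[unfolded Q_def]] l \<eta>
  have "eventually (\<lambda>m. (base_angle n + Y1 (r m), base_angle n + Y2 (r m)) \<in> orbit_tile (word_W n (k (r m)))) sequentially"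
    by (intro eventually_in_tile) (auto simp: s_c_def)
  then obtain m where "(base_angle n + Y1 (r m), base_angle n + Y2 (r m)) \<in> orbit_tile (word_W n (k (r m)))"
    using eventually_happens' sequentially_bot by blast
  moreover have "V n + (Y1 (r m), Y2 (r m)) = (base_angle n + Y1 (r m), base_angle n + Y2 (r m))"
    by (simp add: V_def base_angle_def)
  ultimately show False using Y(5)[of "r m"] by auto
qed

end
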